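(* Let $C_1>0$ and $C_{\mathcal M}>0$. There exist a constant $\kappa_v=\kappa_v(C_1,C_{\mathcal M})>0$, depending only on $C_1$ and $C_{\mathcal M}$, and, for every $\epsilon\in(0,1)$, a constant $\kappa_b(\epsilon)=\kappa_b(\epsilon,C_{\mathcal M})>0$, depending only on $\epsilon$, $C_1$ and $C_{\mathcal M}$, such that the random ball $\hat B_{\beta,\eta}$ built with these constants as described in the context has the following properties. Let $(S_m)_{m\in\mathcal M_n}$, $n\ge 2$, be collections of finite dimensional linear subspaces of $L^2(\mu)$ satisfying H1 and H2 (with constant $C_1$). Let $\beta\in(0,1)$ be such that H3$(\mathcal M,\beta)$ holds (with constant $C_{\mathcal M}$). Let $M_2>0$, $M_\infty>0$, $\eta>0$. (i) For all $n\geq 2$ and every density $s\in B_{2,\infty}(M_2,M_\infty,\eta,S_n)$, $$\mathbb P_s\left(s\in\hat B_{\beta,\eta}\right)\ge 1-\beta .$$ (ii) There exists a constant $\kappa$ (which may depend on $C_1,C_{\mathcal M},M_2,M_\infty$, but not on $n$, $m$, the dimensions of the spaces, $\eta$, $\eta_m$, $\alpha$ or $\beta$) such that, for all $n\ge 2$, all $m\in\mathcal M_n$, all $\eta_m>0$ and all $\alpha\in(0,1)$ such that H3$(\mathcal M,\alpha)$ also holds (with constant $C_{\mathcal M}$), $$\Delta^2_{(B_{2,\infty}(M_2,M_\infty,\eta_m,S_m),\alpha)}(\hat B_{\beta,\eta})\le \kappa\left(\Big(\eta_m^2+\frac{d_m}{n}\Big)\vee\Big(\eta^2+\frac{\sq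rt{d_n}\,\ln(N_n/(\alpha\beta))}{n}\Big)\right).$$
   Context: Notation. $\mu$ is Lebesgue measure on $\mathbb R$; $\|\cdot\|$ and $\langle\cdot,\cdot\rangle$ are the norm and scalar product of $L^2(\mu)$; $\|\cdot\|_\infty$ is the sup-norm; $a\wedge b=\min(a,b)$, $a\vee b=\max(a,b)$. A density is a probability density with respect to $\mu$. For a density $s$, $\mathbb P_s$ is the law of an i.i.d. sample $X_1,\dots,X_n$ with common density $s$. $P_nt=\frac1n\sum_{i=1}^n t(X_i)$. $\pi_S$ is the orthogonal projection onto a closed subspace $S$ and $$B_{2,\infty}(C,C',\eta,S)=\{t\in L^2(\mu)\cap L^\infty(\mu):\ \|t\|\le C,\ \|t\|_\infty\le C',\ \|t-\pi_S(t)\|\le\eta\}.$$ The $L^2$-diameter of a set $\mathcal F$ is $\Delta(\mathcal F)=\sup_{t,t'\in\mathcal F}\|t-t'\|$. For a random set $\hat B\subset L^2(\mu)$, a set $\mathcal S$ of functions and $\alpha\in(0,1)$, $$\Delta_{(\mathcal S,\alpha)}(\hat B)=\inf\Big\{\delta>0:\ \sup_{s\in\mathcal S,\ s\text{ a density}}\mathbb P_s(\Delta(\hat B)>\delta)\le\alpha\Big\}.$$ Assumptions. For each $n\ge2$, $(S_m)_{m\in\mathcal M_n}$ is a collection of linear subspaces of $L^2(\mu)$ with finite dimensions $d_m$. H1: there is $m_n\in\mathcal M_n$ with $S_{m_n}=\mathrm{Span}(\bigcup_{m\in\mathcal M_n}S_m)$; one writes $S_n=S_{m_n}$, $d_n=d_{m_n}$.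 H2: for all $m\in\mathcal M_n$ and all $t\in S_m$, $\|t\|_\infty\le C_1\sqrt{d_m}\,\|t\|$. H3$(\mathcal M,\beta)$: for all $n\ge2$, $N_n=\mathrm{Card}(\mathcal M_n)$ is finite and $2\sqrt{d_n}\ln(6N_n/\beta)/n\le C_{\mathcal M}$. Construction. A resampling scheme $(W_1,\dots,W_n)$ is an exchangeable vector of real random variables independent of $(X_1,\dots,X_n)$; $\bar W_n=\frac1n\sum_iW_i$; $0<\mathrm{Var}(W_1-\bar W_n)<\infty$; $P_n^Wt=\frac1n\sum_iW_it(X_i)$; $\mathbb E_W(\cdot)=\mathbb E(\cdot\mid X_1,\dots,X_n)$. One such scheme is fixed for each $n$. For an orthonormal basis $(\psi_\lambda)_{\lambda\in\Lambda_m}$ of $S_m$, let $\hat s_m=\sum_{\lambda\in\Lambda_m}(P_n\psi_\lambda)\psi_\lambda$ (projection estimator) and $$p_W(S_m)=\frac{1}{\mathrm{Var}(W_1-\bar W_n)}\sum_{\lambda\in\Lambda_m}\mathbb E_W\big([(P_n^W-\bar W_nP_n)\psi_\lambda]^2\big).$$ For $S_m\subset S_n$ and an orthonormal basis $(\psi_\lambda)_{\lambda\in\Lambda_n}$ of $S_n$ such that $(\psi_\lambda)_{\lambda\in\Lambda_m}$, $\Lambda_m\subset\Lambda_n$, is a basis of $S_m$, let $$p_b(S_m,S_n)=\frac1{n(n-1)}\sum_{i\ne j=1}^n\ \sum_{\lambda\in\Lambda_n\setminus\Lambda_m}\psi_\lambda(X_i)\psi_\lambda(X_j).$$ (These quantities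 do not depend on the bases.) Put $$V(m,\beta)=p_W(S_m)+\kappa_v\Big(1+\sqrt{M_\infty\wedge M_2d_m^{1/2}\wedge d_m}\Big)\frac{\sqrt{d_m}\,x_n}{n},\qquad x_n=2\ln(2N_n/\beta)\vee2,$$ $$K(m,\beta)=\inf_{\epsilon\in(0,1)}\left\{\frac{p_b(S_m,S_n)}{1-\epsilon}+\frac{\kappa_b(\epsilon)}{1-\epsilon}\Big(1+\sqrt{M_\infty\wedge M_2d_n^{1/2}}\Big)\frac{\sqrt{d_n}\,x_n'}{n}\right\},\qquad x_n'=2\ln(6N_n/\beta)\vee2,$$ $$\hat\rho(m,\eta,\beta)=\sqrt{\eta^2+K(m,\beta)+V(m,\beta)}$$ (with the convention that the square root of a negative number is $0$), $\hat m\in\arg\min_{m\in\mathcal M_n}\hat\rho(m,\eta,\beta)$, and $$\hat B_{\beta,\eta}=\{t\in L^2(\mu):\ \|t-\hat s_{\hat m}\|\le\hat\rho(\hat m,\eta,\beta)\}.$$ *)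

theory Defs
  imports "HOL-Probability.Probability" "HOL-Probability.Essential_Supremum"
    "HOL-Combinatorics.Permutations"
begin

section \<open>The Hilbert space of square integrable functions on the line\<close>

definition sq_integrable :: "(real \<Rightarrow> real) \<Rightarrow> bool" where
  "sq_integrable f \<longleftrightarrow> f \<in> borel_measurable lborel \<and> integrable lborel (\<lambda>x. (f x)\<^sup>2)"

definition l2_rel :: "(real \<Rightarrow> real) \<Rightarrow> (real \<Rightarrow> real) \<Rightarrow> bool" where
  "l2_rel f g \<longleftrightarrow> sq_integrable f \<and> sq_integrable g \<and> (AE x in lborel. f x = g x)"

lemma sq_integrable_zero: "sq_integrable (\<lambda>x. 0)"
  by (simp add: sq_integrable_def)

lemma sq_integrable_mult:
  assumes "sq_integrable f" "sq_integrable g"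
  shows "integrable lborel (\<lambda>x. f x * g x)"
proof (rule Bochner_Integration.integrable_bound)
  show "integrable lborel (\<lambda>x. (f x)\<^sup>2 + (g x)\<^sup>2)"
    using assms by (auto simp: sq_integrable_def)
  show "(\<lambda>x. f x * g x) \<in> borel_measurable lborel"
    using assms by (auto simp: sq_integrable_def)
  have "\<bar>a * b\<bar> \<le> \<bar>a\<^sup>2 + b\<^sup>2\<bar>" for a b :: real
  proof -
    have "0 \<le> (\<bar>a\<bar> - \<bar>b\<bar>)\<^sup>2" by simp
    then have "2 * (\<bar>a\<bar> * \<bar>b\<bar>) \<le> a\<^sup>2 + b\<^sup>2" by (simp add: power2_diff)
    moreover have "0 \<le> \<bar>a\<bar> * \<bar>b\<bar>" by simp
    moreover have "0 \<le> a\<^sup>2 + b\<^sup>2" by simp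
    ultimately show ?thesis unfolding abs_mult by linarith
  qed
  then show "AE x in lborel. norm (f x * g x) \<le> norm ((f x)\<^sup>2 + (g x)\<^sup>2)"
    by simp
qed

lemma sq_integrable_add:
  assumes "sq_integrable f" "sq_integrable g"
  shows "sq_integrable (\<lambda>x. f x + g x)"
  using assms sq_integrable_mult[OF assms]
  by (auto simp: sq_integrable_def power2_sum mult.assoc)

lemma sq_integrable_scale:
  "sq_integrable f \<Longrightarrow> sq_integrable (\<lambda>x. c * f x)"
  by (auto simp: sq_integrable_def power_mult_distrib)

lemma part_equivp_l2_rel: "part_equivp l2_rel"
proof (rule part_equivpI)
  show "\<exists>x. l2_rel x x"
    using sq_integrable_zero by (auto simp: l2_rel_def)
  show "symp l2_rel"
    by (rule sympI) (auto simp: l2_rel_def elim: eventually_mono)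
  show "transp l2_rel"
  proof (rule transpI)
    fix f g h assume "l2_rel f g" "l2_rel g h"
    moreover from this have "AE x in lborel. f x = h x"
      unfolding l2_rel_def by (auto elim: eventually_elim2)
    ultimately show "l2_rel f h" by (auto simp: l2_rel_def)
  qed
qed

text \<open>
  \<open>l2\<close> is the space of classes, modulo equality almost everywhere, of square integrable functions.
  \<open>rep_l2 t\<close> is one fixed representative of \<open>t\<close>; values of \<open>t\<close> at the observations are computed
  with it.  As the observations have a density, another representative changes them only on a
  null event.
\<close>

quotient_type l2 = "real \<Rightarrow> real" / partial: l2_rel
  by (rule part_equivp_l2_rel)

instantiation l2 :: real_inner
begin

lift_definition zero_l2 :: l2 is "\<lambda>x. 0"
  by (simp add: l2_rel_def sq_integrable_zero)

lift_definition plus_l2 :: "l2 \<Rightarrow> l2 \<Rightarrow> l2" is "\<lambda>f g x. f x + g x"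
  by (auto simp: l2_rel_def intro: sq_integrable_add elim: eventually_elim2)

lift_definition scaleR_l2 :: "real \<Rightarrow> l2 \<Rightarrow> l2" is "\<lambda>c f x. c * f x"
  by (auto simp: l2_rel_def intro: sq_integrable_scale elim: eventually_mono)

lift_definition uminus_l2 :: "l2 \<Rightarrow> l2" is "\<lambda>f x. - f x"
  using sq_integrable_scale[of _ "-1"]
  by (auto simp: l2_rel_def elim: eventually_mono)

definition minus_l2 :: "l2 \<Rightarrow> l2 \<Rightarrow> l2" where "minus_l2 f g = f + (- g)"

lift_definition inner_l2 :: "l2 \<Rightarrow> l2 \<Rightarrow> real" is "\<lambda>f g. \<integral>x. f x * g x \<partial>lborel"
  by (rule integral_cong_AE)
     (auto simp: l2_rel_def sq_integrable_def elim: eventually_elim2)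

definition norm_l2 :: "l2 \<Rightarrow> real" where "norm_l2 t = sqrt (inner t t)"

definition dist_l2 :: "l2 \<Rightarrow> l2 \<Rightarrow> real" where "dist_l2 s t = norm (s - t)"

definition sgn_l2 :: "l2 \<Rightarrow> l2" where "sgn_l2 t = inverse (norm t) *\<^sub>R t"

definition uniformity_l2 :: "(l2 \<times> l2) filter" where
  "uniformity_l2 = (INF e\<in>{0 <..}. principal {(x, y). dist x y < e})"

definition open_l2 :: "l2 set \<Rightarrow> bool" where
  "open_l2 U = (\<forall>x\<in>U. eventually (\<lambda>(x', y). x' = x \<longrightarrow> y \<in> U) uniformity)"

instance
proof
  fix a b c :: l2 and r q :: real and U :: "l2 set"
  show "a + b + c = a + (b + c)"
    by transfer (auto simp: l2_rel_def add.assoc intro!: sq_integrable_add)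
  show "a + b = b + a"
    by transfer (auto simp: l2_rel_def add.commute intro!: sq_integrable_add)
  show "0 + a = a"
    by transfer (auto simp: l2_rel_def)
  show "- a + a = 0"
    by transfer (auto simp: l2_rel_def sq_integrable_zero)
  show "a - b = a + - b"
    by (rule minus_l2_def)
  show "r *\<^sub>R (a + b) = r *\<^sub>R a + r *\<^sub>R b"
    by transfer (auto simp: l2_rel_def algebra_simps
      intro!: sq_integrable_add sq_integrable_scale)
  show "(r + q) *\<^sub>R a = r *\<^sub>R a + q *\<^sub>R a"
    by transfer (auto simp: l2_rel_def algebra_simps
      intro!: sq_integrable_add sq_integrable_scale)
  show "r *\<^sub>R q *\<^sub>R a = (r * q) *\<^sub>R a"
    by transfer (auto simp: l2_rel_def mult.assoc intro!: sq_integrable_scale)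
  show "1 *\<^sub>R a = a"
    by transfer (auto simp: l2_rel_def)
  show "inner a b = inner b a"
    by transfer (simp add: mult.commute)
  show "inner (a + b) c = inner a c + inner b c"
    by transfer (auto simp: l2_rel_def distrib_right sq_integrable_mult
      intro!: Bochner_Integration.integral_add)
  show "inner (r *\<^sub>R a) b = r * inner a b"
    by transfer (simp add: mult.assoc)
  show "0 \<le> inner a a"
    by transfer simp
  show "inner a a = 0 \<longleftrightarrow> a = 0"
  proof transfer
    fix f assume f: "l2_rel f f"
    then have "(\<integral>x. f x * f x \<partial>lborel) = 0 \<longleftrightarrow> (AE x in lborel. f x * f x = 0)"
      by (intro integral_nonneg_eq_0_iff_AE) (auto simp: l2_rel_def sq_integrable_mult)
    with f show "(\<integral>x. f x * f x \<partial>lborel) = 0 \<longleftrightarrow> l2_rel f (\<lambda>x. 0)"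
      by (auto simp: l2_rel_def sq_integrable_zero)
  qed
  show "norm a = sqrt (inner a a)"
    by (rule norm_l2_def)
  show "dist a b = norm (a - b)"
    by (rule dist_l2_def)
  show "sgn a = inverse (norm a) *\<^sub>R a"
    by (rule sgn_l2_def)
  show "uniformity = (INF e\<in>{0 <..}. principal {(x::l2, y). dist x y < e})"
    by (rule uniformity_l2_def)
  show "open U = (\<forall>x\<in>U. eventually (\<lambda>(x', y). x' = x \<longrightarrow> y \<in> U) uniformity)"
    by (rule open_l2_def)
qed

end

definition sup_norm :: "l2 \<Rightarrow> ereal" where
  "sup_norm t = esssup lborel (\<lambda>x. ereal \<bar>rep_l2 t x\<bar>)"

definition orth_proj :: "l2 set \<Rightarrow> l2 \<Rightarrow> l2" where
  "orth_proj S t = (THE p. p \<in> S \<and> (\<forall>z\<in>S. inner (t - p) z = 0))"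

text \<open>Essential boundedness of \<open>t\<close> is implied by the bound on its essential supremum.\<close>

definition B2inf :: "real \<Rightarrow> real \<Rightarrow> real \<Rightarrow> l2 set \<Rightarrow> l2 set" where
  "B2inf C C' \<eta> S =
     {t. norm t \<le> C \<and> sup_norm t \<le> ereal C' \<and> norm (t - orth_proj S t) \<le> \<eta>}"

definition orthonormal_basis :: "l2 set \<Rightarrow> l2 set \<Rightarrow> bool" where
  "orthonormal_basis B S \<longleftrightarrow>
     finite B \<and> pairwise orthogonal B \<and> (\<forall>b\<in>B. norm b = 1) \<and> span B = S"


section \<open>Sample, resampling scheme and collections of models\<close>

definition is_density :: "l2 \<Rightarrow> bool" where
  "is_density s \<longleftrightarrow>
     (AE x in lborel. 0 \<le> rep_l2 s x) \<and> (\<integral>\<^sup>+x. ennreal (rep_l2 s x) \<partial>lborel) = 1"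

text \<open>Samples and weight vectors of size \<open>n\<close> are functions on \<open>{..<n}\<close>: the observation \<open>X\<^sub>i\<close> of the
  usual numbering is \<open>x (i - 1)\<close>.\<close>

definition sample_law :: "nat \<Rightarrow> l2 \<Rightarrow> (nat \<Rightarrow> real) measure" where
  "sample_law n s = (\<Pi>\<^sub>M i\<in>{..<n}. density lborel (\<lambda>x. ennreal (rep_l2 s x)))"

definition emp_mean :: "nat \<Rightarrow> (nat \<Rightarrow> real) \<Rightarrow> l2 \<Rightarrow> real" where
  "emp_mean n x t = (\<Sum>i<n. rep_l2 t (x i)) / real n"

definition weighted_mean :: "nat \<Rightarrow> (nat \<Rightarrow> real) \<Rightarrow> (nat \<Rightarrow> real) \<Rightarrow> l2 \<Rightarrow> real" where
  "weighted_mean n w x t = (\<Sum>i<n. w i * rep_l2 t (x i)) / real n"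

definition weight_avg :: "nat \<Rightarrow> (nat \<Rightarrow> real) \<Rightarrow> real" where
  "weight_avg n w = (\<Sum>i<n. w i) / real n"

definition weight_var :: "nat \<Rightarrow> (nat \<Rightarrow> real) measure \<Rightarrow> real" where
  "weight_var n Q = prob_space.variance Q (\<lambda>w. w 0 - weight_avg n w)"

text \<open>
  A resampling scheme is represented by the law \<open>Q\<close> of the weight vector.  Finiteness of the
  variance is the integrability condition.
\<close>

definition resampling_scheme :: "nat \<Rightarrow> (nat \<Rightarrow> real) measure \<Rightarrow> bool" where
  "resampling_scheme n Q \<longleftrightarrow>
     prob_space Q \<and> sets Q = sets (\<Pi>\<^sub>M i\<in>{..<n}. (borel :: real measure)) \<and>
     (\<forall>\<pi>. \<pi> permutes {..<n} \<longrightarrow>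
        distr Q (\<Pi>\<^sub>M i\<in>{..<n}. borel) (\<lambda>w. \<lambda>i\<in>{..<n}. w (\<pi> i)) = Q) \<and>
     integrable Q (\<lambda>w. (w 0 - weight_avg n w)\<^sup>2) \<and> 0 < weight_var n Q"

text \<open>
  The models \<open>S n m\<close> are indexed by \<open>m \<in> M n\<close> with \<open>M n\<close> a set of natural numbers, which loses
  no generality since the index sets are finite.
\<close>

definition models :: "(nat \<Rightarrow> nat set) \<Rightarrow> (nat \<Rightarrow> nat \<Rightarrow> l2 set) \<Rightarrow> bool" where
  "models M S \<longleftrightarrow>
     (\<forall>n\<ge>2. \<forall>m\<in>M n. subspace (S n m) \<and> (\<exists>B. finite B \<and> span B = S n m))"

definition ambient :: "nat set \<Rightarrow> (nat \<Rightarrow> l2 set) \<Rightarrow> l2 set" where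
  "ambient M S = span (\<Union>m\<in>M. S m)"

definition H1 :: "(nat \<Rightarrow> nat set) \<Rightarrow> (nat \<Rightarrow> nat \<Rightarrow> l2 set) \<Rightarrow> bool" where
  "H1 M S \<longleftrightarrow> (\<forall>n\<ge>2. \<exists>m\<in>M n. S n m = ambient (M n) (S n))"

definition H2 :: "real \<Rightarrow> (nat \<Rightarrow> nat set) \<Rightarrow> (nat \<Rightarrow> nat \<Rightarrow> l2 set) \<Rightarrow> bool" where
  "H2 C\<^sub>1 M S \<longleftrightarrow>
     (\<forall>n\<ge>2. \<forall>m\<in>M n. \<forall>t\<in>S n m.
        sup_norm t \<le> ereal (C\<^sub>1 * sqrt (real (dim (S n m))) * norm t))"

definition H3 :: "real \<Rightarrow> (nat \<Rightarrow> nat set) \<Rightarrow> (nat \<Rightarrow> nat \<Rightarrow> l2 set) \<Rightarrow> real \<Rightarrow> bool" where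
  "H3 CM M S \<beta> \<longleftrightarrow>
     (\<forall>n\<ge>2. finite (M n) \<and>
        2 * sqrt (real (dim (ambient (M n) (S n)))) * ln (6 * real (card (M n)) / \<beta>) / real n
          \<le> CM)"

text \<open>
  \<open>B m\<close> plays the role of \<open>(\<psi>\<^sub>\<lambda>)\<close>, \<open>\<lambda> \<in> \<Lambda>\<^sub>m\<close>, and \<open>B' m\<close> is a completion of it to an
  orthonormal basis of the ambient space; the completion may depend on \<open>m\<close>.
\<close>

definition adapted_bases ::
  "nat set \<Rightarrow> (nat \<Rightarrow> l2 set) \<Rightarrow> (nat \<Rightarrow> l2 set) \<Rightarrow> (nat \<Rightarrow> l2 set) \<Rightarrow> bool" where
  "adapted_bases M S B B' \<longleftrightarrow>
     (\<forall>m\<in>M. orthonormal_basis (B m) (S m) \<and> orthonormal_basis (B' m) (ambient M S) \<and>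
        B m \<subseteq> B' m)"


section \<open>The random ball\<close>

definition proj_estimator :: "nat \<Rightarrow> l2 set \<Rightarrow> (nat \<Rightarrow> real) \<Rightarrow> l2" where
  "proj_estimator n B x = (\<Sum>\<psi>\<in>B. emp_mean n x \<psi> *\<^sub>R \<psi>)"

text \<open>
  As the weights are independent of the sample, the conditional expectation given the sample is
  the integral with respect to the law of the weights, the sample being frozen; see
  \<open>cond_exp_freezing\<close> below.  This is the version of the conditional expectation that
  does not depend on the unknown density.
\<close>

definition p_W :: "nat \<Rightarrow> (nat \<Rightarrow> real) measure \<Rightarrow> l2 set \<Rightarrow> (nat \<Rightarrow> real) \<Rightarrow> real" where
  "p_W n Q B x =
     1 / weight_var n Q *
       (\<Sum>\<psi>\<in>B. \<integral>w. (weighted_mean n w x \<psi> - weight_avg n w * emp_mean n x \<psi>)\<^sup>2 \<partial>Q)"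

lemma cond_exp_freezing:
  fixes X :: "'a \<Rightarrow> 'b" and W :: "'a \<Rightarrow> 'b" and F :: "'b \<times> 'b \<Rightarrow> real"
  assumes "prob_space P"
    and indep: "prob_space.indep_var P N X K W"
    and F [measurable]: "F \<in> borel_measurable (N \<Otimes>\<^sub>M K)"
    and int: "integrable P (\<lambda>\<omega>. F (X \<omega>, W \<omega>))"
  shows "AE \<omega> in P. real_cond_exp P (vimage_algebra (space P) X N) (\<lambda>\<omega>. F (X \<omega>, W \<omega>)) \<omega> =
    (\<integral>w. F (X \<omega>, w) \<partial>distr P K W)"
proof -
  interpret prob_space P by fact
  have X [measurable]: "X \<in> measurable P N" and W [measurable]: "W \<in> measurable P K"
    using indep by (auto simp: indep_var_eq)
  have joint: "distr P N X \<Otimes>\<^sub>M distr P K W = distr P (N \<Otimes>\<^sub>M K) (\<lambda>\<omega>. (X \<omega>, W \<omega>))"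
    using indep by (simp add: indep_var_distribution_eq)
  interpret DX: prob_space "distr P N X" by (rule prob_space_distr) simp
  interpret DW: prob_space "distr P K W" by (rule prob_space_distr) simp
  interpret D: pair_sigma_finite "distr P N X" "distr P K W" ..
  have sets_X: "sets (vimage_algebra (space P) X N) = {X -` C \<inter> space P | C. C \<in> sets N}"
    by (rule sets_vimage_algebra2) (use measurable_space[OF X] in auto)
  have sub: "subalgebra P (vimage_algebra (space P) X N)"
    unfolding subalgebra_def sets_X by auto
  interpret finite_measure_subalgebra P "vimage_algebra (space P) X N"
    by standard (rule sub)
  define G where "G = (\<lambda>y. \<integral>w. F (y, w) \<partial>distr P K W)"
  have G [measurable]: "G \<in> borel_measurable N"
  proof -
    have "(\<lambda>y. \<integral>w. F (y, w) \<partial>distr P K W) \<in> borel_measurable N"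
      by (rule DW.borel_measurable_lebesgue_integral) simp
    then show ?thesis by (simp add: G_def)
  qed
  have int2: "integrable (distr P N X \<Otimes>\<^sub>M distr P K W) F"
    unfolding joint by (subst integrable_distr_eq) (auto intro: int)
  have intG: "integrable (distr P N X) G"
    using D.integrable_fst'[OF int2] by (simp add: G_def)
  have "AE \<omega> in P. real_cond_exp P (vimage_algebra (space P) X N) (\<lambda>\<omega>. F (X \<omega>, W \<omega>)) \<omega> = G (X \<omega>)"
  proof (rule real_cond_exp_charact)
    show "integrable P (\<lambda>\<omega>. F (X \<omega>, W \<omega>))" by fact
    show "integrable P (\<lambda>\<omega>. G (X \<omega>))"
      using intG by (simp add: integrable_distr_eq)
    show "(\<lambda>\<omega>. G (X \<omega>)) \<in> borel_measurable (vimage_algebra (space P) X N)"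
    proof (rule measurable_compose[OF _ G])
      show "X \<in> vimage_algebra (space P) X N \<rightarrow>\<^sub>M N"
        by (rule measurable_vimage_algebra1) (use measurable_space[OF X] in auto)
    qed
    fix A assume "A \<in> sets (vimage_algebra (space P) X N)"
    then obtain C where C [measurable]: "C \<in> sets N" and A: "A = X -` C \<inter> space P"
      by (auto simp: sets_X)
    let ?H = "\<lambda>z. indicator C (fst z) * F z"
    have intH: "integrable (distr P N X \<Otimes>\<^sub>M distr P K W) ?H"
      by (rule Bochner_Integration.integrable_bound[OF int2])
         (auto simp: indicator_def split: if_splits)
    have "(\<integral>\<omega>\<in>A. F (X \<omega>, W \<omega>) \<partial>P) = (\<integral>\<omega>. ?H (X \<omega>, W \<omega>) \<partial>P)"
      unfolding set_lebesgue_integral_def A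
      by (rule Bochner_Integration.integral_cong) (auto simp: indicator_def)
    also have "\<dots> = (\<integral>z. ?H z \<partial>(distr P N X \<Otimes>\<^sub>M distr P K W))"
      unfolding joint by (subst integral_distr) auto
    also have "\<dots> = (\<integral>y. \<integral>w. ?H (y, w) \<partial>distr P K W \<partial>distr P N X)"
      using D.integral_fst'[OF intH] by simp
    also have "\<dots> = (\<integral>y. indicator C y * G y \<partial>distr P N X)"
      by (simp add: G_def)
    also have "\<dots> = (\<integral>\<omega>. indicator C (X \<omega>) * G (X \<omega>) \<partial>P)"
      by (subst integral_distr) auto
    also have "\<dots> = (\<integral>\<omega>\<in>A. G (X \<omega>) \<partial>P)"
      unfolding set_lebesgue_integral_def A
      by (rule Bochner_Integration.integral_cong) (auto simp: indicator_def)
    finally show "(\<integral>\<omega>\<in>A. F (X \<omega>, W \<omega>) \<partial>P) = (\<integral>\<omega>\<in>A. G (X \<omega>) \<partial>P)" .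
  qed
  then show ?thesis by (simp add: G_def)
qed

definition p_b :: "nat \<Rightarrow> l2 set \<Rightarrow> l2 set \<Rightarrow> (nat \<Rightarrow> real) \<Rightarrow> real" where
  "p_b n B B' x =
     1 / (real n * (real n - 1)) *
       (\<Sum>i<n. \<Sum>j\<in>{..<n} - {i}. \<Sum>\<psi>\<in>B' - B. rep_l2 \<psi> (x i) * rep_l2 \<psi> (x j))"

definition V_term ::
  "real \<Rightarrow> real \<Rightarrow> real \<Rightarrow> nat \<Rightarrow> nat set \<Rightarrow> (nat \<Rightarrow> l2 set) \<Rightarrow> (nat \<Rightarrow> real) measure \<Rightarrow>
   (nat \<Rightarrow> l2 set) \<Rightarrow> real \<Rightarrow> (nat \<Rightarrow> real) \<Rightarrow> nat \<Rightarrow> real" where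
  "V_term \<kappa>v M2 Minf n M S Q B \<beta> x m =
     (let d = real (dim (S m)); xn = max (2 * ln (2 * real (card M) / \<beta>)) 2
      in p_W n Q (B m) x +
         \<kappa>v * (1 + sqrt (min (min Minf (M2 * sqrt d)) d)) * (sqrt d * xn / real n))"

text \<open>The infimum is taken in the extended reals, as it can be \<open>-\<infinity>\<close>.\<close>

definition K_term ::
  "(real \<Rightarrow> real) \<Rightarrow> real \<Rightarrow> real \<Rightarrow> nat \<Rightarrow> nat set \<Rightarrow> (nat \<Rightarrow> l2 set) \<Rightarrow>
   (nat \<Rightarrow> l2 set) \<Rightarrow> (nat \<Rightarrow> l2 set) \<Rightarrow> real \<Rightarrow> (nat \<Rightarrow> real) \<Rightarrow> nat \<Rightarrow> ereal" where
  "K_term \<kappa>b M2 Minf n M S B B' \<beta> x m =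
     (let dn = real (dim (ambient M S)); xn' = max (2 * ln (6 * real (card M) / \<beta>)) 2
      in INF \<epsilon>\<in>{0<..<1}. ereal
           (p_b n (B m) (B' m) x / (1 - \<epsilon>) +
            \<kappa>b \<epsilon> / (1 - \<epsilon>) * (1 + sqrt (min Minf (M2 * sqrt dn))) * (sqrt dn * xn' / real n)))"

text \<open>The \<open>max\<close> is the convention that the square root of a negative number is \<open>0\<close>; the argument
  of \<open>real_of_ereal\<close> is always finite.\<close>

definition rho_hat ::
  "real \<Rightarrow> (real \<Rightarrow> real) \<Rightarrow> real \<Rightarrow> real \<Rightarrow> nat \<Rightarrow> nat set \<Rightarrow> (nat \<Rightarrow> l2 set) \<Rightarrow>
   (nat \<Rightarrow> real) measure \<Rightarrow> (nat \<Rightarrow> l2 set) \<Rightarrow> (nat \<Rightarrow> l2 set) \<Rightarrow> real \<Rightarrow> real \<Rightarrow>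
   (nat \<Rightarrow> real) \<Rightarrow> nat \<Rightarrow> real" where
  "rho_hat \<kappa>v \<kappa>b M2 Minf n M S Q B B' \<eta> \<beta> x m =
     sqrt (real_of_ereal (max 0
       (ereal (\<eta>\<^sup>2) + K_term \<kappa>b M2 Minf n M S B B' \<beta> x m +
        ereal (V_term \<kappa>v M2 Minf n M S Q B \<beta> x m))))"

text \<open>The selected index is a measurable function of the sample.\<close>

definition selector ::
  "nat \<Rightarrow> nat set \<Rightarrow> ((nat \<Rightarrow> real) \<Rightarrow> nat \<Rightarrow> real) \<Rightarrow> ((nat \<Rightarrow> real) \<Rightarrow> nat) \<Rightarrow> bool" where
  "selector n M \<rho> mhat \<longleftrightarrow>
     mhat \<in> (\<Pi>\<^sub>M i\<in>{..<n}. (borel :: real measure)) \<rightarrow>\<^sub>M count_space UNIV \<and>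
     (\<forall>x\<in>space (\<Pi>\<^sub>M i\<in>{..<n}. (borel :: real measure)).
        is_arg_min (\<rho> x) (\<lambda>m. m \<in> M) (mhat x))"

definition B_hat ::
  "nat \<Rightarrow> (nat \<Rightarrow> l2 set) \<Rightarrow> ((nat \<Rightarrow> real) \<Rightarrow> nat \<Rightarrow> real) \<Rightarrow> ((nat \<Rightarrow> real) \<Rightarrow> nat) \<Rightarrow>
   (nat \<Rightarrow> real) \<Rightarrow> l2 set" where
  "B_hat n B \<rho> mhat x =
     {t. norm (t - proj_estimator n (B (mhat x)) x) \<le> \<rho> x (mhat x)}"

text \<open>\<open>diameter\<close> is only meaningful for bounded sets; it is applied below to balls.\<close>

definition Delta_risk :: "nat \<Rightarrow> l2 set \<Rightarrow> real \<Rightarrow> ((nat \<Rightarrow> real) \<Rightarrow> l2 set) \<Rightarrow> ennreal" where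
  "Delta_risk n \<S> \<alpha> Bh =
     Inf (ennreal ` {\<delta>. 0 < \<delta> \<and>
       (SUP s\<in>{s \<in> \<S>. is_density s}.
          emeasure (sample_law n s) {x \<in> space (sample_law n s). \<delta> < diameter (Bh x)})
         \<le> ennreal \<alpha>})"

end

theory Submission
  imports Defs
begin

text \<open>
  Both assertions rest on two exact identities.  For a finite orthonormal family \<open>F\<close> put
  \<open>U\<^sub>F = 1 / (n (n - 1)) \<Sum>\<^bsub>i \<noteq> j\<^esub> \<Sum>\<^bsub>\<psi> \<in> F\<^esub> (\<psi>(X\<^sub>i) - \<langle>s, \<psi>\<rangle>) (\<psi>(X\<^sub>j) - \<langle>s, \<psi>\<rangle>)\<close>, a U-statistic with a
  degenerate kernel.  Exchangeability and \<open>\<Sum>\<^sub>i (W\<^sub>i - W') = 0\<close>, where \<open>W'\<close> is the mean of the weights, force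
  the covariance of \<open>W\<^sub>i - W'\<close> and \<open>W\<^sub>j - W'\<close> to be \<open>- v / (n - 1)\<close> with \<open>v\<close> their variance; hence
  \<open>p\<^sub>W\<close> is the unbiased estimator of the variance of the projection estimator whatever the scheme
  is, and the squared distance from this estimator to the projection of \<open>s\<close> is \<open>p\<^sub>W + U\<^sub>F\<close> for a
  basis \<open>F\<close> of the model (\<open>proj_error_eq\<close>).  In the same way \<open>p\<^sub>b\<close>
  is the squared bias plus a centred sum of independent terms plus \<open>U\<^sub>F\<close> for the added basis vectors
  \<open>F\<close> (\<open>p_b_eq\<close>).

  The heart of the proof is the tail of \<open>U\<^sub>F\<close> at the level
  \<open>\<kappa> (1 + \<surd>\<mu>) \<surd>d x / n\<close>, where \<open>d\<close> is the dimension and \<open>\<mu> = min (M\<^sub>\<infinity>, M\<^sub>2 \<surd>d, d)\<close> bounds, up to a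
  constant, the second moment of \<open>t(X)\<close> for \<open>t\<close> in the unit ball.  As only levels \<open>x\<close> with
  \<open>\<surd>d x \<le> C\<^sub>M n\<close> occur, moments of order \<open>p\<close> comparable to \<open>x\<close> suffice, and these are bounded by
  a direct combinatorial argument.  The \<open>p\<close>-th power of a sum of \<open>k(X\<^sub>i, X\<^sub>j)\<close> over \<open>i \<noteq> j\<close> expands into products of \<open>k\<close> along
  the edges of multigraphs with \<open>p\<close> edges.  A vertex of degree one makes the expectation vanish.  If
  all degrees are at least two, with \<open>|k| \<le> A\<close> and second moments of the sections at most \<open>b\<^sup>2\<close>, the
  vertices are integrated out one at a time, once in increasing and once in decreasing order: a
  vertex joined to \<open>r\<close> vertices still present gains a factor \<open>(b / A)\<^bsup>min(2, r)\<^esup>\<close>, and each vertex gains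
  at least two such factors over the two orders.  So one of the orders gives \<open>A\<^bsup>p\<^esup> (b / A)\<^bsup>v\<^esup>\<close> for \<open>v\<close>
  vertices (\<open>abs_integral_edges_le\<close>), and counting the multigraphs yields the bound
  \<open>(6 p (p A + n b))\<^bsup>p\<^esup>\<close> (\<open>off_diag_sum_moment_le\<close>).  For \<open>U\<^sub>F\<close> one has \<open>A\<close> of order \<open>d\<close> and \<open>b\<close> of
  order \<open>\<surd>(\<mu> d)\<close>, so \<open>p A\<close> is at most of order \<open>n \<surd>d\<close> and Markov's inequality gives the level
  above.  The linear part of \<open>p\<^sub>b\<close> is handled by a Bernstein inequality; it is at most
  \<open>\<epsilon>\<close> times the squared bias plus a term of the order \<open>(1 + \<surd>\<mu>) \<surd>d x / (\<epsilon> n)\<close>, for all \<open>\<epsilon>\<close> on the same event.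

  Outside exceptional events of total probability at most \<open>\<beta>\<close>, Pythagoras then shows that every ball
  of the collection contains \<open>s\<close>, hence so does the selected one.  For the diameter, the radius is
  minimal at the selected index, so the radius at the given \<open>m\<close> has to be bounded: \<open>p\<^sub>W\<close> is almost surely at most a
  constant times \<open>d\<^sub>m / n\<close>, and \<open>p\<^sub>b\<close> is at most \<open>3 / 2\<close> times the squared bias plus the deviation terms.
\<close>

section \<open>Integrating a product of kernels along the edges of a multigraph\<close>

text \<open>
  One vertex is integrated out.  With a single factor the second moment bounds the first; with more
  factors two of them are paired by \<open>2 \<bar>u v\<bar> \<le> u\<^sup>2 + v\<^sup>2\<close> and the others are bounded by \<open>A\<close>.  Hence
  at most two factors \<open>b / A\<close> are gained.
\<close>

lemma (in prob_space) nn_integral_prod_abs_le: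
  fixes u :: "'e \<Rightarrow> 'a \<Rightarrow> real"
  assumes fin: "finite E" and b: "0 < b" "b \<le> A"
    and meas: "\<And>e. e \<in> E \<Longrightarrow> u e \<in> borel_measurable M"
    and bound: "\<And>e y. e \<in> E \<Longrightarrow> y \<in> space M \<Longrightarrow> \<bar>u e y\<bar> \<le> A"
    and sec: "\<And>e. e \<in> E \<Longrightarrow> (\<integral>\<^sup>+y. ennreal ((u e y)\<^sup>2) \<partial>M) \<le> ennreal (b\<^sup>2)"
  shows "(\<integral>\<^sup>+y. ennreal (\<Prod>e\<in>E. \<bar>u e y\<bar>) \<partial>M) \<le> ennreal (A ^ card E * (b / A) ^ min 2 (card E))"
proof -
  have A: "0 < A" using b by simp
  consider "card E = 0" | "card E = 1" | "2 \<le> card E" by linarith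
  then show ?thesis
  proof cases
    case 1
    then show ?thesis using fin by (simp add: emeasure_space_1)
  next
    case 2
    then obtain e where e: "E = {e}" by (auto simp: card_1_singleton_iff)
    have "(\<integral>\<^sup>+y. ennreal (\<Prod>e\<in>E. \<bar>u e y\<bar>) \<partial>M)
        \<le> (\<integral>\<^sup>+y. ennreal (1 / (2*b)) * ennreal ((u e y)\<^sup>2) + ennreal (b / 2) \<partial>M)"
    proof (rule nn_integral_mono)
      fix y
      have "0 \<le> (\<bar>u e y\<bar> - b)\<^sup>2" by simp
      then have "2 * b * \<bar>u e y\<bar> \<le> (u e y)\<^sup>2 + b\<^sup>2" by (simp add: power2_diff algebra_simps)
      then have "\<bar>u e y\<bar> \<le> 1 / (2*b) * (u e y)\<^sup>2 + b / 2"
        using b by (simp add: field_simps power2_eq_square)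
      then show "ennreal (\<Prod>e\<in>E. \<bar>u e y\<bar>) \<le> ennreal (1 / (2*b)) * ennreal ((u e y)\<^sup>2) + ennreal (b / 2)"
        using b e by (simp flip: ennreal_mult ennreal_plus add: ennreal_leI)
    qed
    also have "\<dots> = ennreal (1 / (2*b)) * (\<integral>\<^sup>+y. ennreal ((u e y)\<^sup>2) \<partial>M) + ennreal (b / 2)"
      using meas[of e] e by (simp add: nn_integral_add nn_integral_cmult emeasure_space_1)
    also have "\<dots> \<le> ennreal (1 / (2*b)) * ennreal (b\<^sup>2) + ennreal (b / 2)"
      by (intro add_right_mono mult_left_mono sec) (auto simp: e)
    also have "\<dots> = ennreal b"
      using b by (simp flip: ennreal_mult ennreal_plus add: power2_eq_square)
    finally show ?thesis using A e by simp
  next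
    case 3
    then obtain e1 e2 where e: "e1 \<in> E" "e2 \<in> E" "e1 \<noteq> e2"
      by (metis card_le_Suc0_iff_eq fin not_less_eq_eq numeral_2_eq_2)
    define E' where "E' = E - {e1, e2}"
    have cE: "card E = card E' + 2"
      using e fin 3 by (simp add: E'_def card_Diff_insert card_Diff_subset)
    have E: "E = insert e1 (insert e2 E')" "e1 \<notin> E'" "e2 \<notin> E'" "finite E'"
      using e fin by (auto simp: E'_def)
    have "(\<integral>\<^sup>+y. ennreal (\<Prod>e\<in>E. \<bar>u e y\<bar>) \<partial>M)
       \<le> (\<integral>\<^sup>+y. ennreal (A ^ card E' / 2) * (ennreal ((u e1 y)\<^sup>2) + ennreal ((u e2 y)\<^sup>2)) \<partial>M)"
    proof (rule nn_integral_mono)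
      fix y assume y: "y \<in> space M"
      have "(\<Prod>e\<in>E. \<bar>u e y\<bar>) = (\<bar>u e1 y\<bar> * \<bar>u e2 y\<bar>) * (\<Prod>e\<in>E'. \<bar>u e y\<bar>)"
        using E e by simp
      also have "\<dots> \<le> (((u e1 y)\<^sup>2 + (u e2 y)\<^sup>2) / 2) * A ^ card E'"
      proof (rule mult_mono)
        have "0 \<le> (\<bar>u e1 y\<bar> - \<bar>u e2 y\<bar>)\<^sup>2" by simp
        then show "\<bar>u e1 y\<bar> * \<bar>u e2 y\<bar> \<le> ((u e1 y)\<^sup>2 + (u e2 y)\<^sup>2) / 2"
          by (simp add: power2_diff algebra_simps)
        have "(\<Prod>e\<in>E'. \<bar>u e y\<bar>) \<le> (\<Prod>e\<in>E'. A)"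
          using bound y by (intro prod_mono) (auto simp: E'_def)
        then show "(\<Prod>e\<in>E'. \<bar>u e y\<bar>) \<le> A ^ card E'" by simp
      qed (auto intro: prod_nonneg)
      finally show "ennreal (\<Prod>e\<in>E. \<bar>u e y\<bar>)
          \<le> ennreal (A ^ card E' / 2) * (ennreal ((u e1 y)\<^sup>2) + ennreal ((u e2 y)\<^sup>2))"
        using A by (simp flip: ennreal_mult ennreal_plus add: ennreal_leI mult.commute)
    qed
    also have "\<dots> = ennreal (A ^ card E' / 2) *
        ((\<integral>\<^sup>+y. ennreal ((u e1 y)\<^sup>2) \<partial>M) + (\<integral>\<^sup>+y. ennreal ((u e2 y)\<^sup>2) \<partial>M))"
      using meas e by (simp add: nn_integral_add nn_integral_cmult)
    also have "\<dots> \<le> ennreal (A ^ card E' / 2) * (ennreal (b\<^sup>2) + ennreal (b\<^sup>2))"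
      by (intro mult_left_mono add_mono sec e) simp
    also have "\<dots> = ennreal (A ^ card E' * b\<^sup>2)"
      using A by (simp flip: ennreal_mult ennreal_plus)
    also have "A ^ card E' * b\<^sup>2 = A ^ card E * (b / A) ^ min 2 (card E)"
      using cE A by (simp add: min_def power_add power_divide power2_eq_square)
    finally show ?thesis .
  qed
qed

text \<open>
  The condition \<open>b \<le> A\<close> makes every factor \<open>b / A\<close> a gain, so that moment bounds may drop some of them.
\<close>

locale bounded_kernel = prob_space P for P :: "'a measure" +
  fixes k :: "'a \<Rightarrow> 'a \<Rightarrow> real" and A b :: real
  assumes kernel_measurable [measurable]: "case_prod k \<in> borel_measurable (P \<Otimes>\<^sub>M P)"
    and kernel_sym: "k x y = k y x"
    and kernel_bound: "x \<in> space P \<Longrightarrow> y \<in> space P \<Longrightarrow> \<bar>k x y\<bar> \<le> A"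
    and kernel_second_moment:
      "x \<in> space P \<Longrightarrow> (\<integral>\<^sup>+y. ennreal ((k x y)\<^sup>2) \<partial>P) \<le> ennreal (b\<^sup>2)"
    and b_pos: "0 < b" and b_le_A: "b \<le> A"
begin

lemma A_pos: "0 < A" using b_pos b_le_A by simp

sublocale prod: product_prob_space "\<lambda>_ :: nat. P" UNIV ..

lemma kernel_edge_measurable [measurable]:
  assumes "i \<in> I" "j \<in> I"
  shows "(\<lambda>x. k (x i) (x j)) \<in> borel_measurable (Pi\<^sub>M I (\<lambda>_. P))"
proof -
  have "(\<lambda>x. case_prod k (x i, x j)) \<in> borel_measurable (Pi\<^sub>M I (\<lambda>_. P))"
    by (rule measurable_compose[OF _ kernel_measurable]) (use assms in measurable)
  then show ?thesis by simp
qed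

text \<open>
  The vertices are integrated out in decreasing \<open>rank\<close>: when \<open>v\<close> is removed, exactly the edges with
  upper end \<open>v\<close> are still present and depend on \<open>v\<close>.  An arbitrary rank allows the same
  lemma to be used for the natural order and for its reverse.
\<close>

lemma nn_integral_edges_le:
  fixes rank :: "nat \<Rightarrow> int" and lo hi :: "'e \<Rightarrow> nat"
  assumes "finite I" and "finite E"
    and "\<And>e. e \<in> E \<Longrightarrow> lo e \<in> I \<and> hi e \<in> I \<and> rank (lo e) < rank (hi e)"
  shows "(\<integral>\<^sup>+x. ennreal (\<Prod>e\<in>E. \<bar>k (x (lo e)) (x (hi e))\<bar>) \<partial>Pi\<^sub>M I (\<lambda>_. P))
    \<le> ennreal (A ^ card E * (b / A) ^ (\<Sum>v\<in>I. min 2 (card {e\<in>E. hi e = v})))"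
  using assms
proof (induction I arbitrary: E rule: finite_ranking_induct[where f = rank])
  case empty
  then have "E = {}" by auto
  then show ?case by (simp add: PiM_empty nn_integral_count_space_finite)
next
  case (insert v I)
  show ?case
  proof (cases "v \<in> I")
    case True
    then show ?thesis using insert.IH[OF insert.prems(1)] insert.prems(2) by (simp add: insert_absorb)
  next
    case False
    define E1 where "E1 = {e\<in>E. hi e = v}"
    define E0 where "E0 = {e\<in>E. hi e \<noteq> v}"
    have E: "E = E1 \<union> E0" "E1 \<inter> E0 = {}" "finite E1" "finite E0"
      using insert.prems by (auto simp: E1_def E0_def)
    have E1: "lo e \<in> I" "lo e \<noteq> v" "hi e = v" if "e \<in> E1" for e
      using insert.prems(2)[of e] that False by (auto simp: E1_def)
    have E0: "lo e \<in> I" "hi e \<in> I" "rank (lo e) < rank (hi e)" if "e \<in> E0" for e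
    proof -
      have *: "lo e \<in> insert v I" "hi e \<in> insert v I" "rank (lo e) < rank (hi e)" "hi e \<noteq> v"
        using insert.prems(2)[of e] that by (auto simp: E0_def)
      then show "hi e \<in> I" "rank (lo e) < rank (hi e)" by auto
      then have "rank (hi e) \<le> rank v" using insert.hyps by auto
      then show "lo e \<in> I" using * by auto
    qed
    let ?c = "A ^ card E1 * (b / A) ^ min 2 (card E1)"
    have c0: "0 \<le> ?c" using A_pos b_pos by simp
    have meas: "(\<lambda>x. ennreal (\<Prod>e\<in>F. \<bar>k (x (lo e)) (x (hi e))\<bar>)) \<in> borel_measurable (Pi\<^sub>M J (\<lambda>_. P))"
      if "\<And>e. e \<in> F \<Longrightarrow> lo e \<in> J \<and> hi e \<in> J" for F J
      using that by (intro measurable_compose[OF _ measurable_ennreal] borel_measurable_prod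
        borel_measurable_abs kernel_edge_measurable) auto
    have "(\<integral>\<^sup>+x. ennreal (\<Prod>e\<in>E. \<bar>k (x (lo e)) (x (hi e))\<bar>) \<partial>Pi\<^sub>M (insert v I) (\<lambda>_. P))
       = (\<integral>\<^sup>+x. \<integral>\<^sup>+y. ennreal (\<Prod>e\<in>E. \<bar>k ((x(v := y)) (lo e)) ((x(v := y)) (hi e))\<bar>) \<partial>P
            \<partial>Pi\<^sub>M I (\<lambda>_. P))"
      using insert.prems False insert.hyps by (subst prod.product_nn_integral_insert) (auto intro!: meas)
    also have "\<dots> \<le> (\<integral>\<^sup>+x. ennreal (\<Prod>e\<in>E0. \<bar>k (x (lo e)) (x (hi e))\<bar>) * ennreal ?c \<partial>Pi\<^sub>M I (\<lambda>_. P))"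
    proof (rule nn_integral_mono)
      fix x assume x: "x \<in> space (Pi\<^sub>M I (\<lambda>_. P))"
      have xs: "x (lo e) \<in> space P" if "e \<in> E1" for e
        using x E1[OF that] by (auto simp: space_PiM PiE_def Pi_def)
      have km: "(\<lambda>y. k (x (lo e)) y) \<in> borel_measurable P" if "e \<in> E1" for e
        using measurable_compose[OF measurable_Pair1'[OF xs[OF that]] kernel_measurable] by simp
      have "(\<Prod>e\<in>E. \<bar>k ((x(v := y)) (lo e)) ((x(v := y)) (hi e))\<bar>)
         = (\<Prod>e\<in>E0. \<bar>k (x (lo e)) (x (hi e))\<bar>) * (\<Prod>e\<in>E1. \<bar>k (x (lo e)) y\<bar>)" for y
      proof -
        have "(\<Prod>e\<in>E0. \<bar>k ((x(v := y)) (lo e)) ((x(v := y)) (hi e))\<bar>) = (\<Prod>e\<in>E0. \<bar>k (x (lo e)) (x (hi e))\<bar>)"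
          using E0 False by (intro prod.cong) (auto simp: E0_def)
        moreover have "(\<Prod>e\<in>E1. \<bar>k ((x(v := y)) (lo e)) ((x(v := y)) (hi e))\<bar>) = (\<Prod>e\<in>E1. \<bar>k (x (lo e)) y\<bar>)"
          using E1 by (intro prod.cong) auto
        ultimately show ?thesis using E by (simp add: prod.union_disjoint mult.commute)
      qed
      then have "(\<integral>\<^sup>+y. ennreal (\<Prod>e\<in>E. \<bar>k ((x(v := y)) (lo e)) ((x(v := y)) (hi e))\<bar>) \<partial>P)
         = (\<integral>\<^sup>+y. ennreal (\<Prod>e\<in>E0. \<bar>k (x (lo e)) (x (hi e))\<bar>) * ennreal (\<Prod>e\<in>E1. \<bar>k (x (lo e)) y\<bar>) \<partial>P)"
        by (simp add: ennreal_mult prod_nonneg)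
      also have "\<dots> = ennreal (\<Prod>e\<in>E0. \<bar>k (x (lo e)) (x (hi e))\<bar>) * (\<integral>\<^sup>+y. ennreal (\<Prod>e\<in>E1. \<bar>k (x (lo e)) y\<bar>) \<partial>P)"
        by (rule nn_integral_cmult) (use km in measurable)
      also have "\<dots> \<le> ennreal (\<Prod>e\<in>E0. \<bar>k (x (lo e)) (x (hi e))\<bar>) * ennreal ?c"
      proof (rule mult_left_mono)
        show "(\<integral>\<^sup>+y. ennreal (\<Prod>e\<in>E1. \<bar>k (x (lo e)) y\<bar>) \<partial>P) \<le> ennreal ?c"
          by (rule nn_integral_prod_abs_le[where u = "\<lambda>e. k (x (lo e))"])
             (use E b_pos b_le_A km xs kernel_bound kernel_second_moment in blast)+
      qed simp
      finally show "(\<integral>\<^sup>+y. ennreal (\<Prod>e\<in>E. \<bar>k ((x(v := y)) (lo e)) ((x(v := y)) (hi e))\<bar>) \<partial>P)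
        \<le> ennreal (\<Prod>e\<in>E0. \<bar>k (x (lo e)) (x (hi e))\<bar>) * ennreal ?c" .
    qed
    also have "\<dots> = (\<integral>\<^sup>+x. ennreal (\<Prod>e\<in>E0. \<bar>k (x (lo e)) (x (hi e))\<bar>) \<partial>Pi\<^sub>M I (\<lambda>_. P)) * ennreal ?c"
      using E0 by (intro nn_integral_multc meas) auto
    also have "\<dots> \<le> ennreal (A ^ card E0 * (b / A) ^ (\<Sum>v\<in>I. min 2 (card {e\<in>E0. hi e = v}))) * ennreal ?c"
      using E E0 by (intro mult_right_mono insert.IH) auto
    also have "\<dots> = ennreal (A ^ card E * (b / A) ^ (\<Sum>v\<in>insert v I. min 2 (card {e\<in>E. hi e = v})))"
    proof -
      have "(\<Sum>w\<in>insert v I. min 2 (card {e\<in>E. hi e = w}))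
        = min 2 (card E1) + (\<Sum>w\<in>I. min 2 (card {e\<in>E0. hi e = w}))"
      proof -
        have "(\<Sum>w\<in>I. min 2 (card {e\<in>E. hi e = w})) = (\<Sum>w\<in>I. min 2 (card {e\<in>E0. hi e = w}))"
          using False by (intro sum.cong refl arg_cong[of _ _ "\<lambda>X. min 2 (card X)"]) (auto simp: E0_def)
        then show ?thesis using False insert.hyps by (simp add: E1_def)
      qed
      moreover have "card E = card E1 + card E0"
        using E card_Un_disjoint by blast
      ultimately show ?thesis
        using A_pos b_pos c0 by (simp flip: ennreal_mult add: power_add mult_ac)
    qed
    finally show ?thesis .
  qed
qed

end

section \<open>Moments and tails of degenerate U-statistics\<close>

definition off_diag_sum :: "nat \<Rightarrow> ('a \<Rightarrow> 'a \<Rightarrow> real) \<Rightarrow> (nat \<Rightarrow> 'a) \<Rightarrow> real" where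
  "off_diag_sum n k x = (\<Sum>i<n. \<Sum>j\<in>{..<n} - {i}. k (x i) (x j))"

lemma power_self_le_fact: "real v ^ v \<le> 3 ^ v * fact v"
proof -
  have "(\<Sum>i\<in>{v}. inverse (fact i) * real v ^ i) \<le> (\<Sum>i. inverse (fact i) * real v ^ i)"
    by (rule sum_le_suminf[OF summable_exp]) auto
  also have "\<dots> = exp (real v)"
    by (simp add: exp_def scaleR_conv_of_real divide_inverse mult.commute)
  also have "\<dots> = exp 1 ^ v"
    by (simp flip: exp_of_nat_mult)
  also have "\<dots> \<le> 3 ^ v"
    by (intro power_mono exp_le) auto
  finally show ?thesis
    by (simp add: field_simps)
qed

lemma sum_card_fibres:
  assumes "finite E" "finite I" "g ` E \<subseteq> I"
  shows "(\<Sum>v\<in>I. card {e\<in>E. g e = v}) = card E"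
  using sum.group[OF assms, of "\<lambda>_. 1::nat"] by simp

text \<open>
  The count of the multigraphs: \<open>n choose v\<close> vertex sets, at most \<open>v\<^bsup>2 p\<^esup>\<close> sequences of \<open>p\<close> edges
  on each, and a weight \<open>A\<^bsup>p\<^esup> (b / A)\<^bsup>v\<^esup>\<close>.  The factor \<open>1 / v!\<close> of the binomial coefficient absorbs
  \<open>v\<^bsup>v\<^esup>\<close>, which leaves the power \<open>p\<^bsup>2 p - v\<^esup> = p\<^bsup>p\<^esup> p\<^bsup>p - v\<^esup>\<close>.
\<close>

lemma choose_term_le:
  fixes A b :: real
  assumes "0 < b" "0 < A" "v \<le> p" "1 \<le> p"
  shows "real (n choose v) * (real v ^ (2*p) * (A ^ p * (b / A) ^ v)) \<le> (3 * p * (p * A + n * b)) ^ p"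
proof (cases "v = 0")
  case True
  have "0 \<le> (3 * p * (p * A + n * b)) ^ p" using assms by simp
  with True show ?thesis using assms by (simp add: power_0_left)
next
  case False
  let ?s = "p * A + n * b"
  have s: "0 \<le> ?s" "p * A \<le> ?s" "n * b \<le> ?s" using assms by auto
  have ch: "real (n choose v) * fact v \<le> real n ^ v"
    using binomial_fact_pow[of n v] by (metis of_nat_fact of_nat_le_iff of_nat_mult of_nat_power)
  have "real (n choose v) * (real v ^ (2*p) * (A ^ p * (b / A) ^ v))
     = real (n choose v) * real v ^ v * (real v ^ (2*p - v) * (A ^ (p - v) * b ^ v))"
  proof -
    have "real v ^ (2*p) = real v ^ v * real v ^ (2*p - v)"
      using assms by (simp flip: power_add)
    moreover have "A ^ p * (b / A) ^ v = A ^ (p - v) * b ^ v"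
      using assms by (simp add: power_divide power_diff)
    ultimately show ?thesis by (simp add: mult_ac)
  qed
  also have "\<dots> \<le> (3 ^ v * real n ^ v) * (real p ^ (2*p - v) * (A ^ (p - v) * b ^ v))"
  proof (rule mult_mono)
    have "real (n choose v) * real v ^ v \<le> real (n choose v) * (3 ^ v * fact v)"
      by (intro mult_left_mono power_self_le_fact) simp
    also have "\<dots> = 3 ^ v * (real (n choose v) * fact v)" by simp
    also have "\<dots> \<le> 3 ^ v * real n ^ v"
      by (intro mult_left_mono ch) simp
    finally show "real (n choose v) * real v ^ v \<le> 3 ^ v * real n ^ v" .
    show "real v ^ (2*p - v) * (A ^ (p - v) * b ^ v) \<le> real p ^ (2*p - v) * (A ^ (p - v) * b ^ v)"
      using assms by (intro mult_right_mono power_mono) auto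
  qed (use assms in auto)
  also have "\<dots> = 3 ^ v * (real p ^ p * ((p * A) ^ (p - v) * (n * b) ^ v))"
  proof -
    have "2*p - v = p + (p - v)" using assms by simp
    then show ?thesis by (simp add: power_add power_mult_distrib mult_ac)
  qed
  also have "\<dots> \<le> 3 ^ p * (real p ^ p * (?s ^ (p - v) * ?s ^ v))"
    using assms s by (intro mult_mono power_mono power_increasing) auto
  also have "?s ^ (p - v) * ?s ^ v = ?s ^ p"
    using assms by (simp flip: power_add)
  also have "3 ^ p * (real p ^ p * ?s ^ p) = (3 * real p * ?s) ^ p" by (simp add: power_mult_distrib)
  finally show ?thesis .
qed

locale degenerate_kernel = bounded_kernel +
  assumes kernel_mean: "x \<in> space P \<Longrightarrow> (\<integral>y. k x y \<partial>P) = 0"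
begin

lemma prob_space_sample: "prob_space (Pi\<^sub>M I (\<lambda>_. P))"
  by (rule prob_space_PiM) (rule prob_space_axioms)

lemma integrable_edges:
  assumes "finite E" "\<And>e. e \<in> E \<Longrightarrow> lo e \<in> I \<and> hi e \<in> I"
  shows "integrable (Pi\<^sub>M I (\<lambda>_. P)) (\<lambda>x. \<Prod>e\<in>E. k (x (lo e)) (x (hi e)))"
proof -
  interpret S: prob_space "Pi\<^sub>M I (\<lambda>_. P)" by (rule prob_space_sample)
  show ?thesis
  proof (rule S.integrable_const_bound)
    show "AE x in Pi\<^sub>M I (\<lambda>_. P). norm (\<Prod>e\<in>E. k (x (lo e)) (x (hi e))) \<le> A ^ card E"
    proof (rule AE_I2)
      fix x assume "x \<in> space (Pi\<^sub>M I (\<lambda>_. P))"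
      then have "x (lo e) \<in> space P" "x (hi e) \<in> space P" if "e \<in> E" for e
        using assms(2)[OF that] by (auto simp: space_PiM PiE_def Pi_def)
      then have "(\<Prod>e\<in>E. \<bar>k (x (lo e)) (x (hi e))\<bar>) \<le> (\<Prod>e\<in>E. A)"
        using kernel_bound by (intro prod_mono) auto
      then show "norm (\<Prod>e\<in>E. k (x (lo e)) (x (hi e))) \<le> A ^ card E"
        by (simp add: abs_prod)
    qed
    show "(\<lambda>x. \<Prod>e\<in>E. k (x (lo e)) (x (hi e))) \<in> borel_measurable (Pi\<^sub>M I (\<lambda>_. P))"
      using assms by (intro borel_measurable_prod kernel_edge_measurable) auto
  qed
qed

text \<open>
  A vertex on exactly one edge contributes the mean of a section of the kernel, which is zero.
\<close>

lemma integral_edges_eq_0: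
  fixes lo hi :: "'e \<Rightarrow> nat"
  assumes "finite I" "finite E" "\<And>e. e \<in> E \<Longrightarrow> lo e \<in> I \<and> hi e \<in> I \<and> lo e \<noteq> hi e"
    and "card {e\<in>E. lo e = v \<or> hi e = v} = 1"
  shows "(\<integral>x. (\<Prod>e\<in>E. k (x (lo e)) (x (hi e))) \<partial>Pi\<^sub>M I (\<lambda>_. P)) = 0"
proof -
  from assms(4) obtain e0 where e0: "{e\<in>E. lo e = v \<or> hi e = v} = {e0}"
    by (auto simp: card_1_singleton_iff)
  define w where "w = (if lo e0 = v then hi e0 else lo e0)"
  have e0E: "e0 \<in> E" and e0v: "lo e0 = v \<or> hi e0 = v" using e0 by auto
  have v: "v \<in> I" "w \<in> I" "w \<noteq> v"
    using e0v assms(3)[OF e0E] by (auto simp: w_def)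
  have ke0: "k (x (lo e0)) (x (hi e0)) = k (x w) (x v)" for x :: "nat \<Rightarrow> 'a"
    using e0v kernel_sym by (auto simp: w_def)
  have other: "lo e \<noteq> v" "hi e \<noteq> v" if "e \<in> E - {e0}" for e
    using e0 that by auto
  define J where "J = I - {v}"
  have I: "I = insert v J" "v \<notin> J" "finite J" "w \<in> J"
    using v assms(1) by (auto simp: J_def)
  have "(\<integral>x. (\<Prod>e\<in>E. k (x (lo e)) (x (hi e))) \<partial>Pi\<^sub>M I (\<lambda>_. P))
     = (\<integral>x. (\<integral>y. (\<Prod>e\<in>E. k ((x(v := y)) (lo e)) ((x(v := y)) (hi e))) \<partial>P) \<partial>Pi\<^sub>M J (\<lambda>_. P))"
    unfolding I(1) using I integrable_edges[of E lo I hi] assms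
    by (intro prod.product_integral_insert) auto
  also have "\<dots> = (\<integral>x. 0 \<partial>Pi\<^sub>M J (\<lambda>_. P))"
  proof (rule Bochner_Integration.integral_cong[OF refl])
    fix x assume "x \<in> space (Pi\<^sub>M J (\<lambda>_. P))"
    then have xw: "x w \<in> space P" using I by (auto simp: space_PiM PiE_def Pi_def)
    have "(\<Prod>e\<in>E. k ((x(v := y)) (lo e)) ((x(v := y)) (hi e)))
      = k (x w) y * (\<Prod>e\<in>E - {e0}. k (x (lo e)) (x (hi e)))" for y
    proof -
      have "(\<Prod>e\<in>E. k ((x(v := y)) (lo e)) ((x(v := y)) (hi e)))
        = k (x w) y * (\<Prod>e\<in>E - {e0}. k ((x(v := y)) (lo e)) ((x(v := y)) (hi e)))"
        using e0E assms(2) ke0[of "x(v := y)"] v(3) by (subst prod.remove[of E e0]) auto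
      moreover have "(\<Prod>e\<in>E - {e0}. k ((x(v := y)) (lo e)) ((x(v := y)) (hi e)))
        = (\<Prod>e\<in>E - {e0}. k (x (lo e)) (x (hi e)))"
        using other by (intro prod.cong) auto
      ultimately show ?thesis by simp
    qed
    then show "(\<integral>y. (\<Prod>e\<in>E. k ((x(v := y)) (lo e)) ((x(v := y)) (hi e))) \<partial>P) = 0"
      using kernel_mean[OF xw] by simp
  qed
  finally show ?thesis by simp
qed

text \<open>
  Let \<open>r v\<close> and \<open>r' v\<close> be the numbers of edges at \<open>v\<close> that lead to smaller and to larger vertices.
  Their sum is the degree of \<open>v\<close>, so if all degrees are at least two, then
  \<open>min 2 (r v) + min 2 (r' v) \<ge> 2\<close> for every used vertex, and one of the two orders of integration
  gains at least as many factors \<open>b / A\<close> as there are used vertices.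
\<close>

lemma abs_integral_edges_le:
  fixes lo hi :: "'e \<Rightarrow> nat"
  assumes "finite I" "finite E" "\<And>e. e \<in> E \<Longrightarrow> lo e \<in> I \<and> hi e \<in> I \<and> lo e \<noteq> hi e"
  defines "used \<equiv> lo ` E \<union> hi ` E"
  shows "\<bar>\<integral>x. (\<Prod>e\<in>E. k (x (lo e)) (x (hi e))) \<partial>Pi\<^sub>M I (\<lambda>_. P)\<bar>
    \<le> (if card used \<le> card E then A ^ card E * (b / A) ^ card used else 0)"
proof (cases "\<exists>v\<in>used. card {e\<in>E. lo e = v \<or> hi e = v} = 1")
  case True
  then obtain v where v: "card {e\<in>E. lo e = v \<or> hi e = v} = 1" by auto
  show ?thesis using integral_edges_eq_0[where lo = lo and hi = hi, OF assms(1-3) v] A_pos b_pos by simp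
next
  case False
  define r where "r v = card {e\<in>E. max (lo e) (hi e) = v}" for v
  define r' where "r' v = card {e\<in>E. min (lo e) (hi e) = v}" for v
  have finu: "finite used" "used \<subseteq> I" using assms by (auto simp: used_def)
  have deg: "r v + r' v = card {e\<in>E. lo e = v \<or> hi e = v}" for v
  proof -
    have "{e\<in>E. max (lo e) (hi e) = v} \<inter> {e\<in>E. min (lo e) (hi e) = v} = {}"
      using assms(3) by (force simp: max_def min_def split: if_splits)
    then have "r v + r' v = card ({e\<in>E. max (lo e) (hi e) = v} \<union> {e\<in>E. min (lo e) (hi e) = v})"
      unfolding r_def r'_def using assms(2) by (subst card_Un_disjoint) auto
    also have "{e\<in>E. max (lo e) (hi e) = v} \<union> {e\<in>E. min (lo e) (hi e) = v} = {e\<in>E. lo e = v \<or> hi e = v}"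
      by (auto simp: max_def min_def split: if_splits)
    finally show ?thesis .
  qed
  have deg2: "2 \<le> r v + r' v" if "v \<in> used" for v
  proof -
    have "{e\<in>E. lo e = v \<or> hi e = v} \<noteq> {}" using that by (auto simp: used_def)
    then have "card {e\<in>E. lo e = v \<or> hi e = v} \<noteq> 0" using assms(2) by simp
    moreover have "card {e\<in>E. lo e = v \<or> hi e = v} \<noteq> 1" using that False by auto
    ultimately show ?thesis unfolding deg by linarith
  qed
  have "2 * card used = (\<Sum>v\<in>used. 2)" by simp
  also have "\<dots> \<le> (\<Sum>v\<in>used. r v + r' v)" by (intro sum_mono deg2)
  also have "\<dots> \<le> (\<Sum>v\<in>I. r v + r' v)" using finu assms(1) by (intro sum_mono2) auto
  also have "\<dots> = 2 * card E"
  proof -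
    have "(\<Sum>v\<in>I. r v) = card E" unfolding r_def
      using assms by (intro sum_card_fibres) (auto simp: max_def)
    moreover have "(\<Sum>v\<in>I. r' v) = card E" unfolding r'_def
      using assms by (intro sum_card_fibres) (auto simp: min_def)
    ultimately show ?thesis by (simp add: sum.distrib)
  qed
  finally have used_le: "card used \<le> card E" by simp
  define R where "R = (\<Sum>v\<in>I. min 2 (r v))"
  define R' where "R' = (\<Sum>v\<in>I. min 2 (r' v))"
  have "2 * card used = (\<Sum>v\<in>used. 2)" by simp
  also have "\<dots> \<le> (\<Sum>v\<in>used. min 2 (r v) + min 2 (r' v))"
  proof (rule sum_mono)
    fix v assume "v \<in> used"
    from deg2[OF this] show "2 \<le> min 2 (r v) + min 2 (r' v)" by linarith
  qed
  also have "\<dots> \<le> (\<Sum>v\<in>I. min 2 (r v) + min 2 (r' v))" using finu assms(1) by (intro sum_mono2) auto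
  also have "\<dots> = R + R'" by (simp add: R_def R'_def sum.distrib)
  finally have RR: "card used \<le> R \<or> card used \<le> R'" by linarith
  let ?N = "\<integral>\<^sup>+x. ennreal (\<Prod>e\<in>E. \<bar>k (x (lo e)) (x (hi e))\<bar>) \<partial>Pi\<^sub>M I (\<lambda>_. P)"
  have sw: "\<bar>k (x (min (lo e) (hi e))) (x (max (lo e) (hi e)))\<bar> = \<bar>k (x (lo e)) (x (hi e))\<bar>"
    "\<bar>k (x (max (lo e) (hi e))) (x (min (lo e) (hi e)))\<bar> = \<bar>k (x (lo e)) (x (hi e))\<bar>"
    for e and x :: "nat \<Rightarrow> 'a"
    using kernel_sym by (auto simp: max_def min_def)
  have N: "?N \<le> ennreal (A ^ card E * (b / A) ^ R)"
  proof -
    have "?N = (\<integral>\<^sup>+x. ennreal (\<Prod>e\<in>E. \<bar>k (x (min (lo e) (hi e))) (x (max (lo e) (hi e)))\<bar>) \<partial>Pi\<^sub>M I (\<lambda>_. P))"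
      by (simp only: sw)
    also have "\<dots> \<le> ennreal (A ^ card E * (b / A) ^ R)"
      unfolding R_def r_def
    proof (rule nn_integral_edges_le[where rank = int])
      fix e assume "e \<in> E"
      from assms(3)[OF this] show "min (lo e) (hi e) \<in> I \<and> max (lo e) (hi e) \<in> I \<and>
          int (min (lo e) (hi e)) < int (max (lo e) (hi e))"
        by (auto simp: min_def max_def)
    qed (use assms in auto)
    finally show ?thesis .
  qed
  have N': "?N \<le> ennreal (A ^ card E * (b / A) ^ R')"
  proof -
    have "?N = (\<integral>\<^sup>+x. ennreal (\<Prod>e\<in>E. \<bar>k (x (max (lo e) (hi e))) (x (min (lo e) (hi e)))\<bar>) \<partial>Pi\<^sub>M I (\<lambda>_. P))"
      by (simp only: sw)
    also have "\<dots> \<le> ennreal (A ^ card E * (b / A) ^ R')"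
      unfolding R'_def r'_def
    proof (rule nn_integral_edges_le[where rank = "\<lambda>v. - int v"])
      fix e assume "e \<in> E"
      from assms(3)[OF this] show "max (lo e) (hi e) \<in> I \<and> min (lo e) (hi e) \<in> I \<and>
          - int (max (lo e) (hi e)) < - int (min (lo e) (hi e))"
        by (auto simp: min_def max_def)
    qed (use assms in auto)
    finally show ?thesis .
  qed
  have q: "0 \<le> b / A" "b / A \<le> 1" using A_pos b_pos b_le_A by auto
  have "?N \<le> ennreal (A ^ card E * (b / A) ^ card used)"
    using RR
  proof
    assume "card used \<le> R"
    then have "A ^ card E * (b / A) ^ R \<le> A ^ card E * (b / A) ^ card used"
      using A_pos q by (intro mult_left_mono power_decreasing) auto
    then show ?thesis using N by (meson ennreal_leI order_trans)
  next
    assume "card used \<le> R'"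
    then have "A ^ card E * (b / A) ^ R' \<le> A ^ card E * (b / A) ^ card used"
      using A_pos q by (intro mult_left_mono power_decreasing) auto
    then show ?thesis using N' by (meson ennreal_leI order_trans)
  qed
  moreover have "ennreal (norm (\<integral>x. (\<Prod>e\<in>E. k (x (lo e)) (x (hi e))) \<partial>Pi\<^sub>M I (\<lambda>_. P))) \<le> ?N"
    using integral_norm_bound_ennreal[OF integrable_edges[of E lo I hi]] assms
    by (simp add: abs_prod)
  ultimately have "ennreal (norm (\<integral>x. (\<Prod>e\<in>E. k (x (lo e)) (x (hi e))) \<partial>Pi\<^sub>M I (\<lambda>_. P)))
     \<le> ennreal (A ^ card E * (b / A) ^ card used)" by (rule order_trans[rotated])
  then show ?thesis using used_le A_pos q by (simp add: ennreal_le_iff)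
qed

lemma off_diag_sum_power:
  "off_diag_sum n k x ^ p =
    (\<Sum>g\<in>{..<p} \<rightarrow>\<^sub>E (SIGMA i:{..<n}. {..<n} - {i}). \<Prod>e<p. k (x (fst (g e))) (x (snd (g e))))"
proof -
  have "off_diag_sum n k x = (\<Sum>d\<in>(SIGMA i:{..<n}. {..<n} - {i}). k (x (fst d)) (x (snd d)))"
    unfolding off_diag_sum_def by (subst sum.Sigma) (auto simp: case_prod_unfold)
  then have "off_diag_sum n k x ^ p
      = (\<Prod>e<p. \<Sum>d\<in>(SIGMA i:{..<n}. {..<n} - {i}). k (x (fst d)) (x (snd d)))" by simp
  also have "\<dots> = (\<Sum>g\<in>{..<p} \<rightarrow>\<^sub>E (SIGMA i:{..<n}. {..<n} - {i}). \<Prod>e<p. k (x (fst (g e))) (x (snd (g e))))"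
    by (rule prod_sum_PiE) auto
  finally show ?thesis .
qed

lemma integrable_off_diag_sum_power:
  "integrable (Pi\<^sub>M {..<n} (\<lambda>_. P)) (\<lambda>x. off_diag_sum n k x ^ p)"
  unfolding off_diag_sum_power
  by (intro Bochner_Integration.integrable_sum integrable_edges) (auto simp: PiE_def Pi_def)

lemma off_diag_sum_moment_le:
  assumes p: "1 \<le> p"
  shows "(\<integral>x. off_diag_sum n k x ^ p \<partial>Pi\<^sub>M {..<n} (\<lambda>_. P)) \<le> (6 * p * (p * A + n * b)) ^ p"
proof -
  have factor: "2 * (3 * t * u) = 6 * t * u" for t u :: real by simp
  let ?D = "SIGMA i:{..<n}. {..<n} - {i}"
  let ?G = "{..<p} \<rightarrow>\<^sub>E ?D"
  define used where "used g = (fst \<circ> g) ` {..<p} \<union> (snd \<circ> g) ` {..<p}" for g :: "nat \<Rightarrow> nat \<times> nat"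
  define w where "w v = (if v \<le> p then A ^ p * (b / A) ^ v else 0)" for v
  have w0: "0 \<le> w v" for v using A_pos b_pos by (simp add: w_def)
  have finG: "finite ?G" by (intro finite_PiE) auto
  have gD: "fst (g e) < n" "snd (g e) < n" "fst (g e) \<noteq> snd (g e)" if "g \<in> ?G" "e < p" for g e
  proof -
    have "g e \<in> ?D" using that by (auto simp: PiE_def Pi_def)
    then show "fst (g e) < n" "snd (g e) < n" "fst (g e) \<noteq> snd (g e)" by auto
  qed
  have "(\<integral>x. off_diag_sum n k x ^ p \<partial>Pi\<^sub>M {..<n} (\<lambda>_. P))
     = (\<Sum>g\<in>?G. \<integral>x. (\<Prod>e<p. k (x (fst (g e))) (x (snd (g e)))) \<partial>Pi\<^sub>M {..<n} (\<lambda>_. P))"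
    unfolding off_diag_sum_power
    by (intro Bochner_Integration.integral_sum integrable_edges) (auto simp: gD)
  also have "\<dots> \<le> (\<Sum>g\<in>?G. w (card (used g)))"
  proof (rule sum_mono)
    fix g assume g: "g \<in> ?G"
    have "\<bar>\<integral>x. (\<Prod>e<p. k (x (fst (g e))) (x (snd (g e)))) \<partial>Pi\<^sub>M {..<n} (\<lambda>_. P)\<bar> \<le> w (card (used g))"
      using abs_integral_edges_le[of "{..<n}" "{..<p}" "\<lambda>e. fst (g e)" "\<lambda>e. snd (g e)"] gD[OF g]
      by (simp add: w_def used_def o_def del: abs_le_zero_iff split: if_splits)
    then show "(\<integral>x. (\<Prod>e<p. k (x (fst (g e))) (x (snd (g e)))) \<partial>Pi\<^sub>M {..<n} (\<lambda>_. P)) \<le> w (card (used g))"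
      by linarith
  qed
  also have "\<dots> = (\<Sum>T\<in>Pow {..<n}. \<Sum>g | g \<in> ?G \<and> used g = T. w (card (used g)))"
    using finG gD by (intro sum.group[symmetric]) (auto simp: used_def)
  also have "\<dots> \<le> (\<Sum>T\<in>Pow {..<n}. real (card T) ^ (2*p) * w (card T))"
  proof (rule sum_mono)
    fix T assume "T \<in> Pow {..<n}"
    then have T: "finite T" using finite_subset by auto
    have "{g. g \<in> ?G \<and> used g = T} \<subseteq> ({..<p} \<rightarrow>\<^sub>E T \<times> T)"
    proof
      fix g assume g: "g \<in> {g. g \<in> ?G \<and> used g = T}"
      have "g e \<in> T \<times> T" if "e < p" for e
      proof -
        have "fst (g e) \<in> used g" "snd (g e) \<in> used g" using that by (auto simp: used_def)
        then show ?thesis using g by (simp add: mem_Times_iff)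
      qed
      then show "g \<in> ({..<p} \<rightarrow>\<^sub>E T \<times> T)" using g by (auto simp: PiE_def)
    qed
    then have "card {g. g \<in> ?G \<and> used g = T} \<le> card ({..<p} \<rightarrow>\<^sub>E T \<times> T)"
      using T by (intro card_mono finite_PiE) auto
    also have "\<dots> = card T ^ (2*p)"
      using T by (simp add: card_PiE card_cartesian_product power_mult power2_eq_square)
    finally have cT: "card {g. g \<in> ?G \<and> used g = T} \<le> card T ^ (2*p)" .
    have "real (card {g. g \<in> ?G \<and> used g = T}) \<le> real (card T) ^ (2*p)"
      using of_nat_mono[OF cT, where 'a = real] by simp
    moreover have "(\<Sum>g | g \<in> ?G \<and> used g = T. w (card (used g))) = real (card {g. g \<in> ?G \<and> used g = T}) * w (card T)"
    proof -
      have "(\<Sum>g | g \<in> ?G \<and> used g = T. w (card (used g))) = (\<Sum>g | g \<in> ?G \<and> used g = T. w (card T))"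
        by (rule sum.cong) auto
      then show ?thesis by simp
    qed
    ultimately show "(\<Sum>g | g \<in> ?G \<and> used g = T. w (card (used g))) \<le> real (card T) ^ (2*p) * w (card T)"
      using w0 by (simp add: mult_right_mono)
  qed
  also have "\<dots> = (\<Sum>v\<le>n. \<Sum>T | T \<in> Pow {..<n} \<and> card T = v. real (card T) ^ (2*p) * w (card T))"
  proof (rule sum.group[symmetric])
    show "card ` Pow {..<n} \<subseteq> {..n}"
    proof safe
      fix T :: "nat set" assume "T \<subseteq> {..<n}"
      from card_mono[OF _ this] show "card T \<le> n" by simp
    qed
  qed auto
  also have "\<dots> = (\<Sum>v\<le>n. real (n choose v) * (real v ^ (2*p) * w v))"
  proof (rule sum.cong[OF refl])
    fix v
    have "(\<Sum>T | T \<in> Pow {..<n} \<and> card T = v. real (card T) ^ (2*p) * w (card T))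
      = real (card {T. T \<subseteq> {..<n} \<and> card T = v}) * (real v ^ (2*p) * w v)" by simp
    then show "(\<Sum>T | T \<in> Pow {..<n} \<and> card T = v. real (card T) ^ (2*p) * w (card T))
      = real (n choose v) * (real v ^ (2*p) * w v)" by (simp add: n_subsets)
  qed
  also have "\<dots> = (\<Sum>v\<in>{..n} \<inter> {..p}. real (n choose v) * (real v ^ (2*p) * w v))"
    by (intro sum.mono_neutral_right) (auto simp: w_def)
  also have "\<dots> \<le> (\<Sum>v\<in>{..n} \<inter> {..p}. (3 * p * (p * A + n * b)) ^ p)"
  proof (rule sum_mono)
    fix v assume "v \<in> {..n} \<inter> {..p}"
    then show "real (n choose v) * (real v ^ (2*p) * w v) \<le> (3 * p * (p * A + n * b)) ^ p"
      using choose_term_le[of b A v p n] A_pos b_pos p by (simp add: w_def)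
  qed
  also have "\<dots> = real (card ({..n} \<inter> {..p})) * (3 * p * (p * A + n * b)) ^ p" by simp
  also have "\<dots> \<le> 2 ^ p * (3 * p * (p * A + n * b)) ^ p"
  proof (rule mult_right_mono)
    have "card ({..n} \<inter> {..p}) \<le> card {..p}" by (intro card_mono) auto
    also have "\<dots> = Suc p" by simp
    also have "\<dots> \<le> 2 ^ p" by (rule Suc_leI) simp
    finally have "card ({..n} \<inter> {..p}) \<le> 2 ^ p" .
    from of_nat_mono[OF this, where 'a = real] show "real (card ({..n} \<inter> {..p})) \<le> 2 ^ p" by simp
  qed (use A_pos b_pos in simp)
  also have "\<dots> = (2 * ((3 * p) * (p * A + n * b))) ^ p"
    by (rule power_mult_distrib[symmetric])
  also have "2 * ((3 * p) * (p * A + n * b)) = 6 * real p * (real p * A + real n * b)"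
    unfolding of_nat_mult of_nat_numeral by (rule factor)
  finally show ?thesis .
qed

text \<open>
  Markov's inequality for the even power \<open>p = 2 \<lceil>x / 4\<rceil>\<close>, which lies between \<open>x / 2\<close> and \<open>3 x / 2\<close>:
  at three times the moment bound it leaves \<open>(1 / 3)\<^bsup>p\<^esup> \<le> exp (- p)\<close>.
\<close>

lemma off_diag_sum_tail:
  assumes x: "2 \<le> x"
  shows "measure (Pi\<^sub>M {..<n} (\<lambda>_. P))
      {y \<in> space (Pi\<^sub>M {..<n} (\<lambda>_. P)). 41 * x * (x * A + n * b) < \<bar>off_diag_sum n k y\<bar>} \<le> exp (- x / 2)"
proof -
  interpret S: prob_space "Pi\<^sub>M {..<n} (\<lambda>_. P)" by (rule prob_space_sample)
  define p where "p = 2 * nat \<lceil>x / 4\<rceil>"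
  have c: "0 < \<lceil>x / 4\<rceil>" using x by simp
  have p: "x / 2 \<le> p" "p \<le> x / 2 + 2" "1 \<le> p" "even p"
  proof -
    have "real (nat \<lceil>x / 4\<rceil>) = of_int \<lceil>x / 4\<rceil>" using c by simp
    then have "x / 4 \<le> real (nat \<lceil>x / 4\<rceil>)" "real (nat \<lceil>x / 4\<rceil>) \<le> x / 4 + 1"
      using of_int_ceiling_le_add_one[of "x/4"] le_of_int_ceiling[of "x/4"] by auto
    then show "x / 2 \<le> p" "p \<le> x / 2 + 2" unfolding p_def by auto
    have "1 \<le> nat \<lceil>x / 4\<rceil>" using c by linarith
    then show "1 \<le> p" "even p" unfolding p_def by auto
  qed
  have third: "t / (3 * t) = 1 / 3" if "0 < t" for t :: real using that by simp
  let ?s = "6 * real p * (real p * A + real n * b)"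
  have s: "0 < ?s" using p A_pos b_pos by (intro mult_pos_pos add_pos_nonneg mult_nonneg_nonneg) auto
  have ps: "3 * ?s \<le> 41 * x * (x * A + n * b)"
  proof -
    have p2: "p \<le> 3 / 2 * x" using p x by linarith
    have nb: "n * b \<le> 3 / 2 * (n * b)" using b_pos by simp
    have "3 * ?s = 18 * (p * (p * A + n * b))" by simp
    also have "\<dots> \<le> 18 * (3 / 2 * x * (3 / 2 * x * A + 3 / 2 * (n * b)))"
      using p2 A_pos b_pos x nb by (intro mult_left_mono mult_mono add_mono mult_right_mono nb) auto
    also have "\<dots> = 40.5 * x * (x * A + n * b)" by (simp add: algebra_simps)
    also have "\<dots> \<le> 41 * x * (x * A + n * b)"
      using A_pos b_pos x by (intro mult_right_mono) auto
    finally show ?thesis .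
  qed
  have int: "integrable (Pi\<^sub>M {..<n} (\<lambda>_. P)) (\<lambda>y. off_diag_sum n k y ^ p)"
    by (rule integrable_off_diag_sum_power)
  have "measure (Pi\<^sub>M {..<n} (\<lambda>_. P))
      {y \<in> space (Pi\<^sub>M {..<n} (\<lambda>_. P)). 41 * x * (x * A + n * b) < \<bar>off_diag_sum n k y\<bar>}
    \<le> measure (Pi\<^sub>M {..<n} (\<lambda>_. P)) {y \<in> space (Pi\<^sub>M {..<n} (\<lambda>_. P)). (3 * ?s) ^ p \<le> off_diag_sum n k y ^ p}"
  proof (rule S.finite_measure_mono)
    show "{y \<in> space (Pi\<^sub>M {..<n} (\<lambda>_. P)). 41 * x * (x * A + n * b) < \<bar>off_diag_sum n k y\<bar>}
      \<subseteq> {y \<in> space (Pi\<^sub>M {..<n} (\<lambda>_. P)). (3 * ?s) ^ p \<le> off_diag_sum n k y ^ p}"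
    proof safe
      fix y assume "41 * x * (x * A + n * b) < \<bar>off_diag_sum n k y\<bar>"
      then have "(3 * ?s) ^ p \<le> \<bar>off_diag_sum n k y\<bar> ^ p"
        using ps s by (intro power_mono) auto
      then show "(3 * ?s) ^ p \<le> off_diag_sum n k y ^ p" using p by (simp add: power_even_abs)
    qed
    show "{y \<in> space (Pi\<^sub>M {..<n} (\<lambda>_. P)). (3 * ?s) ^ p \<le> off_diag_sum n k y ^ p} \<in> sets (Pi\<^sub>M {..<n} (\<lambda>_. P))"
      using borel_measurable_integrable[OF int] by measurable
  qed
  also have "\<dots> \<le> (\<integral>y. off_diag_sum n k y ^ p \<partial>Pi\<^sub>M {..<n} (\<lambda>_. P)) / (3 * ?s) ^ p"
  proof (rule integral_Markov_inequality_measure[OF int])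
    show "space (Pi\<^sub>M {..<n} (\<lambda>_. P)) \<in> sets (Pi\<^sub>M {..<n} (\<lambda>_. P))" by simp
    show "AE y in Pi\<^sub>M {..<n} (\<lambda>_. P). 0 \<le> off_diag_sum n k y ^ p" using p by (auto simp: zero_le_even_power)
    show "0 < (3 * ?s) ^ p" using s by simp
  qed
  also have "\<dots> \<le> ?s ^ p / (3 * ?s) ^ p"
    using off_diag_sum_moment_le[OF p(3), of n] s by (intro divide_right_mono) auto
  also have "\<dots> = (?s / (3 * ?s)) ^ p" by (rule power_divide[symmetric])
  also have "?s / (3 * ?s) = 1 / 3" by (rule third) (rule s)
  also have "(1 / 3 :: real) ^ p \<le> exp (-1) ^ p"
  proof (rule power_mono)
    show "1 / 3 \<le> exp (- 1 :: real)" using exp_le by (simp add: exp_minus field_simps)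
  qed simp
  also have "\<dots> = exp (- real p)" using exp_of_nat_mult[of p "-1::real"] by simp
  also have "\<dots> \<le> exp (- x / 2)" using p by simp
  finally show ?thesis .
qed

end

section \<open>A Bernstein inequality\<close>

lemma exp_le_quadratic:
  fixes u :: real
  assumes "\<bar>u\<bar> \<le> 1"
  shows "exp u \<le> 1 + u + u\<^sup>2"
proof (cases "0 \<le> u")
  case True
  then show ?thesis using assms by (intro exp_bound) auto
next
  case False
  define v where "v = - u"
  have v: "0 < v" "v \<le> 1" using False assms by (auto simp: v_def)
  have pos: "0 < 1 + v + v\<^sup>2 / 2" using v by (simp add: add_pos_nonneg)
  have "exp u = 1 / exp v" by (simp add: v_def exp_minus field_simps)
  also have "\<dots> \<le> 1 / (1 + v + v\<^sup>2 / 2)"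
    using exp_lower_Taylor_quadratic[of v] v pos by (intro divide_left_mono) auto
  also have "\<dots> \<le> 1 - v + v\<^sup>2"
  proof -
    have "(1 - v + v\<^sup>2) * (1 + v + v\<^sup>2 / 2) = 1 + v\<^sup>2 / 2 + v ^ 3 / 2 + v ^ 4 / 2"
      by (simp add: field_simps power2_eq_square power3_eq_cube power4_eq_xxxx)
    also have "\<dots> \<ge> 1" using v by simp
    finally show ?thesis using pos by (simp add: divide_le_eq)
  qed
  finally show ?thesis by (simp add: v_def)
qed

context prob_space
begin

text \<open>
  The Chernoff bound, with the parameter \<open>lam\<close> left free: on the range \<open>lam * c \<le> 1\<close> the
  logarithm of the moment generating function is at most \<open>lam\<^sup>2 * \<sigma>2\<close>.
\<close>

lemma sum_upper_tail:
  fixes h :: "'a \<Rightarrow> real" and c lam z \<sigma>2 :: real and n :: nat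
  assumes h [measurable]: "h \<in> borel_measurable M"
    and bound: "\<And>y. y \<in> space M \<Longrightarrow> \<bar>h y\<bar> \<le> c"
    and mean: "expectation h = 0" and var: "expectation (\<lambda>y. (h y)\<^sup>2) \<le> \<sigma>2"
    and lam: "0 < lam" "lam * c \<le> 1"
  shows "measure (Pi\<^sub>M {..<n} (\<lambda>_. M))
     {x \<in> space (Pi\<^sub>M {..<n} (\<lambda>_. M)). n * lam * \<sigma>2 + z / lam < (\<Sum>i<n. h (x i))} \<le> exp (- z)"
proof -
  interpret S: prob_space "Pi\<^sub>M {..<n} (\<lambda>_. M)" by (rule prob_space_PiM) (rule prob_space_axioms)
  interpret prod: product_prob_space "\<lambda>_ :: nat. M" UNIV ..
  have lh: "\<bar>lam * h y\<bar> \<le> 1" if "y \<in> space M" for y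
  proof -
    have "\<bar>lam * h y\<bar> = lam * \<bar>h y\<bar>" using lam by (simp add: abs_mult)
    also have "\<dots> \<le> lam * c" using bound[OF that] lam by (intro mult_left_mono) auto
    finally show ?thesis using lam by linarith
  qed
  have int_h: "integrable M h"
    by (rule integrable_const_bound[of _ c]) (auto simp: bound)
  have int_h2: "integrable M (\<lambda>y. (h y)\<^sup>2)"
  proof (rule integrable_const_bound[of _ "c\<^sup>2"])
    show "AE y in M. norm ((h y)\<^sup>2) \<le> c\<^sup>2"
      using bound by (intro AE_I2) (metis abs_ge_zero norm_power power_mono real_norm_def)
  qed simp
  have int_exp: "integrable M (\<lambda>y. exp (lam * h y))"
  proof (rule integrable_const_bound[of _ "exp 1"])
    show "AE y in M. norm (exp (lam * h y)) \<le> exp 1"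
      using lh by (intro AE_I2) (simp add: abs_le_iff)
  qed simp
  have "expectation (\<lambda>y. exp (lam * h y)) \<le> expectation (\<lambda>y. 1 + lam * h y + (lam * h y)\<^sup>2)"
    using int_exp int_h int_h2 exp_le_quadratic[OF lh]
    by (intro integral_mono) (auto simp: power_mult_distrib)
  also have "\<dots> = 1 + lam\<^sup>2 * expectation (\<lambda>y. (h y)\<^sup>2)"
    using int_h int_h2 mean prob_space by (simp add: power_mult_distrib)
  also have "\<dots> \<le> 1 + lam\<^sup>2 * \<sigma>2"
    using var by (intro add_left_mono mult_left_mono) auto
  also have "\<dots> \<le> exp (lam\<^sup>2 * \<sigma>2)" by (rule exp_ge_add_one_self)
  finally have mgf: "expectation (\<lambda>y. exp (lam * h y)) \<le> exp (lam\<^sup>2 * \<sigma>2)" .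
  let ?E = "\<lambda>x. \<Prod>i<n. exp (lam * h (x i))"
  let ?t = "n * (lam\<^sup>2 * \<sigma>2) + z"
  have intE: "integrable (Pi\<^sub>M {..<n} (\<lambda>_. M)) ?E"
    using prod.product_integrable_prod[of "{..<n}" "\<lambda>_ y. exp (lam * h y)"] int_exp by simp
  have "measure (Pi\<^sub>M {..<n} (\<lambda>_. M))
     {x \<in> space (Pi\<^sub>M {..<n} (\<lambda>_. M)). n * lam * \<sigma>2 + z / lam < (\<Sum>i<n. h (x i))}
    \<le> measure (Pi\<^sub>M {..<n} (\<lambda>_. M)) {x \<in> space (Pi\<^sub>M {..<n} (\<lambda>_. M)). exp ?t \<le> ?E x}"
  proof (rule S.finite_measure_mono)
    show "{x \<in> space (Pi\<^sub>M {..<n} (\<lambda>_. M)). n * lam * \<sigma>2 + z / lam < (\<Sum>i<n. h (x i))}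
      \<subseteq> {x \<in> space (Pi\<^sub>M {..<n} (\<lambda>_. M)). exp ?t \<le> ?E x}"
    proof safe
      fix x assume "n * lam * \<sigma>2 + z / lam < (\<Sum>i<n. h (x i))"
      then have "lam * (n * lam * \<sigma>2 + z / lam) < lam * (\<Sum>i<n. h (x i))"
        using lam by (intro mult_strict_left_mono) auto
      moreover have "lam * (n * lam * \<sigma>2 + z / lam) = ?t"
        using lam by (simp add: distrib_left power2_eq_square)
      ultimately have "exp ?t \<le> exp (lam * (\<Sum>i<n. h (x i)))" by simp
      then show "exp ?t \<le> ?E x" by (simp add: exp_sum sum_distrib_left)
    qed
    show "{x \<in> space (Pi\<^sub>M {..<n} (\<lambda>_. M)). exp ?t \<le> ?E x} \<in> sets (Pi\<^sub>M {..<n} (\<lambda>_. M))"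
      using borel_measurable_integrable[OF intE] by measurable
  qed
  also have "\<dots> \<le> (\<integral>x. ?E x \<partial>Pi\<^sub>M {..<n} (\<lambda>_. M)) / exp ?t"
  proof (rule integral_Markov_inequality_measure[OF intE])
    show "space (Pi\<^sub>M {..<n} (\<lambda>_. M)) \<in> sets (Pi\<^sub>M {..<n} (\<lambda>_. M))" by simp
  qed (auto intro!: AE_I2 prod_nonneg)
  also have "(\<integral>x. ?E x \<partial>Pi\<^sub>M {..<n} (\<lambda>_. M)) = expectation (\<lambda>y. exp (lam * h y)) ^ n"
    using prod.product_integral_prod[of "{..<n}" "\<lambda>_ y. exp (lam * h y)"] int_exp by simp
  also have "expectation (\<lambda>y. exp (lam * h y)) ^ n / exp ?t \<le> exp (lam\<^sup>2 * \<sigma>2) ^ n / exp ?t"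
    using mgf by (intro divide_right_mono power_mono) auto
  also have "\<dots> = exp (- z)"
    unfolding exp_of_nat_mult[symmetric] by (simp add: exp_add exp_minus field_simps)
  finally show ?thesis .
qed

lemma sum_two_sided_tail:
  fixes h :: "'a \<Rightarrow> real" and c lam z \<sigma>2 :: real and n :: nat
  assumes h [measurable]: "h \<in> borel_measurable M"
    and bound: "\<And>y. y \<in> space M \<Longrightarrow> \<bar>h y\<bar> \<le> c"
    and mean: "expectation h = 0" and var: "expectation (\<lambda>y. (h y)\<^sup>2) \<le> \<sigma>2"
    and lam: "0 < lam" "lam * c \<le> 1"
  shows "measure (Pi\<^sub>M {..<n} (\<lambda>_. M))
     {x \<in> space (Pi\<^sub>M {..<n} (\<lambda>_. M)). n * lam * \<sigma>2 + z / lam < \<bar>\<Sum>i<n. h (x i)\<bar>} \<le> 2 * exp (- z)"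
proof -
  interpret S: prob_space "Pi\<^sub>M {..<n} (\<lambda>_. M)" by (rule prob_space_PiM) (rule prob_space_axioms)
  let ?u = "n * lam * \<sigma>2 + z / lam"
  let ?U = "{x \<in> space (Pi\<^sub>M {..<n} (\<lambda>_. M)). ?u < (\<Sum>i<n. h (x i))}"
  let ?L = "{x \<in> space (Pi\<^sub>M {..<n} (\<lambda>_. M)). ?u < (\<Sum>i<n. - h (x i))}"
  have "{x \<in> space (Pi\<^sub>M {..<n} (\<lambda>_. M)). ?u < \<bar>\<Sum>i<n. h (x i)\<bar>} = ?U \<union> ?L"
    by (auto simp: sum_negf abs_if)
  moreover have "S.prob (?U \<union> ?L) \<le> S.prob ?U + S.prob ?L"
    by (rule measure_Un_le) measurable
  moreover have "S.prob ?U \<le> exp (- z)"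
    by (rule sum_upper_tail[of h c]) (use assms in auto)
  moreover have "S.prob ?L \<le> exp (- z)"
    by (rule sum_upper_tail[of "\<lambda>y. - h y" c]) (use assms in auto)
  ultimately show ?thesis by simp
qed

end

section \<open>Representatives of square integrable classes\<close>

lemma l2_rel_rep_abs: "l2_rel f f \<Longrightarrow> l2_rel (rep_l2 (abs_l2 f)) f"
  using Quotient_l2 by (rule Quotient_rep_abs)

lemma l2_rel_rep_rep: "l2_rel (rep_l2 t) (rep_l2 t)"
  using Quotient_l2 by (rule Quotient_rep_reflp)

lemma sq_integrable_rep_l2: "sq_integrable (rep_l2 t)"
  using l2_rel_rep_rep by (simp add: l2_rel_def)

lemma borel_measurable_rep_l2 [measurable]: "rep_l2 t \<in> borel_measurable borel"
  using sq_integrable_rep_l2[of t] by (simp add: sq_integrable_def)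

lemma integrable_rep_l2_mult: "integrable lborel (\<lambda>x. rep_l2 s x * rep_l2 t x)"
  by (intro sq_integrable_mult sq_integrable_rep_l2)

lemma inner_l2_eq: "inner s t = (\<integral>x. rep_l2 s x * rep_l2 t x \<partial>lborel)"
  by (simp add: inner_l2_def)

lemma AE_rep_abs_l2: "sq_integrable f \<Longrightarrow> AE x in lborel. rep_l2 (abs_l2 f) x = f x"
  using l2_rel_rep_abs[of f] by (simp add: l2_rel_def)

lemma AE_rep_plus: "AE x in lborel. rep_l2 (s + t) x = rep_l2 s x + rep_l2 t x"
  using AE_rep_abs_l2[OF sq_integrable_add[OF sq_integrable_rep_l2 sq_integrable_rep_l2]]
  by (simp add: plus_l2_def)

lemma AE_rep_scaleR: "AE x in lborel. rep_l2 (c *\<^sub>R t) x = c * rep_l2 t x"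
  using AE_rep_abs_l2[OF sq_integrable_scale[OF sq_integrable_rep_l2]]
  by (simp add: scaleR_l2_def)

lemma AE_rep_zero: "AE x in lborel. rep_l2 0 x = 0"
  using AE_rep_abs_l2[OF sq_integrable_zero] by (simp add: zero_l2_def)

lemma AE_rep_linear_combination:
  "finite F \<Longrightarrow> AE x in lborel. rep_l2 (\<Sum>\<psi>\<in>F. c \<psi> *\<^sub>R \<psi>) x = (\<Sum>\<psi>\<in>F. c \<psi> * rep_l2 \<psi> x)"
proof (induction F rule: finite_induct)
  case empty
  then show ?case using AE_rep_zero by simp
next
  case (insert \<psi> F)
  from insert.IH AE_rep_plus[of "c \<psi> *\<^sub>R \<psi>" "\<Sum>\<psi>\<in>F. c \<psi> *\<^sub>R \<psi>"] AE_rep_scaleR[of "c \<psi>" \<psi>]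
  show ?case
  proof eventually_elim
    case (elim x)
    with insert.hyps show ?case by simp
  qed
qed

lemma AE_abs_rep_le_of_sup_norm:
  assumes "sup_norm t \<le> ereal c"
  shows "AE x in lborel. \<bar>rep_l2 t x\<bar> \<le> c"
  using esssup_AE[of "\<lambda>x. ereal \<bar>rep_l2 t x\<bar>" lborel]
proof eventually_elim
  case (elim x)
  then have "ereal \<bar>rep_l2 t x\<bar> \<le> ereal c" using assms unfolding sup_norm_def by (rule order_trans)
  then show ?case by simp
qed

lemma norm_sq_linear_combination:
  fixes F :: "'a::real_inner set"
  assumes "finite F" "pairwise orthogonal F" "\<And>\<psi>. \<psi> \<in> F \<Longrightarrow> norm \<psi> = 1"
  shows "(norm (\<Sum>\<psi>\<in>F. c \<psi> *\<^sub>R \<psi>))\<^sup>2 = (\<Sum>\<psi>\<in>F. (c \<psi>)\<^sup>2)"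
proof -
  have "(norm (\<Sum>\<psi>\<in>F. c \<psi> *\<^sub>R \<psi>))\<^sup>2 = (\<Sum>\<psi>\<in>F. (norm (c \<psi> *\<^sub>R \<psi>))\<^sup>2)"
    using assms by (intro norm_sum_Pythagorean) (auto simp: pairwise_def orthogonal_clauses)
  also have "\<dots> = (\<Sum>\<psi>\<in>F. (c \<psi>)\<^sup>2)"
    using assms(3) by (intro sum.cong) (auto simp: power_mult_distrib)
  finally show ?thesis .
qed

lemma tendsto_floor_div:
  fixes a :: real
  shows "(\<lambda>N. of_int \<lfloor>real (Suc N) * a\<rfloor> / real (Suc N)) \<longlonglongrightarrow> a"
proof (rule tendsto_sandwich)
  have "(\<lambda>N. a - inverse (real (Suc N))) \<longlonglongrightarrow> a - 0"
    by (intro tendsto_diff tendsto_const LIMSEQ_inverse_real_of_nat)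
  then show "(\<lambda>N. a - inverse (real (Suc N))) \<longlonglongrightarrow> a" by simp
  show "\<forall>\<^sub>F N in sequentially. a - inverse (real (Suc N)) \<le> of_int \<lfloor>real (Suc N) * a\<rfloor> / real (Suc N)"
  proof (rule always_eventually, rule allI)
    fix N
    have "real (Suc N) * a - 1 \<le> of_int \<lfloor>real (Suc N) * a\<rfloor>" by linarith
    then have "(real (Suc N) * a - 1) / real (Suc N) \<le> of_int \<lfloor>real (Suc N) * a\<rfloor> / real (Suc N)"
      by (rule divide_right_mono) simp
    then show "a - inverse (real (Suc N)) \<le> of_int \<lfloor>real (Suc N) * a\<rfloor> / real (Suc N)"
      by (simp add: diff_divide_distrib inverse_eq_divide del: of_nat_Suc)
  qed
  show "\<forall>\<^sub>F N in sequentially. of_int \<lfloor>real (Suc N) * a\<rfloor> / real (Suc N) \<le> a"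
  proof (rule always_eventually, rule allI)
    fix N
    have "of_int \<lfloor>real (Suc N) * a\<rfloor> \<le> real (Suc N) * a" by (rule of_int_floor_le)
    then show "of_int \<lfloor>real (Suc N) * a\<rfloor> / real (Suc N) \<le> a"
      by (simp add: divide_le_eq mult.commute del: of_nat_Suc)
  qed
qed simp

text \<open>
  A bound on all linear forms in \<open>a\<close> gives, for the form with coefficients \<open>a\<close> itself, the bound on
  the sum of squares.  Rational coefficients suffice by approximation; there are countably many of
  them, so that for functions the hypothesis can hold at almost every point simultaneously.
\<close>

lemma sum_squares_le_of_rational_combinations:
  fixes a :: "'e \<Rightarrow> real"
  assumes "finite F" "0 \<le> D"
    and rat: "\<And>q. q \<in> F \<rightarrow>\<^sub>E \<rat> \<Longrightarrow> \<bar>\<Sum>\<psi>\<in>F. q \<psi> * a \<psi>\<bar> \<le> D * sqrt (\<Sum>\<psi>\<in>F. (q \<psi>)\<^sup>2)"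
  shows "(\<Sum>\<psi>\<in>F. (a \<psi>)\<^sup>2) \<le> D\<^sup>2"
proof -
  define q where "q N \<psi> = of_int \<lfloor>real (Suc N) * a \<psi>\<rfloor> / real (Suc N)" for N \<psi>
  have qlim: "(\<lambda>N. q N \<psi>) \<longlonglongrightarrow> a \<psi>" for \<psi>
    unfolding q_def by (rule tendsto_floor_div)
  let ?s = "\<Sum>\<psi>\<in>F. (a \<psi>)\<^sup>2"
  have s0: "0 \<le> ?s" by (simp add: sum_nonneg)
  have "\<bar>\<Sum>\<psi>\<in>F. a \<psi> * a \<psi>\<bar> \<le> D * sqrt ?s"
  proof (rule tendsto_le[OF sequentially_bot])
    show "(\<lambda>N. \<bar>\<Sum>\<psi>\<in>F. q N \<psi> * a \<psi>\<bar>) \<longlonglongrightarrow> \<bar>\<Sum>\<psi>\<in>F. a \<psi> * a \<psi>\<bar>"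
      by (intro tendsto_intros qlim)
    show "(\<lambda>N. D * sqrt (\<Sum>\<psi>\<in>F. (q N \<psi>)\<^sup>2)) \<longlonglongrightarrow> D * sqrt ?s"
      by (intro tendsto_intros qlim)
    show "\<forall>\<^sub>F N in sequentially. \<bar>\<Sum>\<psi>\<in>F. q N \<psi> * a \<psi>\<bar> \<le> D * sqrt (\<Sum>\<psi>\<in>F. (q N \<psi>)\<^sup>2)"
    proof (rule always_eventually, rule allI)
      fix N
      have "restrict (q N) F \<in> F \<rightarrow>\<^sub>E \<rat>" by (auto simp: q_def)
      from rat[OF this] show "\<bar>\<Sum>\<psi>\<in>F. q N \<psi> * a \<psi>\<bar> \<le> D * sqrt (\<Sum>\<psi>\<in>F. (q N \<psi>)\<^sup>2)"
        by (simp cong: sum.cong)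
    qed
  qed
  then have "?s \<le> D * sqrt ?s" by (simp add: power2_eq_square)
  then have "sqrt ?s * sqrt ?s \<le> D * sqrt ?s" using s0 by simp
  then have "sqrt ?s \<le> D"
  proof (cases "?s = 0")
    case False
    then have "0 < sqrt ?s" using s0 by simp
    with \<open>sqrt ?s * sqrt ?s \<le> D * sqrt ?s\<close> show ?thesis by (rule mult_right_le_imp_le)
  qed (use assms(2) in simp)
  then have "(sqrt ?s)\<^sup>2 \<le> D\<^sup>2" using s0 by (intro power_mono) auto
  then show ?thesis using s0 by simp
qed

text \<open>
  The comparison of the sup-norm with the norm on \<open>S\<close> bounds the sum of squares of any
  orthonormal family of \<open>S\<close>, without a factor for the number of its members.
\<close>

lemma AE_sum_squares_basis_le:
  assumes F: "finite F" "pairwise orthogonal F" "\<And>\<psi>. \<psi> \<in> F \<Longrightarrow> norm \<psi> = 1"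
    and S: "subspace S" "F \<subseteq> S"
    and bound: "\<And>t. t \<in> S \<Longrightarrow> sup_norm t \<le> ereal (D * norm t)" and D: "0 \<le> D"
  shows "AE x in lborel. (\<Sum>\<psi>\<in>F. (rep_l2 \<psi> x)\<^sup>2) \<le> D\<^sup>2"
proof -
  have "AE x in lborel. \<forall>q\<in>F \<rightarrow>\<^sub>E \<rat>. \<bar>\<Sum>\<psi>\<in>F. q \<psi> * rep_l2 \<psi> x\<bar> \<le> D * sqrt (\<Sum>\<psi>\<in>F. (q \<psi>)\<^sup>2)"
  proof (subst AE_ball_countable)
    show "countable (F \<rightarrow>\<^sub>E (\<rat> :: real set))"
      using F by (intro countable_PiE countable_rat)
    show "\<forall>q\<in>F \<rightarrow>\<^sub>E \<rat>. AE x in lborel. \<bar>\<Sum>\<psi>\<in>F. q \<psi> * rep_l2 \<psi> x\<bar> \<le> D * sqrt (\<Sum>\<psi>\<in>F. (q \<psi>)\<^sup>2)"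
    proof
      fix q :: "l2 \<Rightarrow> real"
      let ?t = "\<Sum>\<psi>\<in>F. q \<psi> *\<^sub>R \<psi>"
      have "?t \<in> S" using S by (intro subspace_sum subspace_scale) auto
      from AE_abs_rep_le_of_sup_norm[OF bound[OF this]] AE_rep_linear_combination[OF F(1), of q]
      have "AE x in lborel. \<bar>\<Sum>\<psi>\<in>F. q \<psi> * rep_l2 \<psi> x\<bar> \<le> D * norm ?t"
        by eventually_elim simp
      moreover have "norm ?t = sqrt (\<Sum>\<psi>\<in>F. (q \<psi>)\<^sup>2)"
        using norm_sq_linear_combination[OF F, of q] by (metis norm_ge_zero real_sqrt_unique)
      ultimately show "AE x in lborel. \<bar>\<Sum>\<psi>\<in>F. q \<psi> * rep_l2 \<psi> x\<bar> \<le> D * sqrt (\<Sum>\<psi>\<in>F. (q \<psi>)\<^sup>2)"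
        by simp
    qed
  qed
  then show ?thesis
    by eventually_elim (intro sum_squares_le_of_rational_combinations F D; auto)
qed

section \<open>Second moments under a bounded density\<close>

abbreviation observation_law :: "l2 \<Rightarrow> real measure" where
  "observation_law s \<equiv> density lborel (\<lambda>x. ennreal (rep_l2 s x))"

lemma prob_space_observation_law: "is_density s \<Longrightarrow> prob_space (observation_law s)"
  by (rule prob_spaceI) (simp add: is_density_def emeasure_density)

lemma AE_observation_law: "AE x in lborel. R x \<Longrightarrow> AE x in observation_law s. R x"
  by (subst AE_density) (auto elim: eventually_mono)

lemma integral_observation_law:
  fixes f :: "real \<Rightarrow> real"
  assumes "is_density s" "f \<in> borel_measurable borel"
  shows "(\<integral>x. f x \<partial>observation_law s) = (\<integral>x. rep_l2 s x * f x \<partial>lborel)"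
  using assms by (subst integral_density) (auto simp: is_density_def)

lemma integral_rep_observation_law:
  "is_density s \<Longrightarrow> (\<integral>x. rep_l2 t x \<partial>observation_law s) = inner s t"
  by (simp add: integral_observation_law inner_l2_eq)

text \<open>
  This is the quantity \<open>\<mu> = M\<^sub>\<infinity> \<and> M\<^sub>2 d\<^bsup>1/2\<^esup> \<and> d\<close> under the inner square roots of the radius.
\<close>

definition eff_dim :: "real \<Rightarrow> real \<Rightarrow> real \<Rightarrow> real" where
  "eff_dim M2 Minf d = min (min Minf (M2 * sqrt d)) d"

text \<open>
  Three bounds for the integral of \<open>s t\<^sup>2\<close>: \<open>s\<close> is at most \<open>M\<^sub>\<infinity>\<close>; one factor \<open>t\<close> is at most
  \<open>C \<surd>d \<parallel>t\<parallel>\<close> and the Cauchy-Schwarz inequality bounds the integral of \<open>s \<bar>t\<bar>\<close> by \<open>M\<^sub>2 \<parallel>t\<parallel>\<close>; both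
  factors \<open>t\<close> are at most \<open>C \<surd>d \<parallel>t\<parallel>\<close>.
\<close>

lemma integral_square_observation_law_le:
  assumes s: "is_density s" "norm s \<le> M2" "sup_norm s \<le> ereal Minf"
    and pos: "0 < M2" "0 < Minf" "0 < C" "0 \<le> d"
    and bound: "sup_norm t \<le> ereal (C * sqrt d * norm t)"
  shows "(\<integral>x. (rep_l2 t x)\<^sup>2 \<partial>observation_law s) \<le> (1 + C)\<^sup>2 * eff_dim M2 Minf d * (norm t)\<^sup>2"
proof -
  let ?I = "\<integral>x. (rep_l2 t x)\<^sup>2 \<partial>observation_law s"
  let ?D = "C * sqrt d * norm t"
  have D0: "0 \<le> ?D" using pos by simp
  interpret prob_space "observation_law s" by (rule prob_space_observation_law) fact
  have s0: "AE x in lborel. 0 \<le> rep_l2 s x" using s by (simp add: is_density_def)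
  have sM: "AE x in lborel. \<bar>rep_l2 s x\<bar> \<le> Minf" using s by (intro AE_abs_rep_le_of_sup_norm)
  have tD: "AE x in lborel. \<bar>rep_l2 t x\<bar> \<le> ?D" using bound by (rule AE_abs_rep_le_of_sup_norm)
  have I: "?I = (\<integral>x. rep_l2 s x * (rep_l2 t x)\<^sup>2 \<partial>lborel)"
    by (rule integral_observation_law) (use s in auto)
  have it2: "integrable lborel (\<lambda>x. (rep_l2 t x)\<^sup>2)"
    using sq_integrable_rep_l2[of t] by (simp add: sq_integrable_def)
  have nt: "(\<integral>x. (rep_l2 t x)\<^sup>2 \<partial>lborel) = (norm t)\<^sup>2"
    unfolding power2_norm_eq_inner inner_l2_eq by (simp add: power2_eq_square)
  have int: "integrable lborel (\<lambda>x. rep_l2 s x * (rep_l2 t x)\<^sup>2)"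
  proof (rule Bochner_Integration.integrable_bound)
    show "integrable lborel (\<lambda>x. Minf * (rep_l2 t x)\<^sup>2)" using it2 by simp
    show "AE x in lborel. norm (rep_l2 s x * (rep_l2 t x)\<^sup>2) \<le> norm (Minf * (rep_l2 t x)\<^sup>2)"
      using sM by eventually_elim (auto simp: abs_mult intro!: mult_right_mono)
  qed simp
  have b1: "?I \<le> Minf * (norm t)\<^sup>2"
  proof -
    have "?I \<le> (\<integral>x. Minf * (rep_l2 t x)\<^sup>2 \<partial>lborel)"
      unfolding I
    proof (rule integral_mono_AE[OF int])
      show "AE x in lborel. rep_l2 s x * (rep_l2 t x)\<^sup>2 \<le> Minf * (rep_l2 t x)\<^sup>2"
        using sM by eventually_elim (auto intro!: mult_right_mono)
    qed (use it2 in simp)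
    then show ?thesis by (simp add: nt)
  qed
  have b2: "?I \<le> C * (M2 * sqrt d) * (norm t)\<^sup>2"
  proof -
    define u where "u = abs_l2 (\<lambda>x. \<bar>rep_l2 t x\<bar>)"
    have "sq_integrable (\<lambda>x. \<bar>rep_l2 t x\<bar>)"
      using sq_integrable_rep_l2[of t] by (simp add: sq_integrable_def)
    from AE_rep_abs_l2[OF this] have u: "AE x in lborel. rep_l2 u x = \<bar>rep_l2 t x\<bar>"
      by (simp add: u_def)
    have "inner u u = inner t t"
      unfolding inner_l2_eq using u by (intro integral_cong_AE) (auto elim: eventually_mono)
    then have nu: "norm u = norm t" by (simp add: norm_eq_sqrt_inner)
    have "?I \<le> (\<integral>x. ?D * (rep_l2 s x * rep_l2 u x) \<partial>lborel)"
      unfolding I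
    proof (rule integral_mono_AE[OF int])
      show "AE x in lborel. rep_l2 s x * (rep_l2 t x)\<^sup>2 \<le> ?D * (rep_l2 s x * rep_l2 u x)"
        using s0 tD u
      proof eventually_elim
        case (elim x)
        have "(rep_l2 t x)\<^sup>2 = \<bar>rep_l2 t x\<bar> * \<bar>rep_l2 t x\<bar>" by (simp add: power2_eq_square)
        also have "\<dots> \<le> ?D * \<bar>rep_l2 t x\<bar>" using elim by (intro mult_right_mono) auto
        finally have "rep_l2 s x * (rep_l2 t x)\<^sup>2 \<le> rep_l2 s x * (?D * rep_l2 u x)"
          using elim by (intro mult_left_mono) auto
        then show ?case by (simp add: mult_ac)
      qed
    qed (use integrable_rep_l2_mult in simp)
    also have "\<dots> = ?D * inner s u" by (simp add: inner_l2_eq)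
    also have "\<dots> \<le> ?D * (M2 * norm t)"
    proof (rule mult_left_mono[OF _ D0])
      have "inner s u \<le> norm s * norm u" by (rule norm_cauchy_schwarz)
      also have "\<dots> \<le> M2 * norm t" using s nu by (simp add: mult_right_mono)
      finally show "inner s u \<le> M2 * norm t" .
    qed
    finally show ?thesis by (simp add: power2_eq_square mult_ac)
  qed
  have b3: "?I \<le> C\<^sup>2 * d * (norm t)\<^sup>2"
  proof -
    have "AE x in observation_law s. (rep_l2 t x)\<^sup>2 \<le> ?D\<^sup>2"
      using AE_observation_law[OF tD] by eventually_elim (metis abs_ge_zero power2_abs power_mono)
    moreover from this have "integrable (observation_law s) (\<lambda>x. (rep_l2 t x)\<^sup>2)"
      by (intro integrable_const_bound[of _ "?D\<^sup>2"]) auto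
    ultimately have "?I \<le> (\<integral>x. ?D\<^sup>2 \<partial>observation_law s)"
      by (intro integral_mono_AE) auto
    also have "\<dots> = ?D\<^sup>2" using prob_space by simp
    finally show ?thesis using pos by (simp add: power_mult_distrib)
  qed
  have c: "1 \<le> (1 + C)\<^sup>2" "C \<le> (1 + C)\<^sup>2" "C\<^sup>2 \<le> (1 + C)\<^sup>2"
    using pos by (auto simp: power2_eq_square algebra_simps)
  have n2: "0 \<le> (norm t)\<^sup>2" by simp
  have b1': "?I \<le> (1 + C)\<^sup>2 * Minf * (norm t)\<^sup>2"
  proof -
    have "1 * Minf * (norm t)\<^sup>2 \<le> (1 + C)\<^sup>2 * Minf * (norm t)\<^sup>2"
      using c pos by (intro mult_right_mono) auto
    then show ?thesis using b1 by linarith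
  qed
  have b2': "?I \<le> (1 + C)\<^sup>2 * (M2 * sqrt d) * (norm t)\<^sup>2"
  proof -
    have "C * (M2 * sqrt d) * (norm t)\<^sup>2 \<le> (1 + C)\<^sup>2 * (M2 * sqrt d) * (norm t)\<^sup>2"
      using c pos by (intro mult_right_mono) auto
    then show ?thesis using b2 by linarith
  qed
  have b3': "?I \<le> (1 + C)\<^sup>2 * d * (norm t)\<^sup>2"
  proof -
    have "C\<^sup>2 * d * (norm t)\<^sup>2 \<le> (1 + C)\<^sup>2 * d * (norm t)\<^sup>2"
      using c pos by (intro mult_right_mono) auto
    then show ?thesis using b3 by linarith
  qed
  show ?thesis
    unfolding eff_dim_def min_def using b1' b2' b3' by simp
qed

section \<open>Deviations attached to an orthonormal family\<close>

lemma sum_abs_le_sqrt: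
  fixes u v :: "'e \<Rightarrow> real"
  assumes "(\<Sum>e\<in>F. (u e)\<^sup>2) \<le> a\<^sup>2" "(\<Sum>e\<in>F. (v e)\<^sup>2) \<le> c\<^sup>2" "0 \<le> a" "0 \<le> c"
  shows "\<bar>\<Sum>e\<in>F. u e * v e\<bar> \<le> a * c"
proof -
  have "\<bar>\<Sum>e\<in>F. u e * v e\<bar> \<le> (\<Sum>e\<in>F. \<bar>u e\<bar> * \<bar>v e\<bar>)"
    by (rule order_trans[OF sum_abs]) (simp add: abs_mult)
  also have "\<dots> \<le> L2_set u F * L2_set v F" by (rule L2_set_mult_ineq)
  also have "\<dots> \<le> a * c"
  proof (rule mult_mono)
    show "L2_set u F \<le> a" unfolding L2_set_def using assms by (simp add: real_le_lsqrt sum_nonneg)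
    show "L2_set v F \<le> c" unfolding L2_set_def using assms by (simp add: real_le_lsqrt sum_nonneg)
  qed (use assms in \<open>auto simp: L2_set_nonneg\<close>)
  finally show ?thesis .
qed

text \<open>
  With \<open>F\<close> a basis of a model this is the error of the resampling penalty; with \<open>F\<close> the
  vectors added to reach a basis of the ambient space it is the quadratic part of the error of the
  bias estimator, whose linear part is \<open>linear_sum\<close> below.
\<close>

definition degenerate_U :: "nat \<Rightarrow> l2 \<Rightarrow> l2 set \<Rightarrow> (nat \<Rightarrow> real) \<Rightarrow> real" where
  "degenerate_U n s F x = off_diag_sum n
     (\<lambda>u v. \<Sum>\<psi>\<in>F. (rep_l2 \<psi> u - inner s \<psi>) * (rep_l2 \<psi> v - inner s \<psi>)) x / (real n * (real n - 1))"

definition linear_sum :: "nat \<Rightarrow> l2 \<Rightarrow> l2 set \<Rightarrow> (nat \<Rightarrow> real) \<Rightarrow> real" where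
  "linear_sum n s F x = (\<Sum>i<n. \<Sum>\<psi>\<in>F. inner s \<psi> * (rep_l2 \<psi> (x i) - inner s \<psi>))"

text \<open>
  The deviations are multiples of \<open>dev_scale M2 Minf d * x / n\<close>: with the factor \<open>\<kappa>U\<close> for the
  degenerate part, and \<open>\<kappa>L\<^sup>2 / \<epsilon>\<close> for the linear part once a fraction \<open>\<epsilon>\<close> of the squared bias is set apart.
\<close>

definition dev_scale :: "real \<Rightarrow> real \<Rightarrow> real \<Rightarrow> real" where
  "dev_scale M2 Minf d = (1 + sqrt (eff_dim M2 Minf d)) * sqrt d"

definition \<kappa>U :: "real \<Rightarrow> real \<Rightarrow> real" where
  "\<kappa>U C CM = 328 * (1 + C)\<^sup>2 * (1 + CM)"

definition \<kappa>L :: "real \<Rightarrow> real \<Rightarrow> real" where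
  "\<kappa>L C CM = (1 + C)\<^sup>2 + (1 + C) * (1 + CM)"

lemma sets_sample_law: "sets (sample_law n s) = sets (Pi\<^sub>M {..<n} (\<lambda>_. borel :: real measure))"
  unfolding sample_law_def by (intro sets_PiM_cong) auto

lemma space_sample_law: "space (sample_law n s) = space (Pi\<^sub>M {..<n} (\<lambda>_. borel :: real measure))"
  by (rule sets_eq_imp_space_eq) (rule sets_sample_law)

lemma rep_l2_component_measurable [measurable]:
  assumes "i < n"
  shows "(\<lambda>x. rep_l2 t (x i)) \<in> borel_measurable (Pi\<^sub>M {..<n} (\<lambda>_. borel :: real measure))"
proof -
  have [measurable]: "i \<in> {..<n}" using assms by simp
  show ?thesis by (rule measurable_compose[OF _ borel_measurable_rep_l2]) measurable
qed

lemma prob_space_sample_law: "is_density s \<Longrightarrow> prob_space (sample_law n s)"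
  unfolding sample_law_def by (intro prob_space_PiM prob_space_observation_law)

lemma AE_sample_law:
  assumes "is_density s" "AE x in lborel. R x"
  shows "AE x in sample_law n s. \<forall>i<n. R (x i)"
proof -
  have "AE x in sample_law n s. R (x i)" if "i < n" for i
    unfolding sample_law_def
    by (rule AE_PiM_component) (use assms that AE_observation_law prob_space_observation_law in auto)
  then have "AE x in sample_law n s. \<forall>i\<in>{..<n}. R (x i)"
    by (subst AE_finite_all) auto
  then show ?thesis by eventually_elim auto
qed

lemma degenerate_U_measurable [measurable]: "degenerate_U n s F \<in> borel_measurable (Pi\<^sub>M {..<n} (\<lambda>_. borel :: real measure))"
  unfolding degenerate_U_def off_diag_sum_def
  by (intro borel_measurable_divide borel_measurable_sum borel_measurable_times
      borel_measurable_diff borel_measurable_const rep_l2_component_measurable) auto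

lemma linear_sum_measurable [measurable]: "linear_sum n s F \<in> borel_measurable (Pi\<^sub>M {..<n} (\<lambda>_. borel :: real measure))"
  unfolding linear_sum_def
  by (intro borel_measurable_sum borel_measurable_times
      borel_measurable_diff borel_measurable_const rep_l2_component_measurable) auto

locale sampled_family =
  fixes s :: l2 and S F :: "l2 set" and C M2 Minf d :: real
  assumes density: "is_density s" "norm s \<le> M2" "sup_norm s \<le> ereal Minf"
    and pos: "0 < M2" "0 < Minf" "0 < C" "1 \<le> d"
    and S: "subspace S" "F \<subseteq> S"
    and F: "finite F" "pairwise orthogonal F" "\<And>\<psi>. \<psi> \<in> F \<Longrightarrow> norm \<psi> = 1"
    and bound: "\<And>t. t \<in> S \<Longrightarrow> sup_norm t \<le> ereal (C * sqrt d * norm t)"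
begin

lemma eff_dim_pos: "0 < eff_dim M2 Minf d" and eff_dim_le: "eff_dim M2 Minf d \<le> d"
  using pos by (auto simp: eff_dim_def)

lemma dev_scale_pos: "0 < dev_scale M2 Minf d"
  using eff_dim_pos pos by (simp add: dev_scale_def add_pos_nonneg)

text \<open>
  The bound on the sum of squares of the basis holds almost everywhere only.  Cutting the
  representatives to zero off the set where it holds gives functions that satisfy it everywhere, so
  that the moment bounds for kernels apply, and that agree with the representatives on almost
  every sample.
\<close>

definition bounded_version :: "l2 \<Rightarrow> real \<Rightarrow> real" where
  "bounded_version \<psi> x = (if (\<Sum>\<phi>\<in>F. (rep_l2 \<phi> x)\<^sup>2) \<le> C\<^sup>2 * d then rep_l2 \<psi> x else 0)"

lemma bv_meas [measurable]: "bounded_version \<psi> \<in> borel_measurable borel"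
  unfolding bounded_version_def by measurable

lemma bv_AE: "AE x in lborel. \<forall>\<psi>. bounded_version \<psi> x = rep_l2 \<psi> x"
proof -
  have "AE x in lborel. (\<Sum>\<phi>\<in>F. (rep_l2 \<phi> x)\<^sup>2) \<le> (C * sqrt d)\<^sup>2"
    using F S bound pos by (intro AE_sum_squares_basis_le) auto
  then show ?thesis
    by eventually_elim (use pos in \<open>simp add: bounded_version_def power_mult_distrib\<close>)
qed

lemma bv_bound: "(\<Sum>\<psi>\<in>F. (bounded_version \<psi> x)\<^sup>2) \<le> C\<^sup>2 * d"
  using pos by (cases "(\<Sum>\<phi>\<in>F. (rep_l2 \<phi> x)\<^sup>2) \<le> C\<^sup>2 * d") (auto simp: bounded_version_def)

sublocale P: prob_space "observation_law s"
  by (rule prob_space_observation_law) (rule density)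

lemma bv_abs_le: "\<psi> \<in> F \<Longrightarrow> \<bar>bounded_version \<psi> x\<bar> \<le> C * sqrt d"
proof -
  assume "\<psi> \<in> F"
  then have "(bounded_version \<psi> x)\<^sup>2 \<le> (\<Sum>\<psi>\<in>F. (bounded_version \<psi> x)\<^sup>2)"
    using F by (intro member_le_sum) auto
  also have "\<dots> \<le> (C * sqrt d)\<^sup>2" using bv_bound pos by (simp add: power_mult_distrib)
  finally show ?thesis using pos by (simp add: abs_le_square_iff[symmetric])
qed

lemma integrable_bv: "\<psi> \<in> F \<Longrightarrow> integrable (observation_law s) (bounded_version \<psi>)"
  using bv_abs_le by (intro P.integrable_const_bound[of _ "C * sqrt d"]) auto

lemma expectation_bv: "\<psi> \<in> F \<Longrightarrow> (\<integral>x. bounded_version \<psi> x \<partial>observation_law s) = inner s \<psi>"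
proof -
  have "(\<integral>x. bounded_version \<psi> x \<partial>observation_law s) = (\<integral>x. rep_l2 \<psi> x \<partial>observation_law s)"
  proof (rule integral_cong_AE)
    show "AE x in observation_law s. bounded_version \<psi> x = rep_l2 \<psi> x"
      using AE_observation_law[OF bv_AE] by eventually_elim simp
  qed auto
  then show ?thesis using density by (simp add: integral_rep_observation_law)
qed

lemma integrable_bv_sq: "\<psi> \<in> F \<Longrightarrow> integrable (observation_law s) (\<lambda>x. (bounded_version \<psi> x)\<^sup>2)"
proof (intro P.integrable_const_bound[of _ "(C * sqrt d)\<^sup>2"] AE_I2)
  fix x assume "\<psi> \<in> F"
  from bv_abs_le[OF this, of x] show "norm ((bounded_version \<psi> x)\<^sup>2) \<le> (C * sqrt d)\<^sup>2"
    by (metis abs_ge_zero norm_power power_mono real_norm_def)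
qed simp

text \<open>
  The coefficients are expectations, so their squares are at most the second moments, which add up to
  at most \<open>C\<^sup>2 d\<close>.  Bessel's inequality would give \<open>\<parallel>s\<parallel>\<^sup>2\<close> instead and
  so bring \<open>M\<^sub>2\<close> into the constants.
\<close>

lemma sum_coeff_sq_le: "(\<Sum>\<psi>\<in>F. (inner s \<psi>)\<^sup>2) \<le> C\<^sup>2 * d"
proof -
  have "(\<Sum>\<psi>\<in>F. (inner s \<psi>)\<^sup>2) \<le> (\<Sum>\<psi>\<in>F. \<integral>x. (bounded_version \<psi> x)\<^sup>2 \<partial>observation_law s)"
  proof (rule sum_mono)
    fix \<psi> assume f: "\<psi> \<in> F"
    have "0 \<le> P.variance (bounded_version \<psi>)" by simp
    also have "\<dots> = (\<integral>x. (bounded_version \<psi> x)\<^sup>2 \<partial>observation_law s) - (inner s \<psi>)\<^sup>2"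
      using f by (subst P.variance_eq) (auto simp: integrable_bv integrable_bv_sq expectation_bv)
    finally show "(inner s \<psi>)\<^sup>2 \<le> (\<integral>x. (bounded_version \<psi> x)\<^sup>2 \<partial>observation_law s)" by simp
  qed
  also have "\<dots> = (\<integral>x. (\<Sum>\<psi>\<in>F. (bounded_version \<psi> x)\<^sup>2) \<partial>observation_law s)"
    by (subst Bochner_Integration.integral_sum) (auto simp: integrable_bv_sq)
  also have "\<dots> \<le> (\<integral>x. C\<^sup>2 * d \<partial>observation_law s)"
    using bv_bound integrable_bv_sq by (intro integral_mono) auto
  also have "\<dots> = C\<^sup>2 * d" using P.prob_space by simp
  finally show ?thesis .
qed

abbreviation centred :: "l2 \<Rightarrow> real \<Rightarrow> real" where
  "centred \<psi> x \<equiv> bounded_version \<psi> x - inner s \<psi>"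

lemma sum_centred_sq_le: "(\<Sum>\<psi>\<in>F. (centred \<psi> x)\<^sup>2) \<le> (2 * C * sqrt d)\<^sup>2"
proof -
  have "(\<Sum>\<psi>\<in>F. (centred \<psi> x)\<^sup>2)
     \<le> (\<Sum>\<psi>\<in>F. 2 * (bounded_version \<psi> x)\<^sup>2 + 2 * (inner s \<psi>)\<^sup>2)"
  proof (rule sum_mono)
    fix \<psi>
    have "0 \<le> (bounded_version \<psi> x + inner s \<psi>)\<^sup>2" by simp
    then show "(centred \<psi> x)\<^sup>2 \<le> 2 * (bounded_version \<psi> x)\<^sup>2 + 2 * (inner s \<psi>)\<^sup>2"
      by (simp add: power2_diff power2_sum)
  qed
  also have "\<dots> = 2 * (\<Sum>\<psi>\<in>F. (bounded_version \<psi> x)\<^sup>2) + 2 * (\<Sum>\<psi>\<in>F. (inner s \<psi>)\<^sup>2)"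
    by (simp add: sum.distrib sum_distrib_left)
  also have "\<dots> \<le> 2 * (C\<^sup>2 * d) + 2 * (C\<^sup>2 * d)"
    by (intro add_mono mult_left_mono bv_bound sum_coeff_sq_le) auto
  also have "\<dots> = (2 * C * sqrt d)\<^sup>2" using pos by (simp add: power_mult_distrib)
  finally show ?thesis .
qed

text \<open>
  A combination of the centred functions is a centred element of \<open>S\<close>; its variance is at most the
  second moment of that element, to which the three bounds above apply.
\<close>

lemma variance_combination_le:
  shows "(\<integral>x. (\<Sum>\<psi>\<in>F. a \<psi> * centred \<psi> x)\<^sup>2 \<partial>observation_law s)
    \<le> (1 + C)\<^sup>2 * eff_dim M2 Minf d * (\<Sum>\<psi>\<in>F. (a \<psi>)\<^sup>2)"
proof -
  let ?g = "\<lambda>x. \<Sum>\<psi>\<in>F. a \<psi> * bounded_version \<psi> x"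
  let ?t = "\<Sum>\<psi>\<in>F. a \<psi> *\<^sub>R \<psi>"
  have gb: "\<bar>?g x\<bar> \<le> L2_set a F * (C * sqrt d)" for x
    using bv_bound[of x] pos
    by (intro sum_abs_le_sqrt) (auto simp: L2_set_def sum_nonneg power_mult_distrib)
  have int_g: "integrable (observation_law s) ?g"
    by (intro Bochner_Integration.integrable_sum integrable_mult_right integrable_bv)
  have int_g2: "integrable (observation_law s) (\<lambda>x. (?g x)\<^sup>2)"
  proof (rule P.integrable_const_bound[of _ "(L2_set a F * (C * sqrt d))\<^sup>2"])
    show "AE x in observation_law s. norm ((?g x)\<^sup>2) \<le> (L2_set a F * (C * sqrt d))\<^sup>2"
      using gb by (intro AE_I2) (metis abs_ge_zero norm_power power_mono real_norm_def)
  qed simp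
  have Eg: "P.expectation ?g = (\<Sum>\<psi>\<in>F. a \<psi> * inner s \<psi>)"
    by (subst Bochner_Integration.integral_sum) (auto simp: integrable_bv expectation_bv)
  have "(\<Sum>\<psi>\<in>F. a \<psi> * centred \<psi> x) = ?g x - P.expectation ?g" for x
    unfolding Eg by (simp add: right_diff_distrib sum_subtractf)
  then have "(\<integral>x. (\<Sum>\<psi>\<in>F. a \<psi> * centred \<psi> x)\<^sup>2 \<partial>observation_law s) = P.variance ?g"
    by simp
  also have "\<dots> = P.expectation (\<lambda>x. (?g x)\<^sup>2) - (P.expectation ?g)\<^sup>2"
    by (rule P.variance_eq[OF int_g int_g2])
  also have "\<dots> \<le> P.expectation (\<lambda>x. (?g x)\<^sup>2)" by simp
  also have "\<dots> = (\<integral>x. (rep_l2 ?t x)\<^sup>2 \<partial>observation_law s)"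
  proof (rule integral_cong_AE)
    show "AE x in observation_law s. (?g x)\<^sup>2 = (rep_l2 ?t x)\<^sup>2"
      using AE_observation_law[OF bv_AE] AE_observation_law[OF AE_rep_linear_combination[OF F(1), of a]]
      by eventually_elim simp
  qed auto
  also have "\<dots> \<le> (1 + C)\<^sup>2 * eff_dim M2 Minf d * (norm ?t)\<^sup>2"
  proof (rule integral_square_observation_law_le)
    have "?t \<in> S" using S by (intro subspace_sum subspace_scale) auto
    then show "sup_norm ?t \<le> ereal (C * sqrt d * norm ?t)" by (rule bound)
  qed (use density pos in auto)
  also have "(norm ?t)\<^sup>2 = (\<Sum>\<psi>\<in>F. (a \<psi>)\<^sup>2)"
    by (rule norm_sq_linear_combination[OF F])
  finally show ?thesis .
qed

definition centred_kernel :: "real \<Rightarrow> real \<Rightarrow> real" where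
  "centred_kernel x y = (\<Sum>\<psi>\<in>F. centred \<psi> x * centred \<psi> y)"

lemma expectation_combination: "(\<integral>x. (\<Sum>\<psi>\<in>F. a \<psi> * centred \<psi> x) \<partial>observation_law s) = 0"
  by (subst Bochner_Integration.integral_sum)
     (use P.prob_space in \<open>auto simp: integrable_bv expectation_bv\<close>)

lemma centred_kernel_bound: "\<bar>centred_kernel x y\<bar> \<le> 4 * (1 + C)\<^sup>2 * d"
proof -
  have "\<bar>centred_kernel x y\<bar> \<le> (2 * C * sqrt d) * (2 * C * sqrt d)"
    unfolding centred_kernel_def
    using sum_centred_sq_le pos by (intro sum_abs_le_sqrt) auto
  also have "\<dots> = 4 * C\<^sup>2 * d" using pos by (simp add: power2_eq_square mult_ac)
  also have "\<dots> \<le> 4 * (1 + C)\<^sup>2 * d"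
    using pos by (intro mult_right_mono mult_left_mono power_mono) auto
  finally show ?thesis .
qed

text \<open>
  A section of the kernel is the combination of the centred functions with coefficients
  \<open>centred \<psi> x\<close>, so its second moment is at most a constant times \<open>\<mu>\<close> times \<open>\<Sum>\<^sub>\<psi> (centred \<psi> x)\<^sup>2 \<le> 4 C\<^sup>2 d\<close>.
  The constants \<open>A\<close> and \<open>b\<close> are written with \<open>(1 + C)\<^sup>2\<close> to have \<open>b \<le> A\<close> also for small \<open>C\<close>.
\<close>

sublocale K: degenerate_kernel "observation_law s" centred_kernel "4 * (1 + C)\<^sup>2 * d"
  "2 * (1 + C)\<^sup>2 * sqrt (eff_dim M2 Minf d * d)"
proof unfold_locales
  let ?\<mu> = "eff_dim M2 Minf d"
  show "case_prod centred_kernel \<in> borel_measurable (observation_law s \<Otimes>\<^sub>M observation_law s)"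
    unfolding centred_kernel_def by measurable
  show "centred_kernel x y = centred_kernel y x" for x y
    unfolding centred_kernel_def by (simp add: mult.commute)
  show "\<bar>centred_kernel x y\<bar> \<le> 4 * (1 + C)\<^sup>2 * d" for x y
    by (rule centred_kernel_bound)
  show "(\<integral>\<^sup>+y. ennreal ((centred_kernel x y)\<^sup>2) \<partial>observation_law s)
     \<le> ennreal ((2 * (1 + C)\<^sup>2 * sqrt (?\<mu> * d))\<^sup>2)" for x
  proof -
    have int: "integrable (observation_law s) (\<lambda>y. (centred_kernel x y)\<^sup>2)"
    proof (rule P.integrable_const_bound[of _ "(4 * (1 + C)\<^sup>2 * d)\<^sup>2"])
      show "AE y in observation_law s. norm ((centred_kernel x y)\<^sup>2) \<le> (4 * (1 + C)\<^sup>2 * d)\<^sup>2"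
        using centred_kernel_bound by (intro AE_I2) (metis abs_ge_zero norm_power power_mono real_norm_def)
    qed (simp add: centred_kernel_def)
    have "(\<integral>y. (centred_kernel x y)\<^sup>2 \<partial>observation_law s)
       \<le> (1 + C)\<^sup>2 * ?\<mu> * (\<Sum>\<psi>\<in>F. (centred \<psi> x)\<^sup>2)"
      unfolding centred_kernel_def by (rule variance_combination_le)
    also have "\<dots> \<le> (1 + C)\<^sup>2 * ?\<mu> * (2 * C * sqrt d)\<^sup>2"
      using eff_dim_pos by (intro mult_left_mono sum_centred_sq_le) auto
    also have "\<dots> = (1 + C)\<^sup>2 * (4 * C\<^sup>2) * (?\<mu> * d)"
      using pos by (simp add: power_mult_distrib)
    also have "\<dots> \<le> (1 + C)\<^sup>2 * (4 * (1 + C)\<^sup>2) * (?\<mu> * d)"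
      using pos eff_dim_pos by (intro mult_right_mono mult_left_mono power_mono) auto
    also have "\<dots> = (2 * (1 + C)\<^sup>2 * sqrt (?\<mu> * d))\<^sup>2"
      using pos eff_dim_pos by (simp add: power_mult_distrib power2_eq_square)
    finally show ?thesis
      using int by (subst nn_integral_eq_integral) auto
  qed
  show "0 < 2 * (1 + C)\<^sup>2 * sqrt (?\<mu> * d)"
    using pos eff_dim_pos by simp
  have "sqrt (?\<mu> * d) \<le> sqrt (d * d)"
    using pos eff_dim_pos eff_dim_le by (intro real_sqrt_le_mono mult_right_mono) auto
  then have "sqrt (?\<mu> * d) \<le> d" using pos by simp
  then have "2 * (1 + C)\<^sup>2 * sqrt (?\<mu> * d) \<le> 2 * (1 + C)\<^sup>2 * d"
    by (intro mult_left_mono) auto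
  also have "\<dots> \<le> 4 * (1 + C)\<^sup>2 * d" using pos by (intro mult_right_mono) auto
  finally show "2 * (1 + C)\<^sup>2 * sqrt (?\<mu> * d) \<le> 4 * (1 + C)\<^sup>2 * d" .
  show "(\<integral>y. centred_kernel x y \<partial>observation_law s) = 0" for x
    unfolding centred_kernel_def by (rule expectation_combination)
qed

lemma AE_sample_bv: "AE x in sample_law n s. \<forall>i<n. \<forall>\<psi>. bounded_version \<psi> (x i) = rep_l2 \<psi> (x i)"
  using density bv_AE by (intro AE_sample_law)

text \<open>
  In \<open>x (x A + n b)\<close> the hypothesis \<open>\<surd>d x \<le> CM n\<close> turns \<open>x A\<close>, of order \<open>x d\<close>, into \<open>CM n \<surd>d\<close>,
  so that both terms are of order \<open>n (1 + \<surd>\<mu>) \<surd>d\<close>.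
\<close>

lemma degenerate_U_tail:
  assumes n: "2 \<le> n" and x: "2 \<le> x" and CM: "0 \<le> CM" "sqrt d * x / n \<le> CM"
  shows "measure (sample_law n s) {y \<in> space (sample_law n s).
      \<kappa>U C CM * dev_scale M2 Minf d * x / n < \<bar>degenerate_U n s F y\<bar>} \<le> exp (- x / 2)"
proof -
  let ?\<mu> = "eff_dim M2 Minf d"
  let ?A = "4 * (1 + C)\<^sup>2 * d" and ?b = "2 * (1 + C)\<^sup>2 * sqrt (?\<mu> * d)"
  let ?thr = "\<kappa>U C CM * dev_scale M2 Minf d * x / n"
  let ?\<Pi> = "Pi\<^sub>M {..<n} (\<lambda>_. observation_law s)"
  have \<Pi>: "sample_law n s = ?\<Pi>" by (simp add: sample_law_def)
  interpret S: prob_space "sample_law n s" by (rule prob_space_sample_law) (rule density)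
  have [measurable]: "off_diag_sum n centred_kernel \<in> borel_measurable (sample_law n s)"
    using borel_measurable_integrable[OF K.integrable_off_diag_sum_power[of n 1]] unfolding \<Pi> by simp
  have thr: "41 * x * (x * ?A + n * ?b) \<le> (real n * (real n - 1)) * ?thr"
  proof -
    let ?q = "sqrt ?\<mu>" and ?N = "real n"
    have q0: "0 \<le> ?q" using eff_dim_pos by simp
    have "sqrt d * x \<le> CM * n" using CM n by (simp add: divide_le_eq)
    then have "x * d \<le> CM * n * sqrt d"
      using mult_right_mono[of "sqrt d * x" "CM * n" "sqrt d"] pos by (simp add: mult_ac)
    then have "4 * (1 + C)\<^sup>2 * (x * d) \<le> 4 * (1 + C)\<^sup>2 * (CM * n * sqrt d)"
      by (intro mult_left_mono) auto
    then have 1: "x * ?A + n * ?b \<le> 4 * (1 + C)\<^sup>2 * (CM * n * sqrt d) + n * ?b"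
      by (simp add: mult_ac)
    have "4 * (1 + C)\<^sup>2 * (CM * n * sqrt d) + n * ?b = (2 * (1 + C)\<^sup>2 * (n * sqrt d)) * (2 * CM + ?q)"
      by (simp add: real_sqrt_mult algebra_simps)
    also have "\<dots> \<le> (2 * (1 + C)\<^sup>2 * (n * sqrt d)) * (2 * ((1 + CM) * (1 + ?q)))"
    proof (rule mult_left_mono)
      have "0 \<le> CM * ?q" using CM q0 by simp
      then show "2 * CM + ?q \<le> 2 * ((1 + CM) * (1 + ?q))" using CM q0 by (simp add: algebra_simps)
    qed (use pos in simp)
    finally have 2: "x * ?A + n * ?b \<le> (2 * (1 + C)\<^sup>2 * (n * sqrt d)) * (2 * ((1 + CM) * (1 + ?q)))"
      using 1 by linarith
    have "41 * x * (x * ?A + n * ?b) \<le> 41 * x * ((2 * (1 + C)\<^sup>2 * (n * sqrt d)) * (2 * ((1 + CM) * (1 + ?q))))"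
      using 2 x by (intro mult_left_mono) auto
    also have "\<dots> = (?N * ?N / 2) * ?thr"
      using n by (simp add: \<kappa>U_def dev_scale_def field_simps)
    also have "\<dots> \<le> (real n * (real n - 1)) * ?thr"
    proof (rule mult_right_mono)
      have "?N * (?N / 2) \<le> ?N * (?N - 1)" using n by (intro mult_left_mono) auto
      then show "?N * ?N / 2 \<le> ?N * (?N - 1)" by simp
      show "0 \<le> ?thr" using CM dev_scale_pos x by (simp add: \<kappa>U_def)
    qed
    finally show ?thesis .
  qed
  have "measure (sample_law n s) {y \<in> space (sample_law n s). ?thr < \<bar>degenerate_U n s F y\<bar>}
     = measure ?\<Pi> {y \<in> space ?\<Pi>. (real n * (real n - 1)) * ?thr < \<bar>off_diag_sum n centred_kernel y\<bar>}"
    unfolding \<Pi>[symmetric]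
  proof (rule measure_eq_AE)
    show "AE y in sample_law n s.
       (y \<in> {y \<in> space (sample_law n s). ?thr < \<bar>degenerate_U n s F y\<bar>}) =
       (y \<in> {y \<in> space (sample_law n s). (real n * (real n - 1)) * ?thr < \<bar>off_diag_sum n centred_kernel y\<bar>})"
      using AE_sample_bv
    proof eventually_elim
      case (elim y)
      have eq: "off_diag_sum n centred_kernel y = (real n * (real n - 1)) * degenerate_U n s F y"
        using n elim unfolding degenerate_U_def off_diag_sum_def centred_kernel_def by simp
      have "w * t < \<bar>w * u\<bar> \<longleftrightarrow> t < \<bar>u\<bar>" if "0 < w" for w t u :: real
        using that by (simp add: abs_mult)
      moreover have "0 < real n * (real n - 1)" using n by simp
      ultimately show ?case by (simp only: eq mem_Collect_eq)
    qed
    show "{y \<in> space (sample_law n s). ?thr < \<bar>degenerate_U n s F y\<bar>} \<in> sets (sample_law n s)"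
      unfolding space_sample_law sets_sample_law by measurable
    show "{y \<in> space (sample_law n s). (real n * (real n - 1)) * ?thr < \<bar>off_diag_sum n centred_kernel y\<bar>} \<in> sets (sample_law n s)"
      by measurable
  qed
  also have "\<dots> \<le> measure ?\<Pi> {y \<in> space ?\<Pi>. 41 * x * (x * ?A + n * ?b) < \<bar>off_diag_sum n centred_kernel y\<bar>}"
    unfolding \<Pi>[symmetric]
  proof (rule S.finite_measure_mono)
    show "{y \<in> space (sample_law n s). 41 * x * (x * ?A + n * ?b) < \<bar>off_diag_sum n centred_kernel y\<bar>} \<in> sets (sample_law n s)"
      by measurable
    show "{y \<in> space (sample_law n s). (real n * (real n - 1)) * ?thr < \<bar>off_diag_sum n centred_kernel y\<bar>}
      \<subseteq> {y \<in> space (sample_law n s). 41 * x * (x * ?A + n * ?b) < \<bar>off_diag_sum n centred_kernel y\<bar>}"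
      using le_less_trans[OF thr] by blast
  qed
  also have "\<dots> \<le> exp (- x / 2)" by (rule K.off_diag_sum_tail) (rule x)
  finally show ?thesis .
qed

text \<open>
  The summands are bounded by \<open>2 a C \<surd>d\<close> and have variance at most a constant times \<open>a\<^sup>2 \<mu>\<close>, where
  \<open>\<mu> \<le> \<surd>\<mu> \<surd>d\<close>.  The hypothesis on \<open>\<surd>d x / n\<close> ensures that the parameter which is optimal for the
  Gaussian part is admissible in the Bernstein inequality up to a constant factor.
\<close>

lemma linear_sum_tail:
  assumes n: "2 \<le> n" and x: "2 \<le> x" and CM: "0 \<le> CM" "sqrt d * x / n \<le> CM"
  defines "a \<equiv> sqrt (\<Sum>\<psi>\<in>F. (inner s \<psi>)\<^sup>2)"
  shows "measure (sample_law n s) {y \<in> space (sample_law n s).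
      a * \<kappa>L C CM * sqrt (n * x * dev_scale M2 Minf d) < \<bar>linear_sum n s F y\<bar>} \<le> 2 * exp (- x / 2)"
proof (cases "a = 0")
  case True
  then have "(\<Sum>\<psi>\<in>F. (inner s \<psi>)\<^sup>2) = 0" by (simp add: a_def)
  then have "inner s \<psi> = 0" if "\<psi> \<in> F" for \<psi>
    using F that by (simp add: sum_nonneg_eq_0_iff)
  then have "linear_sum n s F y = 0" for y by (simp add: linear_sum_def)
  then show ?thesis using True by simp
next
  case False
  let ?\<mu> = "eff_dim M2 Minf d" and ?\<tau> = "dev_scale M2 Minf d"
  let ?\<Pi> = "Pi\<^sub>M {..<n} (\<lambda>_. observation_law s)"
  have \<Pi>: "sample_law n s = ?\<Pi>" by (simp add: sample_law_def)
  interpret S: prob_space "sample_law n s" by (rule prob_space_sample_law) (rule density)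
  define h where "h y = (\<Sum>\<psi>\<in>F. inner s \<psi> * centred \<psi> y)" for y
  have a: "0 < a" "a\<^sup>2 = (\<Sum>\<psi>\<in>F. (inner s \<psi>)\<^sup>2)"
    using False by (auto simp: a_def sum_nonneg less_le)
  have \<tau>: "0 < ?\<tau>" "sqrt d \<le> ?\<tau>" "?\<mu> \<le> ?\<tau>"
  proof -
    show "0 < ?\<tau>" by (rule dev_scale_pos)
    have "0 \<le> sqrt ?\<mu> * sqrt d" using eff_dim_pos pos by simp
    then show "sqrt d \<le> ?\<tau>" by (simp add: dev_scale_def distrib_right)
    have "?\<mu> = sqrt ?\<mu> * sqrt ?\<mu>" using eff_dim_pos by simp
    also have "\<dots> \<le> (1 + sqrt ?\<mu>) * sqrt d"
      using eff_dim_pos eff_dim_le by (intro mult_mono) auto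
    finally show "?\<mu> \<le> ?\<tau>" by (simp add: dev_scale_def)
  qed
  define \<theta> where "\<theta> = 1 / (2 * (1 + C) * (1 + CM))"
  define r where "r = sqrt (n * x * ?\<tau>)"
  have r: "0 < r" "r * r = n * x * ?\<tau>" using n x \<tau> by (auto simp: r_def)
  \<comment> \<open>Up to the factor \<open>\<theta>\<close> this balances \<open>n * lam * \<sigma>\<^sup>2\<close> and \<open>x / (2 * lam)\<close>; \<open>\<theta>\<close> is
    chosen so small that \<open>lam\<close> times the bound on the summands is at most \<open>1\<close>.\<close>
  define lam where "lam = \<theta> * x / (a * r)"
  have \<theta>: "0 < \<theta>" "\<theta> \<le> 1" "1 / \<theta> = 2 * (1 + C) * (1 + CM)"
  proof -
    have "1 * 1 \<le> (2 * (1 + C)) * (1 + CM)" using pos CM by (intro mult_mono) auto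
    then show "0 < \<theta>" "\<theta> \<le> 1" "1 / \<theta> = 2 * (1 + C) * (1 + CM)"
      unfolding \<theta>_def using pos CM by (auto simp: divide_le_eq)
  qed
  have lam: "0 < lam" using \<theta> x a r by (simp add: lam_def)
  have xr: "x * sqrt d \<le> (1 + CM) * r"
  proof -
    have "(x * sqrt d)\<^sup>2 = x * (sqrt d * x) * sqrt d" by (simp add: power2_eq_square)
    also have "\<dots> \<le> x * (CM * n) * ?\<tau>"
    proof (rule mult_mono)
      show "x * (sqrt d * x) \<le> x * (CM * n)"
        using CM n x by (intro mult_left_mono) (auto simp: divide_le_eq)
    qed (use CM n x \<tau> pos in auto)
    also have "\<dots> = CM * (r * r)" by (simp add: r(2))
    also have "\<dots> \<le> (1 + CM)\<^sup>2 * (r * r)"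
      using CM by (intro mult_right_mono) (auto simp: power2_eq_square algebra_simps)
    also have "\<dots> = ((1 + CM) * r)\<^sup>2" by (simp add: power2_eq_square)
    finally show ?thesis by (rule power2_le_imp_le) (use CM r in simp)
  qed
  have hb: "\<bar>h y\<bar> \<le> a * (2 * C * sqrt d)" for y
    unfolding h_def using sum_centred_sq_le a pos by (intro sum_abs_le_sqrt) auto
  have lamb: "lam * (a * (2 * C * sqrt d)) \<le> 1"
  proof -
    have "lam * (a * (2 * C * sqrt d)) = 2 * C * \<theta> * (x * sqrt d / r)"
      using a r by (simp add: lam_def field_simps)
    also have "\<dots> \<le> 2 * (1 + C) * \<theta> * (1 + CM)"
      using xr r pos \<theta> x by (intro mult_mono mult_right_mono) (auto simp: divide_le_eq)
    also have "\<dots> = 1" using \<theta> pos CM by (simp add: \<theta>_def field_simps)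
    finally show ?thesis .
  qed
  have hmean: "P.expectation h = 0" unfolding h_def by (rule expectation_combination)
  have hvar: "P.expectation (\<lambda>y. (h y)\<^sup>2) \<le> (1 + C)\<^sup>2 * ?\<mu> * a\<^sup>2"
    unfolding h_def a(2) by (rule variance_combination_le)
  have dev: "n * lam * ((1 + C)\<^sup>2 * ?\<mu> * a\<^sup>2) + (x / 2) / lam \<le> a * \<kappa>L C CM * r"
  proof -
    have "n * lam * ((1 + C)\<^sup>2 * ?\<mu> * a\<^sup>2) \<le> n * lam * ((1 + C)\<^sup>2 * ?\<tau> * a\<^sup>2)"
      using \<tau> lam by (intro mult_left_mono mult_right_mono) auto
    also have "\<dots> = \<theta> * ((1 + C)\<^sup>2 * a * (n * x * ?\<tau> / r))"
    proof -
      have "t * (\<theta> * x / (a * r)) * (c * e * a\<^sup>2) = \<theta> * (c * a * (t * x * e / r))" for t c e :: real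
        using a(1) r(1) by (simp add: power2_eq_square divide_simps)
      then show ?thesis unfolding lam_def .
    qed
    also have "n * x * ?\<tau> / r = r" unfolding r(2)[symmetric] using r(1) by simp
    also have "\<theta> * ((1 + C)\<^sup>2 * a * r) \<le> 1 * ((1 + C)\<^sup>2 * a * r)"
      using \<theta> a r by (intro mult_right_mono) auto
    finally have 1: "n * lam * ((1 + C)\<^sup>2 * ?\<mu> * a\<^sup>2) \<le> (1 + C)\<^sup>2 * a * r" by simp
    have "(x / 2) / lam = (1 / \<theta>) / 2 * (a * r)"
      using x a r \<theta>(1) by (simp add: lam_def)
    also have "\<dots> = (1 + C) * (1 + CM) * (a * r)" unfolding \<theta>(3) by simp
    finally show ?thesis using 1 by (simp add: \<kappa>L_def algebra_simps)
  qed
  let ?thr = "a * \<kappa>L C CM * r"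
  have hm [measurable]: "h \<in> borel_measurable borel" unfolding h_def by measurable
  have hsum [measurable]: "(\<lambda>y. \<Sum>i<n. h (y i)) \<in> borel_measurable (sample_law n s)"
    unfolding \<Pi> by measurable
  have "measure (sample_law n s) {y \<in> space (sample_law n s). ?thr < \<bar>linear_sum n s F y\<bar>}
     = measure (sample_law n s) {y \<in> space (sample_law n s). ?thr < \<bar>\<Sum>i<n. h (y i)\<bar>}"
  proof (rule measure_eq_AE)
    show "AE y in sample_law n s.
       (y \<in> {y \<in> space (sample_law n s). ?thr < \<bar>linear_sum n s F y\<bar>}) =
       (y \<in> {y \<in> space (sample_law n s). ?thr < \<bar>\<Sum>i<n. h (y i)\<bar>})"
      using AE_sample_bv
    proof eventually_elim
      case (elim y)
      then have "linear_sum n s F y = (\<Sum>i<n. h (y i))" unfolding linear_sum_def h_def by simp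
      then show ?case by simp
    qed
    show "{y \<in> space (sample_law n s). ?thr < \<bar>linear_sum n s F y\<bar>} \<in> sets (sample_law n s)"
      unfolding space_sample_law sets_sample_law by measurable
    show "{y \<in> space (sample_law n s). ?thr < \<bar>\<Sum>i<n. h (y i)\<bar>} \<in> sets (sample_law n s)"
      by measurable
  qed
  also have "\<dots> \<le> measure (sample_law n s) {y \<in> space (sample_law n s).
      n * lam * ((1 + C)\<^sup>2 * ?\<mu> * a\<^sup>2) + (x / 2) / lam < \<bar>\<Sum>i<n. h (y i)\<bar>}"
  proof (rule S.finite_measure_mono)
    show "{y \<in> space (sample_law n s). n * lam * ((1 + C)\<^sup>2 * ?\<mu> * a\<^sup>2) + (x / 2) / lam
      < \<bar>\<Sum>i<n. h (y i)\<bar>} \<in> sets (sample_law n s)" by measurable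
    show "{y \<in> space (sample_law n s). ?thr < \<bar>\<Sum>i<n. h (y i)\<bar>}
      \<subseteq> {y \<in> space (sample_law n s). n * lam * ((1 + C)\<^sup>2 * ?\<mu> * a\<^sup>2) + (x / 2) / lam
        < \<bar>\<Sum>i<n. h (y i)\<bar>}"
      using le_less_trans[OF dev] by blast
  qed
  also have "\<dots> \<le> 2 * exp (- (x / 2))"
    unfolding \<Pi> using hb hmean hvar lam lamb by (intro P.sum_two_sided_tail[of h]) auto
  finally show ?thesis by (simp add: r_def)
qed

end

section \<open>Exact formulas for the resampling penalty and the bias estimator\<close>

lemma off_diag_product_sum:
  fixes g :: "nat \<Rightarrow> real"
  shows "(\<Sum>i<n. \<Sum>j\<in>{..<n} - {i}. g i * g j) = (\<Sum>i<n. g i)\<^sup>2 - (\<Sum>i<n. (g i)\<^sup>2)"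
proof -
  have "(\<Sum>j\<in>{..<n} - {i}. g i * g j) = g i * (\<Sum>j<n. g j) - (g i)\<^sup>2" if "i < n" for i
    using that by (simp add: sum_diff1 sum_distrib_left power2_eq_square right_diff_distrib)
  then have "(\<Sum>i<n. \<Sum>j\<in>{..<n} - {i}. g i * g j) = (\<Sum>i<n. g i * (\<Sum>j<n. g j) - (g i)\<^sup>2)"
    by (intro sum.cong) auto
  then show ?thesis
    by (simp add: sum_subtractf sum_distrib_right power2_eq_square)
qed

lemma off_diag_family_sum:
  fixes g :: "'e \<Rightarrow> nat \<Rightarrow> real"
  shows "(\<Sum>i<n. \<Sum>j\<in>{..<n} - {i}. \<Sum>\<psi>\<in>F. g \<psi> i * g \<psi> j)
    = (\<Sum>\<psi>\<in>F. (\<Sum>i<n. g \<psi> i)\<^sup>2 - (\<Sum>i<n. (g \<psi> i)\<^sup>2))"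
proof -
  have "(\<Sum>i<n. \<Sum>j\<in>{..<n} - {i}. \<Sum>\<psi>\<in>F. g \<psi> i * g \<psi> j)
    = (\<Sum>i<n. \<Sum>\<psi>\<in>F. \<Sum>j\<in>{..<n} - {i}. g \<psi> i * g \<psi> j)"
    by (intro sum.cong refl sum.swap)
  also have "\<dots> = (\<Sum>\<psi>\<in>F. \<Sum>i<n. \<Sum>j\<in>{..<n} - {i}. g \<psi> i * g \<psi> j)"
    by (rule sum.swap)
  finally show ?thesis by (simp only: off_diag_product_sum)
qed

lemma degenerate_U_eq:
  "degenerate_U n s F x = (\<Sum>\<psi>\<in>F. ((\<Sum>i<n. rep_l2 \<psi> (x i) - inner s \<psi>)\<^sup>2
      - (\<Sum>i<n. (rep_l2 \<psi> (x i) - inner s \<psi>)\<^sup>2)) / (real n * (real n - 1)))"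
  unfolding degenerate_U_def off_diag_sum_def
  using off_diag_family_sum[where n = n and F = F and g = "\<lambda>\<psi> i. rep_l2 \<psi> (x i) - inner s \<psi>"]
  by (simp add: sum_divide_distrib)

text \<open>
  Only the covariances of the deviations \<open>weight_dev i\<close> of the weights from their mean enter \<open>p\<^sub>W\<close>.
  By exchangeability they are determined by the variance: those of distinct deviations are all equal,
  and the deviations sum to zero.
\<close>

context
  fixes n :: nat and Q :: "(nat \<Rightarrow> real) measure"
  assumes Q: "resampling_scheme n Q" and n: "2 \<le> n"
begin

interpretation Q: prob_space Q
  using Q by (simp add: resampling_scheme_def)

definition weight_dev :: "nat \<Rightarrow> (nat \<Rightarrow> real) \<Rightarrow> real" where
  "weight_dev i w = w i - weight_avg n w"

lemma weight_dev_measurable [measurable]: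
  "i < n \<Longrightarrow> weight_dev i \<in> borel_measurable (Pi\<^sub>M {..<n} (\<lambda>_. borel :: real measure))"
  unfolding weight_dev_def weight_avg_def by measurable

lemma measurable_Q: "measurable Q N = measurable (Pi\<^sub>M {..<n} (\<lambda>_. borel :: real measure)) N"
  using Q by (intro measurable_cong_sets) (auto simp: resampling_scheme_def)

lemma weight_dev_permute:
  assumes "\<pi> permutes {..<n}" "i < n"
  shows "weight_dev i (\<lambda>i\<in>{..<n}. w (\<pi> i)) = weight_dev (\<pi> i) w"
proof -
  have "(\<Sum>i<n. w (\<pi> i)) = (\<Sum>i<n. w i)"
    using sum.permute[OF assms(1), of w] by (simp add: o_def)
  then show ?thesis using assms(2) by (simp add: weight_dev_def weight_avg_def)
qed

lemma exchange:
  assumes \<pi>: "\<pi> permutes {..<n}" and ij: "i < n" "j < n"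
  shows "integrable Q (\<lambda>w. weight_dev (\<pi> i) w * weight_dev (\<pi> j) w) \<longleftrightarrow> integrable Q (\<lambda>w. weight_dev i w * weight_dev j w)"
    and "(\<integral>w. weight_dev (\<pi> i) w * weight_dev (\<pi> j) w \<partial>Q) = (\<integral>w. weight_dev i w * weight_dev j w \<partial>Q)"
    and "(\<integral>w. weight_dev (\<pi> i) w \<partial>Q) = (\<integral>w. weight_dev i w \<partial>Q)"
proof -
  let ?N = "Pi\<^sub>M {..<n} (\<lambda>_. borel :: real measure)"
  let ?p = "\<lambda>w. \<lambda>i\<in>{..<n}. w (\<pi> i)"
  have eq: "distr Q ?N ?p = Q" using Q \<pi> by (simp add: resampling_scheme_def)
  have "\<pi> i < n" if "i < n" for i
    using permutes_in_image[OF \<pi>, of i] that by simp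
  then have p: "?p \<in> measurable Q ?N"
    unfolding measurable_Q by (intro measurable_restrict) auto
  have m: "(\<lambda>w. weight_dev i w * weight_dev j w) \<in> borel_measurable ?N" "weight_dev i \<in> borel_measurable ?N"
    using ij by auto
  have "integrable Q (\<lambda>w. weight_dev i w * weight_dev j w) \<longleftrightarrow> integrable Q (\<lambda>w. weight_dev i (?p w) * weight_dev j (?p w))"
    using integrable_distr_eq[OF p m(1)] unfolding eq .
  then show "integrable Q (\<lambda>w. weight_dev (\<pi> i) w * weight_dev (\<pi> j) w) \<longleftrightarrow> integrable Q (\<lambda>w. weight_dev i w * weight_dev j w)"
    using ij by (simp add: weight_dev_permute[OF \<pi>])
  have "(\<integral>w. weight_dev i w * weight_dev j w \<partial>Q) = (\<integral>w. weight_dev i (?p w) * weight_dev j (?p w) \<partial>Q)"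
    using integral_distr[OF p m(1)] unfolding eq .
  then show "(\<integral>w. weight_dev (\<pi> i) w * weight_dev (\<pi> j) w \<partial>Q) = (\<integral>w. weight_dev i w * weight_dev j w \<partial>Q)"
    using ij by (simp add: weight_dev_permute[OF \<pi>])
  have "(\<integral>w. weight_dev i w \<partial>Q) = (\<integral>w. weight_dev i (?p w) \<partial>Q)"
    using integral_distr[OF p m(2)] unfolding eq .
  then show "(\<integral>w. weight_dev (\<pi> i) w \<partial>Q) = (\<integral>w. weight_dev i w \<partial>Q)"
    using ij by (simp add: weight_dev_permute[OF \<pi>])
qed

lemma sum_weight_dev: "(\<Sum>i<n. weight_dev i w) = 0"
  using n by (simp add: weight_dev_def weight_avg_def sum_subtractf)

lemma weight_dev_measurable_Q [measurable]: "i < n \<Longrightarrow> weight_dev i \<in> borel_measurable Q"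
  unfolding measurable_Q by (rule weight_dev_measurable)

lemma swap_permutes: "i < n \<Longrightarrow> j < n \<Longrightarrow> Transposition.transpose i j permutes {..<n}"
  by (rule permutes_swap_id) auto

lemma integrable_weight_dev_sq: "i < n \<Longrightarrow> integrable Q (\<lambda>w. weight_dev i w * weight_dev i w)"
  using exchange(1)[OF swap_permutes[of 0 i], of 0 0] n Q
  by (simp add: resampling_scheme_def weight_dev_def power2_eq_square)

lemma integrable_weight_dev_mult:
  assumes "i < n" "j < n"
  shows "integrable Q (\<lambda>w. weight_dev i w * weight_dev j w)"
proof (rule Bochner_Integration.integrable_bound)
  show "integrable Q (\<lambda>w. weight_dev i w * weight_dev i w + weight_dev j w * weight_dev j w)"
    using assms by (intro Bochner_Integration.integrable_add integrable_weight_dev_sq)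
  have "\<bar>a * b\<bar> \<le> \<bar>a * a + b * b\<bar>" for a b :: real
  proof -
    have "0 \<le> (\<bar>a\<bar> - \<bar>b\<bar>)\<^sup>2" by simp
    then have "2 * (\<bar>a\<bar> * \<bar>b\<bar>) \<le> a * a + b * b" by (simp add: power2_diff) (simp add: power2_eq_square)
    moreover have "0 \<le> \<bar>a\<bar> * \<bar>b\<bar>" by simp
    ultimately show ?thesis unfolding abs_mult by linarith
  qed
  then show "AE w in Q. norm (weight_dev i w * weight_dev j w) \<le> norm (weight_dev i w * weight_dev i w + weight_dev j w * weight_dev j w)"
    by simp
qed (use assms in measurable)

lemma integrable_weight_dev: "i < n \<Longrightarrow> integrable Q (weight_dev i)"
  using Q.square_integrable_imp_integrable[of "weight_dev i"] integrable_weight_dev_sq[of i]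
  by (simp add: power2_eq_square)

lemma expectation_weight_dev: "i < n \<Longrightarrow> (\<integral>w. weight_dev i w \<partial>Q) = 0"
proof -
  assume i: "i < n"
  have "(\<integral>w. weight_dev j w \<partial>Q) = (\<integral>w. weight_dev i w \<partial>Q)" if "j < n" for j
    using exchange(3)[OF swap_permutes[of i j], of i i] i that by simp
  then have "(\<Sum>j<n. \<integral>w. weight_dev j w \<partial>Q) = n * (\<integral>w. weight_dev i w \<partial>Q)" by simp
  moreover have "(\<Sum>j<n. \<integral>w. weight_dev j w \<partial>Q) = (\<integral>w. (\<Sum>j<n. weight_dev j w) \<partial>Q)"
    by (subst Bochner_Integration.integral_sum) (auto simp: integrable_weight_dev)
  ultimately show ?thesis using n by (simp add: sum_weight_dev)
qed

lemma expectation_weight_dev_sq: "i < n \<Longrightarrow> (\<integral>w. weight_dev i w * weight_dev i w \<partial>Q) = weight_var n Q"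
proof -
  assume i: "i < n"
  have "weight_var n Q = (\<integral>w. weight_dev 0 w * weight_dev 0 w \<partial>Q)"
    using expectation_weight_dev[of 0] n by (simp add: weight_var_def power2_eq_square flip: weight_dev_def)
  also have "\<dots> = (\<integral>w. weight_dev i w * weight_dev i w \<partial>Q)"
    using exchange(2)[OF swap_permutes[of 0 i], of 0 0] i n by simp
  finally show ?thesis by simp
qed

lemma expectation_weight_dev_mult:
  assumes ij: "i < n" "j < n" "i \<noteq> j"
  shows "(\<integral>w. weight_dev i w * weight_dev j w \<partial>Q) = - weight_var n Q / (n - 1)"
proof -
  have eq: "(\<integral>w. weight_dev i w * weight_dev k w \<partial>Q) = (\<integral>w. weight_dev i w * weight_dev j w \<partial>Q)" if "k < n" "k \<noteq> i" for k
    using exchange(2)[OF swap_permutes[of j k], of i j] ij that by (simp add: Transposition.transpose_def)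
  have "0 = (\<integral>w. (\<Sum>k<n. weight_dev i w * weight_dev k w) \<partial>Q)"
    by (simp add: sum_weight_dev flip: sum_distrib_left)
  also have "\<dots> = (\<Sum>k<n. \<integral>w. weight_dev i w * weight_dev k w \<partial>Q)"
    using ij by (intro Bochner_Integration.integral_sum integrable_weight_dev_mult) auto
  also have "\<dots> = (\<integral>w. weight_dev i w * weight_dev i w \<partial>Q) + (\<Sum>k\<in>{..<n} - {i}. \<integral>w. weight_dev i w * weight_dev k w \<partial>Q)"
    using ij by (intro sum.remove) auto
  also have "(\<Sum>k\<in>{..<n} - {i}. \<integral>w. weight_dev i w * weight_dev k w \<partial>Q)
      = (\<Sum>k\<in>{..<n} - {i}. \<integral>w. weight_dev i w * weight_dev j w \<partial>Q)"
    using eq by (intro sum.cong) auto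
  also have "\<dots> = (real n - 1) * (\<integral>w. weight_dev i w * weight_dev j w \<partial>Q)"
    using ij by (simp add: of_nat_diff)
  finally have "(real n - 1) * (\<integral>w. weight_dev i w * weight_dev j w \<partial>Q) = - weight_var n Q"
    using expectation_weight_dev_sq[OF ij(1)] by simp
  then show ?thesis using n by (simp add: field_simps of_nat_diff)
qed

lemma resampled_second_moment:
  "(\<integral>w. (\<Sum>i<n. weight_dev i w * f i)\<^sup>2 \<partial>Q)
    = weight_var n Q * ((\<Sum>i<n. (f i)\<^sup>2) - (\<Sum>i<n. \<Sum>j\<in>{..<n} - {i}. f i * f j) / (real n - 1))"
proof -
  let ?v = "weight_var n Q"
  have "(\<integral>w. (\<Sum>i<n. weight_dev i w * f i)\<^sup>2 \<partial>Q)
      = (\<integral>w. (\<Sum>i<n. \<Sum>j<n. (f i * f j) * (weight_dev i w * weight_dev j w)) \<partial>Q)"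
    by (simp add: power2_eq_square sum_product mult_ac)
  also have "\<dots> = (\<Sum>i<n. \<integral>w. (\<Sum>j<n. (f i * f j) * (weight_dev i w * weight_dev j w)) \<partial>Q)"
    by (intro Bochner_Integration.integral_sum Bochner_Integration.integrable_sum integrable_mult_right
        integrable_weight_dev_mult) auto
  also have "\<dots> = (\<Sum>i<n. \<Sum>j<n. (f i * f j) * (\<integral>w. weight_dev i w * weight_dev j w \<partial>Q))"
  proof (rule sum.cong[OF refl])
    fix i assume "i \<in> {..<n}"
    then have "(\<integral>w. (\<Sum>j<n. (f i * f j) * (weight_dev i w * weight_dev j w)) \<partial>Q)
      = (\<Sum>j<n. \<integral>w. (f i * f j) * (weight_dev i w * weight_dev j w) \<partial>Q)"
      by (intro Bochner_Integration.integral_sum integrable_mult_right integrable_weight_dev_mult) auto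
    then show "(\<integral>w. (\<Sum>j<n. (f i * f j) * (weight_dev i w * weight_dev j w)) \<partial>Q)
      = (\<Sum>j<n. (f i * f j) * (\<integral>w. weight_dev i w * weight_dev j w \<partial>Q))" by simp
  qed
  also have "\<dots> = (\<Sum>i<n. ?v * (f i)\<^sup>2 - ?v / (real n - 1) * (\<Sum>j\<in>{..<n} - {i}. f i * f j))"
  proof (rule sum.cong[OF refl])
    fix i assume i: "i \<in> {..<n}"
    have "(\<Sum>j<n. (f i * f j) * (\<integral>w. weight_dev i w * weight_dev j w \<partial>Q))
      = (f i * f i) * ?v + (\<Sum>j\<in>{..<n} - {i}. (f i * f j) * (\<integral>w. weight_dev i w * weight_dev j w \<partial>Q))"
      using i by (subst sum.remove[of _ i]) (auto simp: expectation_weight_dev_sq)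
    also have "(\<Sum>j\<in>{..<n} - {i}. (f i * f j) * (\<integral>w. weight_dev i w * weight_dev j w \<partial>Q))
      = (\<Sum>j\<in>{..<n} - {i}. (f i * f j) * (- ?v / (real n - 1)))"
      using i n by (intro sum.cong) (auto simp: expectation_weight_dev_mult of_nat_diff)
    also have "\<dots> = - ?v / (real n - 1) * (\<Sum>j\<in>{..<n} - {i}. f i * f j)"
      by (subst sum_distrib_right[symmetric]) (rule mult.commute)
    finally show "(\<Sum>j<n. (f i * f j) * (\<integral>w. weight_dev i w * weight_dev j w \<partial>Q))
      = ?v * (f i)\<^sup>2 - ?v / (real n - 1) * (\<Sum>j\<in>{..<n} - {i}. f i * f j)"
      by (simp add: power2_eq_square mult.commute)
  qed
  also have "\<dots> = ?v * ((\<Sum>i<n. (f i)\<^sup>2) - (\<Sum>i<n. \<Sum>j\<in>{..<n} - {i}. f i * f j) / (real n - 1))"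
    unfolding sum_subtractf sum_distrib_left[symmetric] by (simp add: right_diff_distrib)
  finally show ?thesis .
qed

lemma p_W_eq:
  "p_W n Q B x = (\<Sum>\<psi>\<in>B. ((\<Sum>i<n. (rep_l2 \<psi> (x i))\<^sup>2)
     - ((\<Sum>i<n. rep_l2 \<psi> (x i))\<^sup>2 - (\<Sum>i<n. (rep_l2 \<psi> (x i))\<^sup>2)) / (real n - 1)) / (real n)\<^sup>2)"
proof -
  have v: "0 < weight_var n Q" using Q by (simp add: resampling_scheme_def)
  have "(\<integral>w. (weighted_mean n w x \<psi> - weight_avg n w * emp_mean n x \<psi>)\<^sup>2 \<partial>Q)
    = weight_var n Q * (((\<Sum>i<n. (rep_l2 \<psi> (x i))\<^sup>2)
     - ((\<Sum>i<n. rep_l2 \<psi> (x i))\<^sup>2 - (\<Sum>i<n. (rep_l2 \<psi> (x i))\<^sup>2)) / (real n - 1)) / (real n)\<^sup>2)" for \<psi>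
  proof -
    have "(weighted_mean n w x \<psi> - weight_avg n w * emp_mean n x \<psi>)\<^sup>2
      = (\<Sum>i<n. weight_dev i w * rep_l2 \<psi> (x i))\<^sup>2 / (real n)\<^sup>2" for w
      by (simp add: weighted_mean_def emp_mean_def weight_dev_def left_diff_distrib sum_subtractf
          flip: sum_distrib_left diff_divide_distrib power_divide)
    then show ?thesis
      by (simp add: resampled_second_moment off_diag_product_sum)
  qed
  then show ?thesis using v by (simp add: p_W_def sum_distrib_left)
qed

text \<open>
  \<open>p\<^sub>W\<close> is a sum of empirical variances, which are at most the empirical second moments.
\<close>

lemma p_W_le:
  assumes "\<And>i. i < n \<Longrightarrow> (\<Sum>\<psi>\<in>B. (rep_l2 \<psi> (x i))\<^sup>2) \<le> D"
  shows "p_W n Q B x \<le> 2 * D / n"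
proof -
  have n1: "0 < real n - 1" "real n / 2 \<le> real n - 1" using n by auto
  have "p_W n Q B x \<le> (\<Sum>\<psi>\<in>B. (\<Sum>i<n. (rep_l2 \<psi> (x i))\<^sup>2) / (n * (real n - 1)))"
    unfolding p_W_eq
  proof (rule sum_mono)
    fix \<psi>
    let ?q = "\<Sum>i<n. (rep_l2 \<psi> (x i))\<^sup>2" and ?t = "\<Sum>i<n. rep_l2 \<psi> (x i)"
    have "(?q - (?t\<^sup>2 - ?q) / (real n - 1)) / (real n)\<^sup>2 \<le> (?q + ?q / (real n - 1)) / (real n)\<^sup>2"
    proof (rule divide_right_mono)
      have "(?q - ?t\<^sup>2) / (real n - 1) \<le> ?q / (real n - 1)"
        using n1 by (intro divide_right_mono) auto
      then show "?q - (?t\<^sup>2 - ?q) / (real n - 1) \<le> ?q + ?q / (real n - 1)"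
        by (simp add: diff_divide_distrib)
    qed simp
    also have "\<dots> = ?q / (n * (real n - 1))"
      using n1 n by (simp add: divide_simps power2_eq_square) (simp add: algebra_simps)
    finally show "(?q - (?t\<^sup>2 - ?q) / (real n - 1)) / (real n)\<^sup>2 \<le> ?q / (n * (real n - 1))" .
  qed
  also have "\<dots> = (\<Sum>i<n. \<Sum>\<psi>\<in>B. (rep_l2 \<psi> (x i))\<^sup>2) / (n * (real n - 1))"
    by (subst sum.swap) (simp add: sum_divide_distrib)
  also have "\<dots> \<le> (\<Sum>i<n. D) / (n * (real n - 1))"
    using assms n1 by (intro divide_right_mono sum_mono) auto
  also have "\<dots> = D / (real n - 1)" using n by simp
  also have "\<dots> \<le> D / (real n / 2)"
  proof (rule divide_left_mono)
    have "0 \<le> (\<Sum>\<psi>\<in>B. (rep_l2 \<psi> (x 0))\<^sup>2)" by (simp add: sum_nonneg)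
    also have "\<dots> \<le> D" using assms n by simp
    finally show "0 \<le> D" .
  qed (use n1 n in auto)
  finally show ?thesis by (simp add: mult.commute)
qed

text \<open>
  Empirical variances do not change when a constant is subtracted from the observations, so
  \<open>inner s \<psi>\<close> can be subtracted in \<open>p\<^sub>W\<close> too.  The diagonal terms then cancel, and the off-diagonal
  coefficients \<open>1 / n\<^sup>2\<close> and \<open>1 / (n\<^sup>2 (n - 1))\<close> add up to \<open>1 / (n (n - 1))\<close>.
\<close>

lemma proj_error_eq:
  "(\<Sum>\<psi>\<in>B. (emp_mean n x \<psi> - inner s \<psi>)\<^sup>2) = p_W n Q B x + degenerate_U n s B x"
proof -
  have n1: "real n - 1 \<noteq> 0" "real n \<noteq> 0" using n by auto
  show ?thesis
    unfolding degenerate_U_eq p_W_eq sum.distrib[symmetric]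
  proof (rule sum.cong[OF refl])
    fix \<psi>
    define t where "t = (\<Sum>i<n. rep_l2 \<psi> (x i))"
    define q where "q = (\<Sum>i<n. (rep_l2 \<psi> (x i))\<^sup>2)"
    define c where "c = inner s \<psi>"
    have 1: "(\<Sum>i<n. rep_l2 \<psi> (x i) - c) = t - n * c"
      by (simp add: t_def sum_subtractf)
    have 2: "(\<Sum>i<n. (rep_l2 \<psi> (x i) - c)\<^sup>2) = q - 2 * c * t + n * c\<^sup>2"
      by (simp add: t_def q_def power2_diff sum_subtractf sum.distrib sum_distrib_left mult_ac)
    have "(t / N - c)\<^sup>2 = (q - (t\<^sup>2 - q) / (N - 1)) / N\<^sup>2 +
      ((t - N * c)\<^sup>2 - (q - 2 * c * t + N * c\<^sup>2)) / (N * (N - 1))" if "N \<noteq> 0" "N - 1 \<noteq> 0" for N :: real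
      using that by (simp add: divide_simps power2_eq_square) (simp add: algebra_simps)
    from this[OF n1(2,1)]
    show "(emp_mean n x \<psi> - inner s \<psi>)\<^sup>2 =
      ((\<Sum>i<n. (rep_l2 \<psi> (x i))\<^sup>2) - ((\<Sum>i<n. rep_l2 \<psi> (x i))\<^sup>2 - (\<Sum>i<n. (rep_l2 \<psi> (x i))\<^sup>2)) / (real n - 1)) / (real n)\<^sup>2
      + ((\<Sum>i<n. rep_l2 \<psi> (x i) - inner s \<psi>)\<^sup>2 - (\<Sum>i<n. (rep_l2 \<psi> (x i) - inner s \<psi>)\<^sup>2)) / (real n * (real n - 1))"
      unfolding emp_mean_def c_def[symmetric] 1 2 t_def[symmetric] q_def[symmetric] .
  qed
qed

end

lemma p_b_eq:
  assumes n: "2 \<le> n"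
  shows "p_b n B B' x = degenerate_U n s (B' - B) x + 2 / n * linear_sum n s (B' - B) x + (\<Sum>\<psi>\<in>B' - B. (inner s \<psi>)\<^sup>2)"
proof -
  let ?F = "B' - B"
  have n1: "real n - 1 \<noteq> 0" "real n \<noteq> 0" using n by auto
  have pb: "p_b n B B' x = (\<Sum>\<psi>\<in>?F. ((\<Sum>i<n. rep_l2 \<psi> (x i))\<^sup>2 - (\<Sum>i<n. (rep_l2 \<psi> (x i))\<^sup>2)) / (real n * (real n - 1)))"
    unfolding p_b_def using off_diag_family_sum[where n = n and F = ?F and g = "\<lambda>\<psi> i. rep_l2 \<psi> (x i)"] by (simp add: sum_divide_distrib)
  have L: "2 / n * linear_sum n s ?F x = (\<Sum>\<psi>\<in>?F. 2 / n * (inner s \<psi> * (\<Sum>i<n. rep_l2 \<psi> (x i) - inner s \<psi>)))"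
    unfolding linear_sum_def by (subst sum.swap) (simp add: sum_distrib_left)
  show ?thesis
    unfolding pb degenerate_U_eq L sum.distrib[symmetric]
  proof (rule sum.cong[OF refl])
    fix \<psi>
    define t where "t = (\<Sum>i<n. rep_l2 \<psi> (x i))"
    define q where "q = (\<Sum>i<n. (rep_l2 \<psi> (x i))\<^sup>2)"
    define c where "c = inner s \<psi>"
    have 1: "(\<Sum>i<n. rep_l2 \<psi> (x i) - c) = t - n * c"
      by (simp add: t_def sum_subtractf)
    have 2: "(\<Sum>i<n. (rep_l2 \<psi> (x i) - c)\<^sup>2) = q - 2 * c * t + n * c\<^sup>2"
      by (simp add: t_def q_def power2_diff sum_subtractf sum.distrib sum_distrib_left mult_ac)
    have "(t\<^sup>2 - q) / (N * (N - 1)) =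
      ((t - N * c)\<^sup>2 - (q - 2 * c * t + N * c\<^sup>2)) / (N * (N - 1)) + 2 / N * (c * (t - N * c)) + c\<^sup>2"
      if "N \<noteq> 0" "N - 1 \<noteq> 0" for N :: real
      using that by (simp add: divide_simps power2_eq_square) (simp add: algebra_simps)
    from this[OF n1(2,1)]
    show "((\<Sum>i<n. rep_l2 \<psi> (x i))\<^sup>2 - (\<Sum>i<n. (rep_l2 \<psi> (x i))\<^sup>2)) / (real n * (real n - 1)) =
      ((\<Sum>i<n. rep_l2 \<psi> (x i) - inner s \<psi>)\<^sup>2 - (\<Sum>i<n. (rep_l2 \<psi> (x i) - inner s \<psi>)\<^sup>2)) / (real n * (real n - 1))
      + 2 / n * (inner s \<psi> * (\<Sum>i<n. rep_l2 \<psi> (x i) - inner s \<psi>)) + (inner s \<psi>)\<^sup>2"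
      unfolding c_def[symmetric] 1 2 t_def[symmetric] q_def[symmetric] .
  qed
qed

section \<open>Distances to a finite dimensional space\<close>

lemma norm_sq_diff_combination:
  fixes t :: "'a::real_inner"
  assumes F: "finite F" "pairwise orthogonal F" "\<And>\<psi>. \<psi> \<in> F \<Longrightarrow> norm \<psi> = 1"
  shows "(norm (t - (\<Sum>\<psi>\<in>F. e \<psi> *\<^sub>R \<psi>)))\<^sup>2
    = (norm t)\<^sup>2 - (\<Sum>\<psi>\<in>F. (inner t \<psi>)\<^sup>2) + (\<Sum>\<psi>\<in>F. (e \<psi> - inner t \<psi>)\<^sup>2)"
proof -
  let ?y = "\<Sum>\<psi>\<in>F. e \<psi> *\<^sub>R \<psi>"
  have "(norm (t - ?y))\<^sup>2 = (norm t)\<^sup>2 + (norm ?y)\<^sup>2 - 2 * inner t ?y"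
    by (simp add: power2_norm_eq_inner inner_diff_left inner_diff_right inner_commute)
  also have "(norm ?y)\<^sup>2 = (\<Sum>\<psi>\<in>F. (e \<psi>)\<^sup>2)" by (rule norm_sq_linear_combination[OF F])
  also have "inner t ?y = (\<Sum>\<psi>\<in>F. e \<psi> * inner t \<psi>)" by (simp add: inner_sum_right)
  finally show ?thesis
    by (simp add: power2_diff sum.distrib sum_subtractf sum_distrib_left mult.assoc)
qed

lemma orth_proj_eq:
  assumes B: "orthonormal_basis B S"
  shows "orth_proj S t = (\<Sum>\<psi>\<in>B. inner t \<psi> *\<^sub>R \<psi>)"
proof -
  let ?p = "\<Sum>\<psi>\<in>B. inner t \<psi> *\<^sub>R \<psi>"
  have fin: "finite B" and orth: "pairwise orthogonal B" and nrm: "\<And>b. b \<in> B \<Longrightarrow> norm b = 1"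
    and S: "span B = S" using B by (auto simp: orthonormal_basis_def)
  have pS: "?p \<in> S" unfolding S[symmetric] by (intro span_sum span_scale span_base)
  have pb: "inner (t - ?p) b = 0" if b: "b \<in> B" for b
  proof -
    have "inner ?p b = (\<Sum>\<psi>\<in>B. inner t \<psi> * inner \<psi> b)" by (simp add: inner_sum_left)
    also have "\<dots> = inner t b * inner b b + (\<Sum>\<psi>\<in>B - {b}. inner t \<psi> * inner \<psi> b)"
      using fin b by (rule sum.remove)
    also have "(\<Sum>\<psi>\<in>B - {b}. inner t \<psi> * inner \<psi> b) = 0"
      using orth b by (intro sum.neutral) (auto simp: pairwise_def orthogonal_def)
    also have "inner b b = 1" using nrm[OF b] by (simp add: norm_eq_1)
    finally show ?thesis by (simp add: inner_diff_left)
  qed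
  have orthS: "inner (t - ?p) z = 0" if "z \<in> S" for z
    using that unfolding S[symmetric]
  proof (induction rule: span_induct_alt)
    case base
    then show ?case by simp
  next
    case (step c x y)
    then show ?case using pb[of x] by (simp add: inner_add_right)
  qed
  show ?thesis
    unfolding orth_proj_def
  proof (rule the_equality)
    show "?p \<in> S \<and> (\<forall>z\<in>S. inner (t - ?p) z = 0)" using pS orthS by auto
  next
    fix p assume p: "p \<in> S \<and> (\<forall>z\<in>S. inner (t - p) z = 0)"
    have "?p - p \<in> S" using p pS S subspace_span[of B] by (auto intro: subspace_diff)
    then have "inner (t - p) (?p - p) - inner (t - ?p) (?p - p) = 0" using p orthS by simp
    then have "inner (?p - p) (?p - p) = 0" by (simp add: inner_diff_left)
    then show "p = ?p" by simp
  qed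
qed

lemma norm_sq_diff_orth_proj:
  assumes B: "orthonormal_basis B S"
  shows "(norm (t - orth_proj S t))\<^sup>2 = (norm t)\<^sup>2 - (\<Sum>\<psi>\<in>B. (inner t \<psi>)\<^sup>2)"
  using norm_sq_diff_combination[of B t "inner t"] B
  by (simp add: orth_proj_eq[OF B]) (simp add: orthonormal_basis_def)

section \<open>Measurability and deviations for one model\<close>

lemma dim_eq_card_orthonormal_basis:
  assumes "orthonormal_basis B S"
  shows "dim S = card B"
proof -
  have "0 \<notin> B" using assms by (auto simp: orthonormal_basis_def)
  then have "independent B"
    using assms by (intro pairwise_orthogonal_independent) (auto simp: orthonormal_basis_def)
  then show ?thesis
    using assms dim_span_eq_card_independent by (auto simp: orthonormal_basis_def)
qed

lemma dev_scale_nonneg: "0 < M2 \<Longrightarrow> 0 < Minf \<Longrightarrow> 0 \<le> d \<Longrightarrow> 0 \<le> dev_scale M2 Minf d"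
  by (simp add: dev_scale_def eff_dim_def)

lemma sampled_family_of_basis:
  assumes "is_density s" "norm s \<le> M2" "sup_norm s \<le> ereal Minf" "0 < M2" "0 < Minf" "0 < C"
    and basis: "orthonormal_basis Bs T" "F \<subseteq> Bs" "F \<noteq> {}"
    and "\<And>t. t \<in> T \<Longrightarrow> sup_norm t \<le> ereal (C * sqrt (real (dim T)) * norm t)"
  shows "sampled_family s T F C M2 Minf (real (dim T))"
proof unfold_locales
  have Bs: "finite Bs" "Bs \<noteq> {}" using basis by (auto simp: orthonormal_basis_def)
  then show "1 \<le> real (dim T)"
    using dim_eq_card_orthonormal_basis[OF basis(1)] by (simp add: Suc_le_eq card_gt_0_iff)
  show "subspace T" "F \<subseteq> T" using basis subspace_span span_superset by (auto simp: orthonormal_basis_def)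
  show "finite F" using Bs basis by (auto intro: finite_subset)
  show "pairwise orthogonal F" using basis by (auto simp: orthonormal_basis_def intro: pairwise_subset)
  show "norm \<psi> = 1" if "\<psi> \<in> F" for \<psi> using basis that by (auto simp: orthonormal_basis_def)
qed (use assms in auto)

text \<open>
  The empty family is separate, as the dimension may then be zero; both statistics vanish for it.
\<close>

lemma tails_of_basis:
  assumes s: "is_density s" "norm s \<le> M2" "sup_norm s \<le> ereal Minf" and pos: "0 < M2" "0 < Minf" "0 < C"
    and basis: "orthonormal_basis Bs T" "F \<subseteq> Bs"
    and bound: "\<And>t. t \<in> T \<Longrightarrow> sup_norm t \<le> ereal (C * sqrt (real (dim T)) * norm t)"
    and n: "2 \<le> n" and x: "2 \<le> x" and CM: "0 \<le> CM" "sqrt (real (dim T)) * x / n \<le> CM"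
  shows "measure (sample_law n s) {y \<in> space (sample_law n s).
      \<kappa>U C CM * dev_scale M2 Minf (real (dim T)) * x / n < \<bar>degenerate_U n s F y\<bar>} \<le> exp (- x / 2)" (is "measure _ ?U \<le> _")
    and "measure (sample_law n s) {y \<in> space (sample_law n s).
      sqrt (\<Sum>\<psi>\<in>F. (inner s \<psi>)\<^sup>2) * \<kappa>L C CM * sqrt (n * x * dev_scale M2 Minf (real (dim T)))
        < \<bar>linear_sum n s F y\<bar>} \<le> 2 * exp (- x / 2)" (is "measure _ ?L \<le> _")
proof -
  have "measure (sample_law n s) ?U \<le> exp (- x / 2) \<and> measure (sample_law n s) ?L \<le> 2 * exp (- x / 2)"
  proof (cases "F = {}")
    case True
    have "0 \<le> \<kappa>U C CM * dev_scale M2 Minf (real (dim T)) * x / n"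
      using pos x CM dev_scale_nonneg[of M2 Minf "real (dim T)"] by (simp add: \<kappa>U_def)
    then have U0: "?U = {}" using True by (auto simp: degenerate_U_def off_diag_sum_def)
    have L0: "?L = {}" using True by (auto simp: linear_sum_def)
    show ?thesis unfolding U0 L0 by simp
  next
    case False
    interpret sampled_family s T F C M2 Minf "real (dim T)"
      using assms False by (intro sampled_family_of_basis)
    show ?thesis using degenerate_U_tail[OF n x CM] linear_sum_tail[OF n x CM] by simp
  qed
  then show "measure (sample_law n s) ?U \<le> exp (- x / 2)" "measure (sample_law n s) ?L \<le> 2 * exp (- x / 2)"
    by auto
qed

text \<open>
  The constant \<open>\<kappa>\<^sub>b\<close> of the radius: the first term comes from the linear part, after its product with
  the bias is split by \<open>2 a q \<le> \<epsilon> a\<^sup>2 + q\<^sup>2 / \<epsilon>\<close>.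
\<close>

definition \<kappa>B :: "real \<Rightarrow> real \<Rightarrow> real \<Rightarrow> real" where
  "\<kappa>B C CM \<epsilon> = (\<kappa>L C CM)\<^sup>2 / \<epsilon> + \<kappa>U C CM"

lemma p_b_deviation:
  assumes n: "2 \<le> n" and \<epsilon>: "0 < \<epsilon>" and x\<tau>: "0 \<le> x" "0 \<le> \<tau>"
    and a: "a = sqrt (\<Sum>\<psi>\<in>B' - B. (inner s \<psi>)\<^sup>2)"
    and U: "\<bar>degenerate_U n s (B' - B) y\<bar> \<le> \<kappa>U C CM * \<tau> * x / n"
    and L: "\<bar>linear_sum n s (B' - B) y\<bar> \<le> a * \<kappa>L C CM * sqrt (n * x * \<tau>)"
  shows "\<bar>p_b n B B' y - a\<^sup>2\<bar> \<le> \<epsilon> * a\<^sup>2 + \<kappa>B C CM \<epsilon> * \<tau> * x / n"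
proof -
  have a2: "a\<^sup>2 = (\<Sum>\<psi>\<in>B' - B. (inner s \<psi>)\<^sup>2)" by (simp add: a sum_nonneg)
  let ?q = "\<kappa>L C CM * sqrt (x * \<tau> / n)"
  have "p_b n B B' y - a\<^sup>2 = degenerate_U n s (B' - B) y + 2 / n * linear_sum n s (B' - B) y"
    using p_b_eq[OF n, of B B' y s] a2 by simp
  then have "\<bar>p_b n B B' y - a\<^sup>2\<bar> \<le> \<bar>degenerate_U n s (B' - B) y\<bar> + 2 / n * \<bar>linear_sum n s (B' - B) y\<bar>"
    by (simp add: abs_triangle_ineq[THEN order_trans] abs_mult)
  also have "\<dots> \<le> \<kappa>U C CM * \<tau> * x / n + 2 / n * (a * \<kappa>L C CM * sqrt (n * x * \<tau>))"
    by (intro add_mono U mult_left_mono L) simp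
  also have "2 / n * (a * \<kappa>L C CM * sqrt (n * x * \<tau>)) = 2 * (a * ?q)"
  proof -
    have "sqrt (n * x * \<tau>) = n * sqrt (x * \<tau> / n)"
    proof -
      have eq: "n * x * \<tau> = (real n)\<^sup>2 * (x * \<tau> / n)" using n by (simp add: power2_eq_square)
      show ?thesis unfolding eq real_sqrt_mult[of "(real n)\<^sup>2"] by simp
    qed
    then show ?thesis using n by simp
  qed
  also have "2 * (a * ?q) \<le> \<epsilon> * a\<^sup>2 + ?q\<^sup>2 / \<epsilon>"
  proof -
    have "0 \<le> (\<epsilon> * a - ?q)\<^sup>2 / \<epsilon>" using \<epsilon> by simp
    also have "\<dots> = \<epsilon> * a\<^sup>2 + ?q\<^sup>2 / \<epsilon> - 2 * (a * ?q)"
      using \<epsilon> by (simp add: power2_diff power_mult_distrib field_simps) (simp add: power2_eq_square)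
    finally show ?thesis by simp
  qed
  also have "?q\<^sup>2 = (\<kappa>L C CM)\<^sup>2 * (x * \<tau> / n)"
    using x\<tau> by (simp add: power_mult_distrib)
  finally show ?thesis
    using n \<epsilon> by (simp add: \<kappa>B_def field_simps)
qed

lemma le_of_K_term:
  assumes "\<And>\<epsilon>. \<epsilon> \<in> {0<..<1} \<Longrightarrow> a \<le> f \<epsilon>"
  shows "ereal a \<le> (INF \<epsilon>\<in>{0<..<1}. ereal (f \<epsilon>))"
  by (rule INF_greatest) (simp add: assms)

text \<open>
  The infimum is over uncountably many \<open>\<epsilon>\<close>, but as a function of \<open>g x\<close> it is an infimum of continuous
  functions, hence upper semicontinuous.
\<close>

lemma borel_measurable_INF_affine:
  fixes c :: "real \<Rightarrow> real" and g :: "'a \<Rightarrow> real"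
  assumes g [measurable]: "g \<in> borel_measurable N"
  shows "(\<lambda>x. INF \<epsilon>\<in>{0<..<1::real}. ereal (g x / (1 - \<epsilon>) + c \<epsilon>)) \<in> borel_measurable N"
proof -
  define F where "F p = (INF \<epsilon>\<in>{0<..<1::real}. ereal (p / (1 - \<epsilon>) + c \<epsilon>))" for p :: real
  have "F \<in> borel_measurable borel"
  proof (rule borel_measurableI_less)
    fix y
    have "{p \<in> space borel. F p < y} = (\<Union>\<epsilon>\<in>{0<..<1}. {p. ereal (p / (1 - \<epsilon>) + c \<epsilon>) < y})"
      by (auto simp: F_def INF_less_iff)
    moreover have "open {p. ereal (p / (1 - \<epsilon>) + c \<epsilon>) < y}" for \<epsilon>
      unfolding divide_inverse by (intro open_Collect_less continuous_on_ereal continuous_intros)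
    ultimately show "{p \<in> space borel. F p < y} \<in> sets borel"
      by (simp add: borel_open open_UN)
  qed
  from measurable_compose[OF g this] show ?thesis by (simp add: F_def)
qed

lemma emp_mean_measurable [measurable]:
  "(\<lambda>x. emp_mean n x t) \<in> borel_measurable (Pi\<^sub>M {..<n} (\<lambda>_. borel :: real measure))"
  unfolding emp_mean_def by (intro borel_measurable_divide borel_measurable_sum) auto

text \<open>
  The exact formulas hold for every centring, in particular for \<open>0\<close> in place of \<open>s\<close>; this reduces
  the measurability of \<open>p\<^sub>b\<close> and \<open>p\<^sub>W\<close> to that of the statistics above.
\<close>

lemma p_b_measurable [measurable]:
  "2 \<le> n \<Longrightarrow> p_b n B B' \<in> borel_measurable (Pi\<^sub>M {..<n} (\<lambda>_. borel :: real measure))"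
proof -
  assume n: "2 \<le> n"
  have "p_b n B B' = (\<lambda>x. degenerate_U n 0 (B' - B) x + 2 / n * linear_sum n 0 (B' - B) x + (\<Sum>\<psi>\<in>B' - B. (inner 0 \<psi>)\<^sup>2))"
    by (rule ext) (rule p_b_eq[OF n])
  then show ?thesis by simp
qed

lemma p_W_measurable:
  assumes "resampling_scheme n Q" "2 \<le> n"
  shows "p_W n Q B \<in> borel_measurable (Pi\<^sub>M {..<n} (\<lambda>_. borel :: real measure))"
proof -
  have "p_W n Q B = (\<lambda>x. (\<Sum>\<psi>\<in>B. (emp_mean n x \<psi> - inner 0 \<psi>)\<^sup>2) - degenerate_U n 0 B x)"
    by (rule ext) (simp only: proj_error_eq[OF assms] add_diff_cancel_right')
  then show ?thesis by simp
qed

lemma rho_hat_measurable: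
  assumes "resampling_scheme n Q" "2 \<le> n"
  shows "(\<lambda>x. rho_hat \<kappa>v \<kappa>b M2 Minf n M S Q B B' \<eta> \<beta> x m)
    \<in> borel_measurable (Pi\<^sub>M {..<n} (\<lambda>_. borel :: real measure))"
proof -
  have [measurable]: "(\<lambda>x. K_term \<kappa>b M2 Minf n M S B B' \<beta> x m) \<in> borel_measurable (Pi\<^sub>M {..<n} (\<lambda>_. borel :: real measure))"
    unfolding K_term_def Let_def using assms(2) by (intro borel_measurable_INF_affine) auto
  have [measurable]: "(\<lambda>x. V_term \<kappa>v M2 Minf n M S Q B \<beta> x m) \<in> borel_measurable (Pi\<^sub>M {..<n} (\<lambda>_. borel :: real measure))"
    unfolding V_term_def Let_def using p_W_measurable[OF assms, of "B m"] by simp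
  show ?thesis unfolding rho_hat_def by measurable
qed

lemma norm_diff_proj_estimator:
  assumes "orthonormal_basis B S"
  shows "(norm (s - proj_estimator n B x))\<^sup>2
    = (norm s)\<^sup>2 - (\<Sum>\<psi>\<in>B. (inner s \<psi>)\<^sup>2) + (\<Sum>\<psi>\<in>B. (emp_mean n x \<psi> - inner s \<psi>)\<^sup>2)"
  unfolding proj_estimator_def using assms
  by (intro norm_sq_diff_combination) (auto simp: orthonormal_basis_def)

text \<open>
  A lower bound on the probability of coverage needs the event to be measurable, as the measure of
  any other set is \<open>0\<close>.  The event is split along the finitely many values of the selected index.
\<close>

lemma covering_event_measurable:
  assumes "resampling_scheme n Q" "2 \<le> n" "finite M"
    and bases: "\<And>m. m \<in> M \<Longrightarrow> orthonormal_basis (B m) (S m)"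
    and sel: "selector n M (rho_hat \<kappa>v \<kappa>b M2 Minf n M S Q B B' \<eta> \<beta>) mhat"
  defines "\<Omega> \<equiv> space (Pi\<^sub>M {..<n} (\<lambda>_. borel :: real measure))"
  shows "{x \<in> \<Omega>. s \<in> B_hat n B (rho_hat \<kappa>v \<kappa>b M2 Minf n M S Q B B' \<eta> \<beta>) mhat x}
    \<in> sets (Pi\<^sub>M {..<n} (\<lambda>_. borel :: real measure))"
proof -
  let ?N = "Pi\<^sub>M {..<n} (\<lambda>_. borel :: real measure)"
  let ?\<rho> = "rho_hat \<kappa>v \<kappa>b M2 Minf n M S Q B B' \<eta> \<beta>"
  have mM: "mhat x \<in> M" if "x \<in> \<Omega>" for x
    using sel that by (auto simp: selector_def \<Omega>_def is_arg_min_def)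
  have mh [measurable]: "mhat \<in> ?N \<rightarrow>\<^sub>M count_space UNIV" using sel by (simp add: selector_def)
  have "{x \<in> \<Omega>. s \<in> B_hat n B ?\<rho> mhat x}
     = (\<Union>m\<in>M. {x \<in> \<Omega>. mhat x = m \<and> norm (s - proj_estimator n (B m) x) \<le> ?\<rho> x m})"
    using mM by (auto simp: B_hat_def)
  also have "\<dots> \<in> sets ?N"
  proof (rule sets.finite_UN[OF assms(3)])
    fix m assume m: "m \<in> M"
    define f g where "f x = norm (s - proj_estimator n (B m) x)" and "g x = ?\<rho> x m" for x
    have g: "g \<in> borel_measurable ?N"
      unfolding g_def by (rule rho_hat_measurable) fact+
    have "norm (s - proj_estimator n (B m) x) = sqrt ((norm s)\<^sup>2 - (\<Sum>\<psi>\<in>B m. (inner s \<psi>)\<^sup>2)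
        + (\<Sum>\<psi>\<in>B m. (emp_mean n x \<psi> - inner s \<psi>)\<^sup>2))" for x
      using norm_diff_proj_estimator[OF bases[OF m], of s n x] by (metis norm_ge_zero real_sqrt_unique)
    then have f: "f \<in> borel_measurable ?N"
      unfolding f_def by simp
    have "{x \<in> \<Omega>. mhat x = m} \<inter> {x \<in> \<Omega>. f x \<le> g x} \<in> sets ?N"
    proof (rule sets.Int)
      show "{x \<in> \<Omega>. mhat x = m} \<in> sets ?N" unfolding \<Omega>_def by measurable
      show "{x \<in> \<Omega>. f x \<le> g x} \<in> sets ?N"
        unfolding \<Omega>_def using f g by (rule borel_measurable_le)
    qed
    also have "{x \<in> \<Omega>. mhat x = m} \<inter> {x \<in> \<Omega>. f x \<le> g x}
        = {x \<in> \<Omega>. mhat x = m \<and> norm (s - proj_estimator n (B m) x) \<le> ?\<rho> x m}"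
      by (auto simp: f_def g_def)
    finally show "{x \<in> \<Omega>. mhat x = m \<and> norm (s - proj_estimator n (B m) x) \<le> ?\<rho> x m} \<in> sets ?N" .
  qed
  finally show ?thesis .
qed

section \<open>Coverage and diameter for a fixed sample size\<close>

text \<open>
  As \<open>6 N / \<beta> > 6 > e\<close>, the first term of the maximum in \<open>x'\<close> always exceeds \<open>2\<close>, so the growth
  condition on \<open>ln (6 * N / \<beta>)\<close> is a condition on \<open>x'\<close>.
\<close>

lemma levels:
  fixes N \<beta> d CM :: real and n :: nat
  assumes N: "1 \<le> N" and \<beta>: "0 < \<beta>" "\<beta> < 1" and h: "2 * d * ln (6 * N / \<beta>) / n \<le> CM" and d: "0 \<le> d"
  defines "x \<equiv> max (2 * ln (2 * N / \<beta>)) 2" and "x' \<equiv> max (2 * ln (6 * N / \<beta>)) 2"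
  shows "x' = 2 * ln (6 * N / \<beta>)" "2 \<le> x" "x \<le> x'" "d * x' / n \<le> CM" "d * x / n \<le> CM"
    "exp (- x' / 2) = \<beta> / (6 * N)" "exp (- x / 2) \<le> \<beta> / (2 * N)"
proof -
  have "3 \<le> 6 * N / \<beta>" using N \<beta> by (simp add: le_divide_eq)
  then have "exp 1 \<le> 6 * N / \<beta>" using exp_le by linarith
  then have "1 \<le> ln (6 * N / \<beta>)"
    using N \<beta> by (subst ln_ge_iff) auto
  then show x': "x' = 2 * ln (6 * N / \<beta>)" by (simp add: x'_def)
  show "2 \<le> x" by (simp add: x_def)
  have "2 * N / \<beta> \<le> 6 * N / \<beta>" using N \<beta> by (intro divide_right_mono) auto
  then have "ln (2 * N / \<beta>) \<le> ln (6 * N / \<beta>)" using N \<beta> by (subst ln_le_cancel_iff) auto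
  then show xx: "x \<le> x'" by (simp add: x_def x'_def)
  show d': "d * x' / n \<le> CM" using h unfolding x' by (simp add: mult_ac)
  have "d * x / n \<le> d * x' / n" using xx d by (intro divide_right_mono mult_left_mono) auto
  then show "d * x / n \<le> CM" using d' by linarith
  have "exp (- x' / 2) = inverse (6 * N / \<beta>)" using N \<beta> unfolding x' by (simp add: exp_minus)
  then show "exp (- x' / 2) = \<beta> / (6 * N)" by simp
  have "exp (- x / 2) \<le> exp (- ln (2 * N / \<beta>))" by (simp add: x_def)
  also have "\<dots> = inverse (2 * N / \<beta>)" using N \<beta> by (simp add: exp_minus)
  finally show "exp (- x / 2) \<le> \<beta> / (2 * N)" by simp
qed

locale model_collection =
  fixes n :: nat and M :: "nat set" and S B B' :: "nat \<Rightarrow> l2 set" and Q :: "(nat \<Rightarrow> real) measure"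
    and C CM M2 Minf :: real
  assumes n: "2 \<le> n" and C: "0 < C" and CM: "0 < CM" and M2: "0 < M2" and Minf: "0 < Minf"
    and fin: "finite M"
    and largest: "\<exists>m\<in>M. S m = ambient M S"
    and bases: "adapted_bases M S B B'"
    and sup_bound: "\<And>m t. m \<in> M \<Longrightarrow> t \<in> S m \<Longrightarrow> sup_norm t \<le> ereal (C * sqrt (real (dim (S m))) * norm t)"
    and scheme: "resampling_scheme n Q"
begin

abbreviation "dA \<equiv> real (dim (ambient M S))"

abbreviation "N \<equiv> real (card M)"

lemma N: "1 \<le> N"
  using fin largest by (auto simp: Suc_le_eq card_gt_0_iff)

lemma basis: "m \<in> M \<Longrightarrow> orthonormal_basis (B m) (S m)"
  and basis': "m \<in> M \<Longrightarrow> orthonormal_basis (B' m) (ambient M S)"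
  and B_subset: "m \<in> M \<Longrightarrow> B m \<subseteq> B' m"
  using bases by (auto simp: adapted_bases_def)

lemma ambient_bound: "t \<in> ambient M S \<Longrightarrow> sup_norm t \<le> ereal (C * sqrt dA * norm t)"
  using largest sup_bound by fastforce

lemma dim_le: "m \<in> M \<Longrightarrow> dim (S m) \<le> dim (ambient M S)"
proof -
  assume m: "m \<in> M"
  have "card (B m) \<le> card (B' m)"
    using basis'[OF m] B_subset[OF m] by (intro card_mono) (auto simp: orthonormal_basis_def)
  then show ?thesis
    using dim_eq_card_orthonormal_basis[OF basis[OF m]] dim_eq_card_orthonormal_basis[OF basis'[OF m]] by simp
qed

definition bias :: "l2 \<Rightarrow> nat \<Rightarrow> real" where
  "bias s m = sqrt (\<Sum>\<psi>\<in>B' m - B m. (inner s \<psi>)\<^sup>2)"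

lemma bias_sq: "(bias s m)\<^sup>2 = (\<Sum>\<psi>\<in>B' m - B m. (inner s \<psi>)\<^sup>2)"
  by (simp add: bias_def sum_nonneg)

lemma sum_coeff_split:
  assumes "m \<in> M"
  shows "(\<Sum>\<psi>\<in>B' m. (inner s \<psi>)\<^sup>2) = (bias s m)\<^sup>2 + (\<Sum>\<psi>\<in>B m. (inner s \<psi>)\<^sup>2)"
  unfolding bias_sq using basis'[OF assms] B_subset[OF assms]
  by (intro sum.subset_diff) (auto simp: orthonormal_basis_def)

lemma bias_le:
  assumes "m \<in> M" "norm (s - orth_proj (S m) s) \<le> e"
  shows "(bias s m)\<^sup>2 \<le> e\<^sup>2"
proof -
  have "(bias s m)\<^sup>2 = (norm (s - orth_proj (S m) s))\<^sup>2 - (norm (s - orth_proj (ambient M S) s))\<^sup>2"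
    using sum_coeff_split[OF assms(1), of s]
    by (simp add: norm_sq_diff_orth_proj[OF basis[OF assms(1)]] norm_sq_diff_orth_proj[OF basis'[OF assms(1)]])
  also have "\<dots> \<le> (norm (s - orth_proj (S m) s))\<^sup>2" by simp
  also have "\<dots> \<le> e\<^sup>2" using assms(2) by (intro power_mono) auto
  finally show ?thesis .
qed

lemma error_decomposition:
  assumes m: "m \<in> M"
  shows "(norm (s - proj_estimator n (B m) x))\<^sup>2
    = (norm (s - orth_proj (ambient M S) s))\<^sup>2 + (bias s m)\<^sup>2 + p_W n Q (B m) x + degenerate_U n s (B m) x"
  using sum_coeff_split[OF m, of s] norm_diff_proj_estimator[OF basis[OF m], of s n x]
    proj_error_eq[OF scheme n, where B = "B m" and x = x and s = s]
  by (simp add: norm_sq_diff_orth_proj[OF basis'[OF m]])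

text \<open>
  The exceptional events: outside \<open>bad_var\<close> the penalty \<open>p\<^sub>W\<close> is close to the error of the
  projection estimator, outside \<open>bad_bias\<close> the estimator \<open>p\<^sub>b\<close> is close to the squared bias.
\<close>

definition bad_var :: "real \<Rightarrow> l2 \<Rightarrow> nat \<Rightarrow> (nat \<Rightarrow> real) set" where
  "bad_var x s m = {y \<in> space (sample_law n s).
     \<kappa>U C CM * dev_scale M2 Minf (real (dim (S m))) * x / n < \<bar>degenerate_U n s (B m) y\<bar>}"

definition bad_bias :: "real \<Rightarrow> l2 \<Rightarrow> nat \<Rightarrow> (nat \<Rightarrow> real) set" where
  "bad_bias x s m =
     {y \<in> space (sample_law n s). \<kappa>U C CM * dev_scale M2 Minf dA * x / n < \<bar>degenerate_U n s (B' m - B m) y\<bar>} \<union>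
     {y \<in> space (sample_law n s).
        bias s m * \<kappa>L C CM * sqrt (real n * x * dev_scale M2 Minf dA) < \<bar>linear_sum n s (B' m - B m) y\<bar>}"

lemma sets_bad: "bad_var x s m \<in> sets (sample_law n s)" "bad_bias x s m \<in> sets (sample_law n s)"
  unfolding bad_var_def bad_bias_def space_sample_law sets_sample_law by measurable

lemma measure_bad_var:
  assumes "is_density s" "norm s \<le> M2" "sup_norm s \<le> ereal Minf" "m \<in> M" "2 \<le> x" "sqrt dA * x / n \<le> CM"
  shows "measure (sample_law n s) (bad_var x s m) \<le> exp (- x / 2)"
  unfolding bad_var_def
proof (rule tails_of_basis(1))
  have "sqrt (real (dim (S m))) * x / n \<le> sqrt dA * x / n"
    using dim_le assms by (intro divide_right_mono mult_right_mono) auto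
  then show "sqrt (real (dim (S m))) * x / n \<le> CM" using assms by linarith
  show "orthonormal_basis (B m) (S m)" using assms by (intro basis)
qed (use assms M2 Minf C CM n sup_bound in auto)

lemma measure_bad_bias:
  assumes "is_density s" "norm s \<le> M2" "sup_norm s \<le> ereal Minf" "m \<in> M" "2 \<le> x" "sqrt dA * x / n \<le> CM"
  shows "measure (sample_law n s) (bad_bias x s m) \<le> 3 * exp (- x / 2)"
proof -
  have "measure (sample_law n s) (bad_bias x s m) \<le> exp (- x / 2) + 2 * exp (- x / 2)"
    unfolding bad_bias_def
  proof (rule order_trans[OF measure_Un_le add_mono])
    show "measure (sample_law n s) {y \<in> space (sample_law n s).
        \<kappa>U C CM * dev_scale M2 Minf dA * x / n < \<bar>degenerate_U n s (B' m - B m) y\<bar>} \<le> exp (- x / 2)"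
      by (rule tails_of_basis(1)[OF _ _ _ _ _ _ basis'[OF assms(4)]])
         (use assms M2 Minf C CM n ambient_bound in auto)
    show "measure (sample_law n s) {y \<in> space (sample_law n s).
        bias s m * \<kappa>L C CM * sqrt (real n * x * dev_scale M2 Minf dA) < \<bar>linear_sum n s (B' m - B m) y\<bar>} \<le> 2 * exp (- x / 2)"
      unfolding bias_def
      by (rule tails_of_basis(2)[OF _ _ _ _ _ _ basis'[OF assms(4)]])
         (use assms M2 Minf C CM n ambient_bound in auto)
    show "{y \<in> space (sample_law n s). \<kappa>U C CM * dev_scale M2 Minf dA * x / n < \<bar>degenerate_U n s (B' m - B m) y\<bar>}
       \<in> sets (sample_law n s)"
      unfolding space_sample_law sets_sample_law by measurable
    show "{y \<in> space (sample_law n s). bias s m * \<kappa>L C CM * sqrt (real n * x * dev_scale M2 Minf dA)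
       < \<bar>linear_sum n s (B' m - B m) y\<bar>} \<in> sets (sample_law n s)"
      unfolding space_sample_law sets_sample_law by measurable
  qed
  then show ?thesis by simp
qed

lemma p_b_deviation_of_good:
  assumes "y \<in> space (sample_law n s)" "y \<notin> bad_bias x s m" "0 \<le> x" "0 < \<epsilon>"
  shows "\<bar>p_b n (B m) (B' m) y - (bias s m)\<^sup>2\<bar>
    \<le> \<epsilon> * (bias s m)\<^sup>2 + \<kappa>B C CM \<epsilon> * dev_scale M2 Minf dA * x / n"
  using assms
  by (intro p_b_deviation[OF n]) (auto simp: bias_def bad_bias_def not_less dev_scale_nonneg M2 Minf)

abbreviation "rho \<eta> \<beta> \<equiv> rho_hat (\<kappa>U C CM) (\<kappa>B C CM) M2 Minf n M S Q B B' \<eta> \<beta>"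

lemma \<kappa>_nonneg: "0 < \<kappa>U C CM" "0 < \<epsilon> \<Longrightarrow> 0 < \<kappa>B C CM \<epsilon>"
proof -
  show U: "0 < \<kappa>U C CM" using C CM by (simp add: \<kappa>U_def)
  show "0 < \<kappa>B C CM \<epsilon>" if "0 < \<epsilon>" using U that by (simp add: \<kappa>B_def add_nonneg_pos)
qed

lemma dev_scale_dA_le: "dev_scale M2 Minf dA \<le> (1 + sqrt (min Minf (M2 * sqrt dA))) * sqrt dA"
  unfolding dev_scale_def eff_dim_def by (intro mult_right_mono add_left_mono real_sqrt_le_mono) auto

text \<open>
  Outside \<open>bad_bias\<close> the deviation bound for \<open>p\<^sub>b\<close> holds for all \<open>\<epsilon>\<close> at once, which is why the squared bias
  is at most the infimum \<open>K_term\<close> and not only at most each of its terms with high probability.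
\<close>

lemma covering_of_good:
  assumes m: "m \<in> M" and \<beta>: "0 < \<beta>" "\<beta> < 1" and y: "y \<in> space (sample_law n s)"
    and good: "y \<notin> bad_var (max (2 * ln (2 * N / \<beta>)) 2) s m"
      "y \<notin> bad_bias (max (2 * ln (6 * N / \<beta>)) 2) s m"
    and \<eta>: "norm (s - orth_proj (ambient M S) s) \<le> \<eta>"
  shows "norm (s - proj_estimator n (B m) y) \<le> rho \<eta> \<beta> y m"
proof -
  let ?x = "max (2 * ln (2 * N / \<beta>)) 2" and ?x' = "max (2 * ln (6 * N / \<beta>)) 2"
  let ?a2 = "(bias s m)\<^sup>2"
  let ?K = "K_term (\<kappa>B C CM) M2 Minf n M S B B' \<beta> y m"
  let ?V = "V_term (\<kappa>U C CM) M2 Minf n M S Q B \<beta> y m"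
  have V: "p_W n Q (B m) y + degenerate_U n s (B m) y \<le> ?V"
    using good(1) y by (simp add: bad_var_def V_term_def Let_def dev_scale_def eff_dim_def mult.assoc)
  have K: "ereal ?a2 \<le> ?K"
    unfolding K_term_def Let_def
  proof (rule le_of_K_term)
    fix \<epsilon> :: real assume \<epsilon>: "\<epsilon> \<in> {0<..<1}"
    let ?R = "\<kappa>B C CM \<epsilon> * (1 + sqrt (min Minf (M2 * sqrt dA))) * (sqrt dA * ?x' / n)"
    have "\<kappa>B C CM \<epsilon> * (dev_scale M2 Minf dA * (?x' / n)) \<le> \<kappa>B C CM \<epsilon> * ((1 + sqrt (min Minf (M2 * sqrt dA))) * sqrt dA * (?x' / n))"
      using \<kappa>_nonneg(2)[of \<epsilon>] \<epsilon> dev_scale_dA_le by (intro mult_left_mono mult_right_mono) auto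
    then have R: "\<kappa>B C CM \<epsilon> * dev_scale M2 Minf dA * ?x' / n \<le> ?R" by (simp add: mult.assoc)
    have "(1 - \<epsilon>) * ?a2 \<le> p_b n (B m) (B' m) y + ?R"
    proof -
      have "0 \<le> ?x'" "0 < \<epsilon>" using \<epsilon> by (auto simp: le_max_iff_disj)
      from p_b_deviation_of_good[OF y good(2) this] R show ?thesis
        unfolding left_diff_distrib abs_le_iff by linarith
    qed
    then have "?a2 \<le> (p_b n (B m) (B' m) y + ?R) / (1 - \<epsilon>)"
      using \<epsilon> by (simp add: pos_le_divide_eq mult.commute)
    then show "?a2 \<le> p_b n (B m) (B' m) y / (1 - \<epsilon>) + \<kappa>B C CM \<epsilon> / (1 - \<epsilon>) *
        (1 + sqrt (min Minf (M2 * sqrt dA))) * (sqrt dA * ?x' / n)"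
      by (simp add: add_divide_distrib mult_ac)
  qed
  have "?K \<noteq> \<infinity>"
  proof -
    have "?K \<le> ereal (p_b n (B m) (B' m) y / (1 - 1/2) + \<kappa>B C CM (1/2) / (1 - 1/2) *
        (1 + sqrt (min Minf (M2 * sqrt dA))) * (sqrt dA * ?x' / n))"
      unfolding K_term_def Let_def by (rule INF_lower) simp
    then show ?thesis by auto
  qed
  with K obtain k where k: "?K = ereal k" "?a2 \<le> k" by (cases ?K) auto
  have "(norm (s - proj_estimator n (B m) y))\<^sup>2 \<le> \<eta>\<^sup>2 + k + ?V"
  proof -
    have "(norm (s - orth_proj (ambient M S) s))\<^sup>2 \<le> \<eta>\<^sup>2" using \<eta> by (intro power_mono) auto
    then show ?thesis using error_decomposition[OF m, of s y] V k by linarith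
  qed
  also have "\<dots> \<le> real_of_ereal (max 0 (ereal (\<eta>\<^sup>2) + ?K + ereal ?V))"
    by (simp add: k(1) max_def)
  finally have "sqrt ((norm (s - proj_estimator n (B m) y))\<^sup>2)
      \<le> sqrt (real_of_ereal (max 0 (ereal (\<eta>\<^sup>2) + ?K + ereal ?V)))"
    by (rule real_sqrt_le_mono)
  then show ?thesis by (simp add: rho_hat_def)
qed

text \<open>
  Each of the \<open>N\<close> models contributes \<open>\<beta> / (2 N)\<close> for \<open>bad_var\<close> and \<open>3 \<beta> / (6 N)\<close> for \<open>bad_bias\<close>.
  Off these events all balls contain \<open>s\<close>, hence so does the selected one, although its index depends
  on the sample.
\<close>

lemma coverage:
  assumes \<beta>: "0 < \<beta>" "\<beta> < 1" and H3: "2 * sqrt dA * ln (6 * N / \<beta>) / n \<le> CM"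
    and s: "s \<in> B2inf M2 Minf \<eta> (ambient M S)" "is_density s"
    and sel: "selector n M (rho \<eta> \<beta>) mhat"
  shows "1 - \<beta> \<le> measure (sample_law n s) {x \<in> space (sample_law n s). s \<in> B_hat n B (rho \<eta> \<beta>) mhat x}"
proof -
  interpret P: prob_space "sample_law n s" by (rule prob_space_sample_law) (rule s)
  let ?x = "max (2 * ln (2 * N / \<beta>)) 2" and ?x' = "max (2 * ln (6 * N / \<beta>)) 2"
  let ?G = "{x \<in> space (sample_law n s). s \<in> B_hat n B (rho \<eta> \<beta>) mhat x}"
  note lev = levels[OF N \<beta> H3 real_sqrt_ge_zero[OF of_nat_0_le_iff]]
  have s': "norm s \<le> M2" "sup_norm s \<le> ereal Minf" "norm (s - orth_proj (ambient M S) s) \<le> \<eta>"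
    using s(1) by (auto simp: B2inf_def)
  let ?bad = "\<Union>m\<in>M. bad_var ?x s m \<union> bad_bias ?x' s m"
  have sG: "?G \<in> sets (sample_law n s)"
    unfolding sets_sample_law space_sample_law
    using scheme n fin basis sel by (intro covering_event_measurable) auto
  have mM: "mhat x \<in> M" if "x \<in> space (sample_law n s)" for x
    using sel that by (auto simp: selector_def space_sample_law is_arg_min_def)
  have "space (sample_law n s) - ?G \<subseteq> ?bad"
  proof
    fix y assume y: "y \<in> space (sample_law n s) - ?G"
    then have ys: "y \<in> space (sample_law n s)" by simp
    show "y \<in> ?bad"
    proof (rule ccontr)
      assume "y \<notin> ?bad"
      then have "y \<notin> bad_var ?x s (mhat y)" "y \<notin> bad_bias ?x' s (mhat y)" using mM[OF ys] by auto
      from covering_of_good[OF mM[OF ys] \<beta> ys this s'(3)] y show False by (simp add: B_hat_def)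
    qed
  qed
  then have "P.prob (space (sample_law n s) - ?G) \<le> P.prob ?bad"
    using fin sets_bad by (intro P.finite_measure_mono) auto
  also have "\<dots> \<le> (\<Sum>m\<in>M. P.prob (bad_var ?x s m \<union> bad_bias ?x' s m))"
    using fin sets_bad by (intro measure_UNION_le) auto
  also have "\<dots> \<le> (\<Sum>m\<in>M. \<beta> / N)"
  proof (rule sum_mono)
    fix m assume m: "m \<in> M"
    have "P.prob (bad_var ?x s m \<union> bad_bias ?x' s m) \<le> P.prob (bad_var ?x s m) + P.prob (bad_bias ?x' s m)"
      by (intro measure_Un_le sets_bad)
    also have "\<dots> \<le> exp (- ?x / 2) + 3 * exp (- ?x' / 2)"
      using s s' m lev(2,3,4,5) by (intro add_mono measure_bad_var measure_bad_bias) auto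
    also have "\<dots> \<le> \<beta> / (2 * N) + 3 * (\<beta> / (6 * N))"
      using lev(6,7) by simp
    also have "\<dots> = \<beta> / N" using N by (simp add: field_simps)
    finally show "P.prob (bad_var ?x s m \<union> bad_bias ?x' s m) \<le> \<beta> / N" .
  qed
  also have "\<dots> = \<beta>" using N by simp
  finally show ?thesis using P.prob_compl[OF sG] by simp
qed

text \<open>
  The infimum in \<open>K_term\<close> is bounded by its value at \<open>\<epsilon> = 1 / 2\<close>, the three levels by a common \<open>X\<close>,
  and all dimensions in the deviation terms by that of the ambient space.
\<close>

lemma rho_sq_le:
  assumes m: "m \<in> M" and y: "y \<in> space (sample_law n s)"
    and good: "y \<notin> bad_bias x s m" "0 \<le> x"
    and ae: "\<And>i. i < n \<Longrightarrow> (\<Sum>\<psi>\<in>B m. (rep_l2 \<psi> (y i))\<^sup>2) \<le> C\<^sup>2 * real (dim (S m))"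
    and X: "0 \<le> X" "x \<le> X" "max (2 * ln (2 * N / \<beta>)) 2 \<le> X" "max (2 * ln (6 * N / \<beta>)) 2 \<le> X"
  shows "(rho \<eta> \<beta> y m)\<^sup>2 \<le> \<eta>\<^sup>2 + 3 * (bias s m)\<^sup>2 + 2 * C\<^sup>2 * real (dim (S m)) / n
    + (4 * \<kappa>B C CM (1/2) + \<kappa>U C CM) * (1 + sqrt Minf) * (sqrt dA * X / n)"
proof -
  let ?k = "\<kappa>B C CM (1/2)" and ?R = "1 + sqrt Minf"
  let ?x = "max (2 * ln (2 * N / \<beta>)) 2" and ?x' = "max (2 * ln (6 * N / \<beta>)) 2"
  let ?r = "1 + sqrt (min Minf (M2 * sqrt dA))"
  let ?K = "K_term (\<kappa>B C CM) M2 Minf n M S B B' \<beta> y m"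
  let ?V = "V_term (\<kappa>U C CM) M2 Minf n M S Q B \<beta> y m"
  let ?W = "\<eta>\<^sup>2 + 3 * (bias s m)\<^sup>2 + 2 * C\<^sup>2 * real (dim (S m)) / n + (4 * ?k + \<kappa>U C CM) * ?R * (sqrt dA * X / n)"
  let ?T = "sqrt dA * X / n"
  have k0: "0 < ?k" "0 < \<kappa>U C CM" by (auto intro: \<kappa>_nonneg)
  have T0: "0 \<le> ?T" using X by simp
  have x0: "0 \<le> ?x" "0 \<le> ?x'" by (auto simp: le_max_iff_disj)
  have R: "?r \<le> ?R" by (intro add_left_mono real_sqrt_le_mono) auto
  have r0: "0 \<le> ?r" "0 \<le> ?R" using Minf M2 by auto
  have dA: "dev_scale M2 Minf dA \<le> ?R * sqrt dA"
    using dev_scale_dA_le R by (meson mult_right_mono order_trans real_sqrt_ge_zero of_nat_0_le_iff)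
  have scaled: "c * z / n \<le> ?R * ?T" if "c \<le> ?R * sqrt dA" "z \<le> X" "0 \<le> z" for c z
  proof -
    have "c * z \<le> (?R * sqrt dA) * X"
      using that r0 by (intro mult_mono) auto
    then show ?thesis by (simp add: divide_right_mono mult.assoc)
  qed
  have collect: "2 * (3 / 2 * u + v * w) + 2 * v * w = 3 * u + 4 * v * w" for u v w :: real
    by (simp add: algebra_simps)
  have pb: "p_b n (B m) (B' m) y \<le> 3 / 2 * (bias s m)\<^sup>2 + ?k * (?R * ?T)"
  proof -
    have "dev_scale M2 Minf dA * x / n \<le> ?R * ?T" by (rule scaled[OF dA X(2) good(2)])
    then have "?k * (dev_scale M2 Minf dA * x / n) \<le> ?k * (?R * ?T)"
      using k0 by (intro mult_left_mono) auto
    then show ?thesis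
      using p_b_deviation_of_good[OF y good, of "1/2"] by (simp add: mult.assoc)
  qed
  let ?kk = "p_b n (B m) (B' m) y / (1 - 1/2) + ?k / (1 - 1/2) * ?r * (sqrt dA * ?x' / n)"
  have K: "?K \<le> ereal ?kk"
    unfolding K_term_def Let_def by (rule INF_lower) simp
  have kk: "?kk \<le> 3 * (bias s m)\<^sup>2 + 4 * ?k * (?R * ?T)"
  proof -
    have "?r * sqrt dA * ?x' / n \<le> ?R * ?T"
      using R x0 X by (intro scaled mult_right_mono) auto
    then have x'T: "2 * ?k * (?r * sqrt dA * ?x' / n) \<le> 2 * ?k * (?R * ?T)"
      using k0 by (intro mult_left_mono) auto
    have "?kk = 2 * p_b n (B m) (B' m) y + 2 * ?k * (?r * sqrt dA * ?x' / n)"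
      by (simp add: algebra_simps add_divide_distrib)
    also have "\<dots> \<le> 2 * (3 / 2 * (bias s m)\<^sup>2 + ?k * (?R * ?T)) + 2 * ?k * (?R * ?T)"
      by (intro add_mono mult_left_mono pb x'T) simp
    also have "\<dots> = 3 * (bias s m)\<^sup>2 + 4 * ?k * (?R * ?T)" by (rule collect)
    finally show ?thesis .
  qed
  have V: "?V \<le> 2 * C\<^sup>2 * real (dim (S m)) / n + \<kappa>U C CM * (?R * ?T)"
  proof -
    let ?d = "real (dim (S m))"
    have "p_W n Q (B m) y \<le> 2 * (C\<^sup>2 * ?d) / n" by (rule p_W_le[OF scheme n ae])
    moreover have "(1 + sqrt (min (min Minf (M2 * sqrt ?d)) ?d)) * sqrt ?d * ?x / n \<le> ?R * ?T"
      using dim_le[OF m] x0 X Minf M2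
      by (intro scaled mult_mono add_left_mono real_sqrt_le_mono) auto
    then have "\<kappa>U C CM * ((1 + sqrt (min (min Minf (M2 * sqrt ?d)) ?d)) * sqrt ?d * ?x / n) \<le> \<kappa>U C CM * (?R * ?T)"
      using k0 by (intro mult_left_mono) auto
    ultimately show ?thesis by (simp add: V_term_def Let_def mult.assoc)
  qed
  have W: "\<eta>\<^sup>2 + ?kk + ?V \<le> ?W"
    using kk V by (simp add: algebra_simps add_divide_distrib)
  have W0: "0 \<le> ?W"
    using k0 r0 T0 Minf by (intro add_nonneg_nonneg mult_nonneg_nonneg) auto
  have "ereal (\<eta>\<^sup>2) + ?K + ereal ?V \<le> ereal (\<eta>\<^sup>2) + ereal ?kk + ereal ?V"
    by (intro add_mono order_refl K)
  also have "\<dots> \<le> ereal ?W" using W by simp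
  finally have Z: "ereal (\<eta>\<^sup>2) + ?K + ereal ?V \<le> ereal ?W" .
  have "real_of_ereal (max 0 (ereal (\<eta>\<^sup>2) + ?K + ereal ?V)) \<le> ?W"
    using Z W0 by (cases "ereal (\<eta>\<^sup>2) + ?K + ereal ?V") (auto simp: max_def)
  moreover have "0 \<le> real_of_ereal (max 0 (ereal (\<eta>\<^sup>2) + ?K + ereal ?V))"
    by (intro real_of_ereal_pos) simp
  ultimately show ?thesis by (simp add: rho_hat_def)
qed

lemma AE_basis_bound:
  assumes "m \<in> M" "is_density s"
  shows "AE y in sample_law n s. \<forall>i<n. (\<Sum>\<psi>\<in>B m. (rep_l2 \<psi> (y i))\<^sup>2) \<le> C\<^sup>2 * real (dim (S m))"
proof (rule AE_sample_law[OF assms(2)])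
  have "AE x in lborel. (\<Sum>\<psi>\<in>B m. (rep_l2 \<psi> x)\<^sup>2) \<le> (C * sqrt (real (dim (S m))))\<^sup>2"
    using basis[OF assms(1)] C sup_bound[OF assms(1)] subspace_span[of "B m"] span_superset[of "B m"]
    by (intro AE_sum_squares_basis_le[where S = "S m"]) (auto simp: orthonormal_basis_def)
  then show "AE x in lborel. (\<Sum>\<psi>\<in>B m. (rep_l2 \<psi> x)\<^sup>2) \<le> C\<^sup>2 * real (dim (S m))"
    by (simp add: power_mult_distrib)
qed

lemma diameter_le_rho:
  assumes sel: "selector n M (rho \<eta> \<beta>) mhat" and m: "m \<in> M" and y: "y \<in> space (sample_law n s)"
  shows "diameter (B_hat n B (rho \<eta> \<beta>) mhat y) \<le> 2 * rho \<eta> \<beta> y m"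
proof -
  have "is_arg_min (rho \<eta> \<beta> y) (\<lambda>m. m \<in> M) (mhat y)"
    using sel y by (simp add: selector_def space_sample_law)
  then have le: "rho \<eta> \<beta> y (mhat y) \<le> rho \<eta> \<beta> y m"
    using m by (auto simp: is_arg_min_def not_less)
  have "0 \<le> rho \<eta> \<beta> y m"
    unfolding rho_hat_def by (intro real_sqrt_ge_zero real_of_ereal_pos) simp
  then show ?thesis
  proof (intro diameter_le)
    fix u v assume "u \<in> B_hat n B (rho \<eta> \<beta>) mhat y" "v \<in> B_hat n B (rho \<eta> \<beta>) mhat y"
    then have "norm (u - proj_estimator n (B (mhat y)) y) \<le> rho \<eta> \<beta> y (mhat y)"
      "norm (v - proj_estimator n (B (mhat y)) y) \<le> rho \<eta> \<beta> y (mhat y)"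
      by (auto simp: B_hat_def)
    then have "norm ((u - proj_estimator n (B (mhat y)) y) - (v - proj_estimator n (B (mhat y)) y))
        \<le> rho \<eta> \<beta> y (mhat y) + rho \<eta> \<beta> y (mhat y)"
      by (rule order_trans[OF norm_triangle_ineq4 add_mono])
    then show "norm (u - v) \<le> 2 * rho \<eta> \<beta> y m" using le by simp
  qed simp
qed

text \<open>
  The factor of \<open>sqrt dA * X / n\<close> in the bound on the squared radius.
\<close>

definition \<kappa>H :: real where
  "\<kappa>H = (4 * \<kappa>B C CM (1/2) + \<kappa>U C CM) * (1 + sqrt Minf)"

lemma \<kappa>H_pos: "0 < \<kappa>H"
  using \<kappa>_nonneg(1) \<kappa>_nonneg(2)[of "1/2"] Minf by (auto simp: \<kappa>H_def intro!: mult_pos_pos add_pos_pos)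

text \<open>
  The logarithms in the radius contain a constant that \<open>L\<close> need not dominate: \<open>L\<close> is close to \<open>0\<close> if there is one
  model and \<open>\<alpha>\<close> and \<open>\<beta>\<close> are close to \<open>1\<close>.  But with one model the ambient space is \<open>S m\<close>, so the
  constant term is at most a multiple of \<open>d\<^sub>m / n\<close>; with two or more models \<open>L \<ge> ln 2\<close>.
\<close>

lemma level_term_le:
  assumes m: "m \<in> M" and ab: "0 < \<alpha>" "\<alpha> < 1" "0 < \<beta>" "\<beta> < 1"
  defines "L \<equiv> ln (N / (\<alpha> * \<beta>))"
  shows "0 \<le> L" "sqrt dA * (10 + 2 * L) / n \<le> 10 * (real (dim (S m)) / n) + 22 * (sqrt dA * L / n)"
proof -
  have ab1: "0 < \<alpha> * \<beta>" "\<alpha> * \<beta> \<le> 1" using ab by (auto intro: mult_le_one)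
  have NL: "N \<le> N / (\<alpha> * \<beta>)" using ab1 N by (simp add: le_divide_eq mult_left_le)
  then have LN: "ln N \<le> L" using N unfolding L_def by (subst ln_le_cancel_iff) auto
  then show L0: "0 \<le> L" using N by (smt (verit) ln_ge_zero)
  have "sqrt dA * (10 + 2 * L) \<le> 10 * real (dim (S m)) + 22 * (sqrt dA * L)"
  proof (cases "card M = 1")
    case True
    then have "ambient M S = S m" using largest m by (metis card_1_singletonE singletonD)
    moreover have "sqrt d \<le> d" if "d = 0 \<or> 1 \<le> d" for d :: real
      using that by (auto intro: real_le_lsqrt simp: power2_eq_square)
    ultimately have "sqrt dA \<le> real (dim (S m))" by (metis Suc_le_eq neq0_conv of_nat_0 of_nat_1 of_nat_le_iff One_nat_def)
    moreover have "0 \<le> sqrt dA * L" using L0 by simp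
    ultimately show ?thesis by (simp add: algebra_simps)
  next
    case False
    then have "2 \<le> card M" using N by simp
    then have "ln 2 \<le> ln N" by (subst ln_le_cancel_iff) auto
    then have "2 / 3 \<le> L" using LN ln2_ge_two_thirds by linarith
    then have "sqrt dA * (10 + 2 * L) \<le> sqrt dA * (22 * L)" by (intro mult_left_mono) auto
    then show ?thesis by simp
  qed
  then have "sqrt dA * (10 + 2 * L) / n \<le> (10 * real (dim (S m)) + 22 * (sqrt dA * L)) / n"
    by (rule divide_right_mono) simp
  then show "sqrt dA * (10 + 2 * L) / n \<le> 10 * (real (dim (S m)) / n) + 22 * (sqrt dA * L / n)"
    by (simp add: add_divide_distrib)
qed

lemma level_le:
  assumes ab: "0 < \<alpha>" "\<alpha> < 1" "0 < \<beta>" "\<beta> < 1"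
  shows "2 * ln (6 * N / \<beta>) \<le> 10 + 2 * ln (N / (\<alpha> * \<beta>))"
proof -
  have "N / \<beta> \<le> N / (\<alpha> * \<beta>)" using ab N by (intro divide_left_mono) auto
  then have "ln (N / \<beta>) \<le> ln (N / (\<alpha> * \<beta>))" using ab N by (subst ln_le_cancel_iff) auto
  moreover have "ln (6 * N / \<beta>) = ln 6 + ln (N / \<beta>)"
    using ab N by (subst ln_mult_pos[symmetric]) auto
  moreover have "ln 6 \<le> (6 - 1 :: real)" by (rule ln_le_minus_one) simp
  ultimately show ?thesis by simp
qed

text \<open>
  The exceptional event for the level \<open>\<alpha>\<close> only concerns the bias estimator of the given \<open>m\<close>.
  The factor \<open>8\<close> is \<open>4\<close> from the squared diameter times \<open>2\<close> from a sum bounded by a maximum.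
\<close>

lemma diameter_bound:
  assumes \<beta>: "0 < \<beta>" "\<beta> < 1" and H3: "2 * sqrt dA * ln (6 * N / \<beta>) / n \<le> CM"
    and \<alpha>: "0 < \<alpha>" "\<alpha> < 1" and H3': "2 * sqrt dA * ln (6 * N / \<alpha>) / n \<le> CM"
    and sel: "selector n M (rho \<eta> \<beta>) mhat" and m: "m \<in> M" and em: "0 < em" and \<eta>: "0 < \<eta>"
  shows "(Delta_risk n (B2inf M2 Minf em (S m)) \<alpha> (B_hat n B (rho \<eta> \<beta>) mhat))\<^sup>2
    \<le> ennreal (8 * (3 + 2 * C\<^sup>2 + 22 * \<kappa>H) * max (em\<^sup>2 + real (dim (S m)) / n)
        (\<eta>\<^sup>2 + sqrt dA * ln (N / (\<alpha> * \<beta>)) / n))"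
proof -
  let ?L = "ln (N / (\<alpha> * \<beta>))"
  let ?A = "em\<^sup>2 + real (dim (S m)) / n" and ?E = "\<eta>\<^sup>2 + sqrt dA * ?L / n"
  let ?c = "3 + 2 * C\<^sup>2 + 22 * \<kappa>H"
  let ?X = "10 + 2 * ?L"
  let ?x = "max (2 * ln (6 * N / \<alpha>)) 2"
  let ?Bh = "B_hat n B (rho \<eta> \<beta>) mhat"
  note lev = levels[OF N \<beta> H3 real_sqrt_ge_zero[OF of_nat_0_le_iff]]
  note lev' = levels[OF N \<alpha> H3' real_sqrt_ge_zero[OF of_nat_0_le_iff]]
  note L = level_term_le[OF m \<alpha> \<beta>]
  have X: "0 \<le> ?X" using L(1) by simp
  have xX: "?x \<le> ?X" using level_le[OF \<beta> \<alpha>] unfolding lev'(1) by (simp add: mult.commute)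
  have xX2: "max (2 * ln (6 * N / \<beta>)) 2 \<le> ?X" using level_le[OF \<alpha> \<beta>] unfolding lev(1) .
  have xX1: "max (2 * ln (2 * N / \<beta>)) 2 \<le> ?X" using lev(3) xX2 by linarith
  have c0: "0 < ?c" using \<kappa>H_pos by (intro add_pos_pos add_pos_nonneg) auto
  have A0: "0 < ?A" using em by (simp add: add_pos_nonneg)
  have E0: "0 \<le> ?E" using L(1) by simp
  define \<delta> where "\<delta> = sqrt (8 * ?c * max ?A ?E)"
  have \<delta>: "0 < \<delta>" using c0 A0 by (simp add: \<delta>_def less_max_iff_disj)
  have bnd: "emeasure (sample_law n s) {x \<in> space (sample_law n s). \<delta> < diameter (?Bh x)} \<le> ennreal \<alpha>"
    if s: "s \<in> B2inf M2 Minf em (S m)" "is_density s" for s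
  proof -
    interpret P: prob_space "sample_law n s" by (rule prob_space_sample_law) (rule s)
    have s': "norm s \<le> M2" "sup_norm s \<le> ereal Minf" "norm (s - orth_proj (S m) s) \<le> em"
      using s(1) by (auto simp: B2inf_def)
    have "AE y in sample_law n s. y \<in> {x \<in> space (sample_law n s). \<delta> < diameter (?Bh x)} \<longrightarrow> y \<in> bad_bias ?x s m"
      using AE_basis_bound[OF m s(2)] AE_space
    proof eventually_elim
      case (elim y)
      show ?case
      proof (rule impI, rule ccontr)
        assume d: "y \<in> {x \<in> space (sample_law n s). \<delta> < diameter (?Bh x)}" and good: "y \<notin> bad_bias ?x s m"
        have "(rho \<eta> \<beta> y m)\<^sup>2 \<le> \<eta>\<^sup>2 + 3 * (bias s m)\<^sup>2 + 2 * C\<^sup>2 * real (dim (S m)) / n + \<kappa>H * (sqrt dA * ?X / n)"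
          unfolding \<kappa>H_def using elim X xX xX1 xX2 m good
          by (intro rho_sq_le[where x = ?x]) (auto simp: le_max_iff_disj)
        also have "\<dots> \<le> \<eta>\<^sup>2 + 3 * em\<^sup>2 + 2 * C\<^sup>2 * real (dim (S m)) / n
            + \<kappa>H * (10 * (real (dim (S m)) / n) + 22 * (sqrt dA * ?L / n))"
          using bias_le[OF m s'(3)] L(2) \<kappa>H_pos by (intro add_mono mult_left_mono) auto
        also have "\<dots> \<le> ?c * (?A + ?E)"
        proof -
          have nn: "0 \<le> \<eta>\<^sup>2" "0 \<le> em\<^sup>2" "0 \<le> real (dim (S m)) / n" "0 \<le> sqrt dA * ?L / n"
            "0 \<le> C\<^sup>2" "0 \<le> \<kappa>H" using L(1) \<kappa>H_pos by auto
          have "g + 3 * e + 2 * c2 * p + h * (10 * p + 22 * q) \<le> (3 + 2 * c2 + 22 * h) * (e + p + (g + q))"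
            if "0 \<le> g" "0 \<le> e" "0 \<le> p" "0 \<le> q" "0 \<le> c2" "0 \<le> h" for g e p q c2 h :: real
          proof -
            have "0 \<le> c2 * e" "0 \<le> c2 * g" "0 \<le> c2 * q" "0 \<le> h * e" "0 \<le> h * g" "0 \<le> h * p" "0 \<le> h * q"
              using that by auto
            then show ?thesis using that by (simp add: algebra_simps)
          qed
          from this[OF nn] show ?thesis by simp
        qed
        also have "\<dots> \<le> ?c * (2 * max ?A ?E)"
        proof (rule mult_left_mono)
          have "u + v \<le> 2 * max u v" for u v :: real by (simp add: max_def)
          then show "?A + ?E \<le> 2 * max ?A ?E" .
        qed (use c0 in simp)
        finally have "(rho \<eta> \<beta> y m)\<^sup>2 \<le> ?c * (2 * max ?A ?E)" .
        moreover have "4 * r \<le> 8 * c * t" if "r \<le> c * (2 * t)" for r c t :: real using that by simp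
        ultimately have "4 * (rho \<eta> \<beta> y m)\<^sup>2 \<le> 8 * ?c * max ?A ?E" by blast
        then have "2 * rho \<eta> \<beta> y m \<le> \<delta>"
          unfolding \<delta>_def by (intro real_le_rsqrt) (simp add: power_mult_distrib)
        then show False using diameter_le_rho[OF sel m elim(2)] d by simp
      qed
    qed
    then have "emeasure (sample_law n s) {x \<in> space (sample_law n s). \<delta> < diameter (?Bh x)}
        \<le> emeasure (sample_law n s) (bad_bias ?x s m)"
      using sets_bad by (intro emeasure_mono_AE) auto
    also have "\<dots> = ennreal (P.prob (bad_bias ?x s m))" by (rule P.emeasure_eq_measure)
    also have "\<dots> \<le> ennreal \<alpha>"
    proof (rule ennreal_leI)
      have "P.prob (bad_bias ?x s m) \<le> 3 * exp (- ?x / 2)"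
        using s s' m lev'(2,3,4) by (intro measure_bad_bias) auto
      also have "\<dots> = 3 * (\<alpha> / (6 * N))" using lev'(6) by simp
      also have "\<dots> \<le> \<alpha>" using N \<alpha> by (simp add: divide_le_eq)
      finally show "P.prob (bad_bias ?x s m) \<le> \<alpha>" .
    qed
    finally show ?thesis .
  qed
  have "Delta_risk n (B2inf M2 Minf em (S m)) \<alpha> ?Bh \<le> ennreal \<delta>"
    unfolding Delta_risk_def using bnd \<delta> by (intro Inf_lower imageI) (auto intro!: SUP_least)
  then have "(Delta_risk n (B2inf M2 Minf em (S m)) \<alpha> ?Bh)\<^sup>2 \<le> (ennreal \<delta>)\<^sup>2"
    by (intro power_mono) auto
  also have "\<dots> = ennreal (\<delta>\<^sup>2)" using \<delta> by (simp add: ennreal_power)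
  also have "\<delta>\<^sup>2 = 8 * ?c * max ?A ?E" using c0 A0 by (simp add: \<delta>_def le_max_iff_disj less_imp_le)
  finally show ?thesis .
qed

end

section \<open>The confidence balls\<close>

theorem theorem4p1:
  fixes C\<^sub>1 CM :: real
  assumes "0 < C\<^sub>1" and "0 < CM"
  shows "\<exists>\<kappa>v \<kappa>b. 0 < \<kappa>v \<and> (\<forall>\<epsilon>\<in>{0<..<1}. 0 < \<kappa>b \<epsilon>) \<and>
    (\<forall>M2>0. \<forall>Minf>0. \<exists>\<kappa>>0.
      \<forall>(M :: nat \<Rightarrow> nat set) (S :: nat \<Rightarrow> nat \<Rightarrow> l2 set) (Q :: nat \<Rightarrow> (nat \<Rightarrow> real) measure)
        (B :: nat \<Rightarrow> nat \<Rightarrow> l2 set) (B' :: nat \<Rightarrow> nat \<Rightarrow> l2 set) (\<beta> :: real) (\<eta> :: real)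
        (mhat :: nat \<Rightarrow> (nat \<Rightarrow> real) \<Rightarrow> nat).
        let \<rho> = (\<lambda>n. rho_hat \<kappa>v \<kappa>b M2 Minf n (M n) (S n) (Q n) (B n) (B' n) \<eta> \<beta>);
            Bh = (\<lambda>n. B_hat n (B n) (\<rho> n) (mhat n));
            Sn = (\<lambda>n. ambient (M n) (S n))
        in
        models M S \<longrightarrow> H1 M S \<longrightarrow> H2 C\<^sub>1 M S \<longrightarrow>
        0 < \<beta> \<longrightarrow> \<beta> < 1 \<longrightarrow> H3 CM M S \<beta> \<longrightarrow> 0 < \<eta> \<longrightarrow>
        (\<forall>n\<ge>2. resampling_scheme n (Q n)) \<longrightarrow>
        (\<forall>n\<ge>2. adapted_bases (M n) (S n) (B n) (B' n)) \<longrightarrow>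
        (\<forall>n\<ge>2. selector n (M n) (\<rho> n) (mhat n)) \<longrightarrow>
          (\<forall>n\<ge>2. \<forall>s\<in>B2inf M2 Minf \<eta> (Sn n). is_density s \<longrightarrow>
             1 - \<beta> \<le> measure (sample_law n s) {x \<in> space (sample_law n s). s \<in> Bh n x}) \<and>
          (\<forall>n\<ge>2. \<forall>m\<in>M n. \<forall>\<eta>m>0. \<forall>\<alpha>\<in>{0<..<1}. H3 CM M S \<alpha> \<longrightarrow>
             (Delta_risk n (B2inf M2 Minf \<eta>m (S n m)) \<alpha> (Bh n))\<^sup>2 \<le>
               ennreal (\<kappa> * max (\<eta>m\<^sup>2 + real (dim (S n m)) / real n)
                 (\<eta>\<^sup>2 + sqrt (real (dim (Sn n))) * ln (real (card (M n)) / (\<alpha> * \<beta>)) / real n))))"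
proof (rule exI[of _ "\<kappa>U C\<^sub>1 CM"], rule exI[of _ "\<kappa>B C\<^sub>1 CM"], intro conjI ballI allI impI)
  show "0 < \<kappa>U C\<^sub>1 CM" using assms by (simp add: \<kappa>U_def)
  then show "0 < \<kappa>B C\<^sub>1 CM \<epsilon>" if "\<epsilon> \<in> {0<..<1}" for \<epsilon>
    using that by (simp add: \<kappa>B_def add_nonneg_pos)
next
  fix M2 Minf :: real
  assume pos: "0 < M2" "0 < Minf"
  define \<kappa> where "\<kappa> = 8 * (3 + 2 * C\<^sub>1\<^sup>2 + 22 * ((4 * \<kappa>B C\<^sub>1 CM (1/2) + \<kappa>U C\<^sub>1 CM) * (1 + sqrt Minf)))"
  have \<kappa>0: "0 < \<kappa>"
  proof -
    have "0 < \<kappa>U C\<^sub>1 CM" using assms by (simp add: \<kappa>U_def)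
    moreover from this have "0 < \<kappa>B C\<^sub>1 CM (1/2)" by (simp add: \<kappa>B_def add_nonneg_pos)
    ultimately show ?thesis using pos by (auto simp: \<kappa>_def intro!: add_pos_nonneg)
  qed
  {
    fix M :: "nat \<Rightarrow> nat set" and S :: "nat \<Rightarrow> nat \<Rightarrow> l2 set" and Q :: "nat \<Rightarrow> (nat \<Rightarrow> real) measure"
      and B B' :: "nat \<Rightarrow> nat \<Rightarrow> l2 set" and \<beta> \<eta> :: real and mhat :: "nat \<Rightarrow> (nat \<Rightarrow> real) \<Rightarrow> nat"
    let ?\<rho> = "\<lambda>n. rho_hat (\<kappa>U C\<^sub>1 CM) (\<kappa>B C\<^sub>1 CM) M2 Minf n (M n) (S n) (Q n) (B n) (B' n) \<eta> \<beta>"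
    let ?Bh = "\<lambda>n. B_hat n (B n) (?\<rho> n) (mhat n)"
    let ?Sn = "\<lambda>n. ambient (M n) (S n)"
    assume H: "H1 M S" "H2 C\<^sub>1 M S" "H3 CM M S \<beta>"
      and \<beta>: "0 < \<beta>" "\<beta> < 1" and \<eta>: "0 < \<eta>"
      and scheme: "\<forall>n\<ge>2. resampling_scheme n (Q n)"
      and bases: "\<forall>n\<ge>2. adapted_bases (M n) (S n) (B n) (B' n)"
      and sel: "\<forall>n\<ge>2. selector n (M n) (?\<rho> n) (mhat n)"
    have coll: "model_collection n (M n) (S n) (B n) (B' n) (Q n) C\<^sub>1 CM M2 Minf" if "2 \<le> n" for n
      using that assms pos H scheme bases
      by unfold_locales (auto simp: H1_def H2_def H3_def)
    have level: "2 * sqrt (real (dim (?Sn n))) * ln (6 * real (card (M n)) / \<gamma>) / real n \<le> CM"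
      if "2 \<le> n" "H3 CM M S \<gamma>" for n \<gamma>
      using that by (simp add: H3_def)
    have "1 - \<beta> \<le> measure (sample_law n s) {x \<in> space (sample_law n s). s \<in> ?Bh n x}"
      if "2 \<le> n" "s \<in> B2inf M2 Minf \<eta> (?Sn n)" "is_density s" for n s
      by (rule model_collection.coverage[OF coll]) (use that \<beta> level H sel in auto)
    moreover have "(Delta_risk n (B2inf M2 Minf \<eta>m (S n m)) \<alpha> (?Bh n))\<^sup>2 \<le>
        ennreal (\<kappa> * max (\<eta>m\<^sup>2 + real (dim (S n m)) / real n)
          (\<eta>\<^sup>2 + sqrt (real (dim (?Sn n))) * ln (real (card (M n)) / (\<alpha> * \<beta>)) / real n))"
      if "2 \<le> n" "m \<in> M n" "0 < \<eta>m" "\<alpha> \<in> {0<..<1}" "H3 CM M S \<alpha>" for n m \<eta>m \<alpha>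
      using model_collection.diameter_bound[OF coll[OF that(1)] \<beta> level[OF that(1) H(3)] _ _ level[OF that(1,5)]
          sel[rule_format, OF that(1)] that(2,3) \<eta>] that(4)
      unfolding \<kappa>_def model_collection.\<kappa>H_def[OF coll[OF that(1)]] by simp
    ultimately have "(\<forall>n\<ge>2. \<forall>s\<in>B2inf M2 Minf \<eta> (?Sn n). is_density s \<longrightarrow>
         1 - \<beta> \<le> measure (sample_law n s) {x \<in> space (sample_law n s). s \<in> ?Bh n x}) \<and>
      (\<forall>n\<ge>2. \<forall>m\<in>M n. \<forall>\<eta>m>0. \<forall>\<alpha>\<in>{0<..<1}. H3 CM M S \<alpha> \<longrightarrow>
         (Delta_risk n (B2inf M2 Minf \<eta>m (S n m)) \<alpha> (?Bh n))\<^sup>2 \<le>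
           ennreal (\<kappa> * max (\<eta>m\<^sup>2 + real (dim (S n m)) / real n)
             (\<eta>\<^sup>2 + sqrt (real (dim (?Sn n))) * ln (real (card (M n)) / (\<alpha> * \<beta>)) / real n)))"
      by blast
  }
  note main = this
  show "\<exists>\<kappa>>0. \<forall>(M :: nat \<Rightarrow> nat set) (S :: nat \<Rightarrow> nat \<Rightarrow> l2 set) (Q :: nat \<Rightarrow> (nat \<Rightarrow> real) measure)
        (B :: nat \<Rightarrow> nat \<Rightarrow> l2 set) (B' :: nat \<Rightarrow> nat \<Rightarrow> l2 set) (\<beta> :: real) (\<eta> :: real)
        (mhat :: nat \<Rightarrow> (nat \<Rightarrow> real) \<Rightarrow> nat).
        let \<rho> = (\<lambda>n. rho_hat (\<kappa>U C\<^sub>1 CM) (\<kappa>B C\<^sub>1 CM) M2 Minf n (M n) (S n) (Q n) (B n) (B' n) \<eta> \<beta>);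
            Bh = (\<lambda>n. B_hat n (B n) (\<rho> n) (mhat n));
            Sn = (\<lambda>n. ambient (M n) (S n))
        in
        models M S \<longrightarrow> H1 M S \<longrightarrow> H2 C\<^sub>1 M S \<longrightarrow>
        0 < \<beta> \<longrightarrow> \<beta> < 1 \<longrightarrow> H3 CM M S \<beta> \<longrightarrow> 0 < \<eta> \<longrightarrow>
        (\<forall>n\<ge>2. resampling_scheme n (Q n)) \<longrightarrow>
        (\<forall>n\<ge>2. adapted_bases (M n) (S n) (B n) (B' n)) \<longrightarrow>
        (\<forall>n\<ge>2. selector n (M n) (\<rho> n) (mhat n)) \<longrightarrow>
          (\<forall>n\<ge>2. \<forall>s\<in>B2inf M2 Minf \<eta> (Sn n). is_density s \<longrightarrow>
             1 - \<beta> \<le> measure (sample_law n s) {x \<in> space (sample_law n s). s \<in> Bh n x}) \<and>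
          (\<forall>n\<ge>2. \<forall>m\<in>M n. \<forall>\<eta>m>0. \<forall>\<alpha>\<in>{0<..<1}. H3 CM M S \<alpha> \<longrightarrow>
             (Delta_risk n (B2inf M2 Minf \<eta>m (S n m)) \<alpha> (Bh n))\<^sup>2 \<le>
               ennreal (\<kappa> * max (\<eta>m\<^sup>2 + real (dim (S n m)) / real n)
                 (\<eta>\<^sup>2 + sqrt (real (dim (Sn n))) * ln (real (card (M n)) / (\<alpha> * \<beta>)) / real n)))"
    unfolding Let_def
    by (intro exI[of _ \<kappa>] conjI[OF \<kappa>0] allI impI) (rule main; assumption)
qed

end
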